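(* Let $k$ and $n$ be positive integers such that $2k\leqslant n<(k+1)^3$. Then the polynomial $P_{n,k}(x)=\sum_{j=0}^{k}\binom{n}{j}x^j$ is irreducible over $\mathbb{Q}$.
   Context: $P_{n,k}(x)$ is the truncation at degree $k$ of the binomial expansion of $(1+x)^n$. *)

theory Defs
  imports Complex_Main "HOL-Computational_Algebra.Computational_Algebra"
begin

definition trunc_binom_poly :: "nat \<Rightarrow> nat \<Rightarrow> rat poly" where
  "trunc_binom_poly n k = (\<Sum>j=0..k. monom (of_nat (n choose j)) j)"

end

theory Submission
  imports Defs
begin

text \<open>
Replacing \<open>x\<close> by \<open>x - 1\<close> turns the coefficient of \<open>x ^ j\<close> into \<open>\<plusminus> (k choose j) * K / (n - j)\<close>
with \<open>K\<close> independent of \<open>j\<close>. If a prime \<open>p > k\<close> divides \<open>n - l\<close> exactly \<open>e\<close> times, where \<open>l \<le> k\<close>, then the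
\<open>p\<close>-adic Newton polygon consists of an edge of length \<open>l\<close> and an edge of length \<open>k - l\<close>, both of height \<open>e\<close>, and
by Dumas' theorem the degree of a factor is \<open>s + t\<close> with \<open>l dvd e * s\<close> and \<open>(k - l) dvd e * t\<close>. The bound
\<open>n < (k + 1) ^ 3\<close> forces \<open>e \<le> 2\<close>. So if there is a factor of degree \<open>d \<le> k / 2\<close>, then \<open>n - l\<close> can have a prime
factor exceeding \<open>k\<close> only for at most four values of \<open>l\<close>, or for even \<open>l\<close> if \<open>2 * d = k\<close>.

In the style of Erdos' proof of Sylvester's theorem this makes \<open>n choose k\<close> (or, if \<open>2 * d = k\<close>, the product of the
\<open>n - l\<close> over odd \<open>l\<close>) so small that \<open>k\<close> is bounded: a prime \<open>p \<le> k\<close> contributes at most \<open>n\<close>, and at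
most \<open>p\<close> if \<open>p\<^sup>2 > n\<close>. For the remaining small \<open>k\<close> the numbers \<open>n\<close> such that both \<open>n\<close> and \<open>n - k\<close> are
\<open>k\<close>-smooth are enumerated. The eight pairs \<open>(n, k)\<close> with \<open>k \<ge> 3\<close> where the primes above \<open>k\<close> do not
suffice are treated with primes up to \<open>k\<close>, or by excluding a linear factor.
\<close>

section \<open>Newton polygons with two edges\<close>

text \<open>For \<open>p > k\<close> at most one of \<open>n, n - 1, ..., n - k\<close> is a
  multiple of \<open>p\<close>, and \<open>p\<close> divides no \<open>k choose j\<close>; the shift
  by -1 makes exactly these facts visible in the coefficients. With \<open>e = 1\<close> a degree
  \<open>d \<le> k / 2\<close> can only be \<open>l\<close> or \<open>k - l\<close>; with
  \<open>e = 2\<close> it can also be \<open>l / 2\<close>, \<open>(k - l) / 2\<close>, or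
  \<open>k / 2\<close>. The last possibility is the obstacle: if \<open>2 * d = k\<close>, about
  half of all positions may carry a squared prime, so their number has no constant bound. For the
  other degrees \<open>n choose k\<close> is compared with \<open>n ^ (c + pi(k))\<close>, where
  \<open>c = 2\<close> if \<open>n < (k + 1)^2\<close>, since no square of a prime above
  \<open>k\<close> fits there, and \<open>c = 4\<close> otherwise. As \<open>pi(k)\<close> is
  roughly at most \<open>k / 4\<close>, the trivial lower bound \<open>(n / k)^k\<close> suffices
  for large \<open>k\<close> once \<open>n^2 \<ge> k^3\<close>. Below that, primes above the square
  root of \<open>n\<close> must be bounded by a Chebyshev estimate, and for \<open>n < 3 * k\<close>
  the decisive point is that primes between \<open>n / 3\<close> and \<open>k\<close> cancel from
  \<open>n choose k\<close>.\<close>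

definition newton_weight :: "int \<Rightarrow> int \<Rightarrow> int \<Rightarrow> int poly \<Rightarrow> nat \<Rightarrow> int" where
  "newton_weight p a b g i = a * int (multiplicity p (coeff g i)) + b * int i"

text \<open>For \<open>a > 0\<close> the indices of least weight lie on the supporting line of slope
  \<open>-b / a\<close> of the Newton polygon. The sign \<open>\<sigma>\<close> selects an end of
  that edge: 1 the right one, -1 the left one. This describes vertices without constructing the
  polygon.\<close>

definition newton_vertex :: "int \<Rightarrow> int \<Rightarrow> int \<Rightarrow> int \<Rightarrow> int poly \<Rightarrow> nat \<Rightarrow> bool" where
  "newton_vertex p a b \<sigma> g i \<longleftrightarrow> coeff g i \<noteq> 0 \<and>
     (\<forall>j. coeff g j \<noteq> 0 \<longrightarrow> newton_weight p a b g i \<le> newton_weight p a b g j \<and>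
        (\<sigma> * int i < \<sigma> * int j \<longrightarrow> newton_weight p a b g i < newton_weight p a b g j))"

lemma newton_vertex_exists:
  assumes "g \<noteq> 0"
  shows "\<exists>i. newton_vertex p a b \<sigma> g i"
proof -
  let ?w = "newton_weight p a b g"
  define S where "S = {i. coeff g i \<noteq> 0}"
  have "S \<subseteq> {..degree g}" unfolding S_def by (auto simp: le_degree)
  hence fin: "finite S" by (rule finite_subset) simp
  have ne: "S \<noteq> {}" using assms unfolding S_def by (auto simp: poly_eq_iff)
  define m where "m = Min (?w ` S)"
  have mle: "m \<le> ?w j" if "j \<in> S" for j unfolding m_def using fin that by simp
  define T where "T = {i \<in> S. ?w i = m}"
  have "m \<in> ?w ` S" unfolding m_def using fin ne by (intro Min_in) auto
  hence "T \<noteq> {}" unfolding T_def by auto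
  moreover have finT: "finite T" using fin unfolding T_def by simp
  ultimately have "Max ((\<lambda>i. \<sigma> * int i) ` T) \<in> (\<lambda>i. \<sigma> * int i) ` T"
    by (intro Max_in) auto
  then obtain i where i: "i \<in> T" "\<sigma> * int i = Max ((\<lambda>i. \<sigma> * int i) ` T)" by auto
  have top: "\<sigma> * int j \<le> \<sigma> * int i" if "j \<in> T" for j
    unfolding i(2) using finT that by (intro Max_ge) auto
  have "newton_vertex p a b \<sigma> g i"
    unfolding newton_vertex_def
  proof (intro conjI allI impI)
    show "coeff g i \<noteq> 0" using i(1) unfolding T_def S_def by auto
    have wi: "?w i = m" using i(1) unfolding T_def by auto
    fix j assume "coeff g j \<noteq> 0"
    hence j: "j \<in> S" unfolding S_def by auto
    show "?w i \<le> ?w j" using mle[OF j] wi by simp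
    assume "\<sigma> * int i < \<sigma> * int j"
    hence "j \<notin> T" using top[of j] by auto
    hence "?w j \<noteq> m" using j unfolding T_def by auto
    thus "?w i < ?w j" using mle[OF j] wi by simp
  qed
  thus ?thesis ..
qed

lemma newton_vertex_unique:
  assumes "newton_vertex p a b \<sigma> g i" "newton_vertex p a b \<sigma> g j" "\<sigma> \<noteq> 0"
  shows "i = j"
proof -
  have "\<not> \<sigma> * int i < \<sigma> * int j" "\<not> \<sigma> * int j < \<sigma> * int i"
    using assms(1,2) unfolding newton_vertex_def by fastforce+
  thus ?thesis using assms(3) by simp
qed

text \<open>This is additivity of Newton polygons. Weights add under multiplication, and among the
  products contributing to index \<open>i + j\<close> every pair other than \<open>(i, j)\<close>
  moves one of its two indices in the direction of \<open>\<sigma>\<close>, where the weight is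
  strictly larger. Hence one term has strictly least valuation and nothing cancels it.\<close>

lemma newton_vertex_mult:
  assumes p: "prime p" and a: "a > 0" and \<sigma>: "\<sigma> \<noteq> 0"
    and g: "newton_vertex p a b \<sigma> g i" and h: "newton_vertex p a b \<sigma> h j"
  shows "newton_vertex p a b \<sigma> (g * h) (i + j)"
proof -
  let ?v = "\<lambda>q i. int (multiplicity p (coeff q i))"
  define W where "W = newton_weight p a b g i + newton_weight p a b h j"
  have ge: "W \<le> a * (?v g r + ?v h s) + b * int (r + s)"
    if "coeff g r \<noteq> 0" "coeff h s \<noteq> 0" for r s
    using g h that unfolding newton_vertex_def W_def newton_weight_def
    by (smt (verit, ccfv_threshold) distrib_left of_nat_add)
  have gt: "W < a * (?v g r + ?v h s) + b * int (r + s)"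
    if "coeff g r \<noteq> 0" "coeff h s \<noteq> 0" "\<sigma> * int i < \<sigma> * int r \<or> \<sigma> * int j < \<sigma> * int s" for r s
  proof -
    have "newton_weight p a b g i \<le> newton_weight p a b g r" "newton_weight p a b h j \<le> newton_weight p a b h s"
      "newton_weight p a b g i < newton_weight p a b g r \<or> newton_weight p a b h j < newton_weight p a b h s"
      using g h that unfolding newton_vertex_def by auto
    thus ?thesis unfolding W_def newton_weight_def by (auto simp: algebra_simps)
  qed
  have nz: "coeff g i \<noteq> 0" "coeff h j \<noteq> 0" using g h unfolding newton_vertex_def by auto
  have W0: "W = a * (?v g i + ?v h j) + b * int (i + j)"
    unfolding W_def newton_weight_def by (simp add: algebra_simps)
  have pu: "\<not> is_unit p" "p \<noteq> 0" using p by auto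
  have dvd_term: "p ^ V dvd coeff g r * coeff h s"
    if "coeff g r \<noteq> 0 \<Longrightarrow> coeff h s \<noteq> 0 \<Longrightarrow> int V \<le> ?v g r + ?v h s" for r s V
  proof (cases "coeff g r = 0 \<or> coeff h s = 0")
    case False
    hence "int V \<le> ?v g r + ?v h s" using that by blast
    hence "V \<le> multiplicity p (coeff g r) + multiplicity p (coeff h s)" by linarith
    hence "p ^ V dvd p ^ (multiplicity p (coeff g r) + multiplicity p (coeff h s))"
      by (rule le_imp_power_dvd)
    also have "\<dots> dvd coeff g r * coeff h s"
      unfolding power_add by (intro mult_dvd_mono multiplicity_dvd)
    finally show ?thesis .
  qed auto
  define v0 where "v0 = multiplicity p (coeff g i) + multiplicity p (coeff h j)"
  have main: "coeff (g * h) (i + j) \<noteq> 0 \<and> multiplicity p (coeff (g * h) (i + j)) = v0"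
  proof -
    define R where "R = (\<Sum>r\<in>{..i+j}-{i}. coeff g r * coeff h (i + j - r))"
    have "coeff (g * h) (i + j) = coeff g i * coeff h j + R"
      unfolding coeff_mult R_def by (subst sum.remove[of _ i]) auto
    moreover have "p ^ Suc v0 dvd R" unfolding R_def
    proof (rule dvd_sum, rule dvd_term)
      fix r assume r: "r \<in> {..i+j}-{i}" and n0: "coeff g r \<noteq> 0" "coeff h (i + j - r) \<noteq> 0"
      have sm: "r + (i + j - r) = i + j" using r by auto
      have "\<sigma> * int i < \<sigma> * int r \<or> \<sigma> * int j < \<sigma> * int (i + j - r)"
      proof -
        have e: "int (i + j - r) = int j + (int i - int r)" using r by auto
        have "\<sigma> * int i \<noteq> \<sigma> * int r" using r \<sigma> by simp
        thus ?thesis unfolding e distrib_left right_diff_distrib by linarith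
      qed
      from gt[OF n0 this] have "a * (?v g i + ?v h j) < a * (?v g r + ?v h (i + j - r))"
        unfolding W0 sm by simp
      hence "?v g i + ?v h j < ?v g r + ?v h (i + j - r)" using a by simp
      thus "int (Suc v0) \<le> ?v g r + ?v h (i + j - r)" unfolding v0_def by simp
    qed
    moreover
    have mm: "multiplicity p (coeff g i * coeff h j) = v0" unfolding v0_def
      using p nz by (subst prime_elem_multiplicity_mult_distrib) auto
    have d0: "p ^ v0 dvd coeff g i * coeff h j" using mm multiplicity_dvd by metis
    have d1: "\<not> p ^ Suc v0 dvd coeff g i * coeff h j"
      using mm nz pu by (subst power_dvd_iff_le_multiplicity) auto
    moreover note d0 d1
    ultimately have eq: "coeff (g * h) (i + j) = coeff g i * coeff h j + R" and R: "p ^ Suc v0 dvd R"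
      by auto
    have R0: "p ^ v0 dvd R" using R by (rule dvd_trans[rotated]) (simp add: le_imp_power_dvd)
    have "p ^ v0 dvd coeff (g * h) (i + j)" unfolding eq using d0 R0 by (rule dvd_add)
    moreover have "\<not> p ^ Suc v0 dvd coeff (g * h) (i + j)"
      unfolding eq using d1 dvd_add_left_iff[OF R] by blast
    ultimately have "p ^ v0 dvd coeff (g * h) (i + j)" "\<not> p ^ Suc v0 dvd coeff (g * h) (i + j)" .
    thus ?thesis by (metis dvd_0_right multiplicity_eqI)
  qed
  have low: "W \<le> a * ?v (g * h) N + b * int N"
    and lows: "\<sigma> * int (i + j) < \<sigma> * int N \<Longrightarrow> W < a * ?v (g * h) N + b * int N"
    if n0: "coeff (g * h) N \<noteq> 0" for N
  proof -
    define V where "V = multiplicity p (coeff (g * h) N)"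
    have nd: "\<not> p ^ Suc V dvd (\<Sum>r\<le>N. coeff g r * coeff h (N - r))"
      unfolding V_def coeff_mult[symmetric] using n0 pu by (subst power_dvd_iff_le_multiplicity) auto
    have "\<exists>r\<in>{..N}. \<not> p ^ Suc V dvd coeff g r * coeff h (N - r)"
    proof (rule ccontr)
      assume "\<not> ?thesis"
      hence "p ^ Suc V dvd (\<Sum>r\<le>N. coeff g r * coeff h (N - r))" by (intro dvd_sum) blast
      thus False using nd by contradiction
    qed
    then obtain r where r: "r \<le> N" "\<not> p ^ Suc V dvd coeff g r * coeff h (N - r)" by auto
    hence n1: "coeff g r \<noteq> 0" "coeff h (N - r) \<noteq> 0" by auto
    have "\<not> int (Suc V) \<le> ?v g r + ?v h (N - r)" using dvd_term[of r "N - r" "Suc V"] r(2) by blast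
    hence "?v g r + ?v h (N - r) \<le> int V" by simp
    hence le: "a * (?v g r + ?v h (N - r)) \<le> a * int V" using a by simp
    have sm: "r + (N - r) = N" using r by simp
    show "W \<le> a * ?v (g * h) N + b * int N" using ge[OF n1] le unfolding sm V_def by simp
    assume less: "\<sigma> * int (i + j) < \<sigma> * int N"
    have N: "int N = int r + int (N - r)" using r by simp
    have "\<sigma> * int i + \<sigma> * int j < \<sigma> * int r + \<sigma> * int (N - r)"
      using less unfolding N of_nat_add distrib_left .
    hence "\<sigma> * int i < \<sigma> * int r \<or> \<sigma> * int j < \<sigma> * int (N - r)" by linarith
    from gt[OF n1 this] show "W < a * ?v (g * h) N + b * int N" using le unfolding sm V_def by simp
  qed
  have "newton_weight p a b (g * h) (i + j) = W"
    unfolding newton_weight_def W0 using main by (simp add: v0_def)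
  thus ?thesis unfolding newton_vertex_def using main low lows
    unfolding newton_weight_def by metis
qed

text \<open>The Newton polygon of \<open>f\<close> consists of one edge over \<open>[0, l]\<close> and one over \<open>[l, k]\<close>;
  \<open>s\<close> and \<open>degree g - s\<close> are the lengths of the parts of these edges contributed by \<open>g\<close>.\<close>

lemma dumas_two_edges:
  fixes p :: int and f g h :: "int poly"
  assumes p: "prime p" and fgh: "f = g * h" and degf: "degree f = k" and lk: "l \<le> k" and e: "e > 0"
    and fl: "coeff f l \<noteq> 0" "multiplicity p (coeff f l) = c"
    and ge: "\<And>j. j \<le> k \<Longrightarrow> j \<noteq> l \<Longrightarrow> coeff f j \<noteq> 0 \<Longrightarrow> c + e \<le> multiplicity p (coeff f j)"
    and f0: "l > 0 \<Longrightarrow> coeff f 0 \<noteq> 0 \<and> multiplicity p (coeff f 0) = c + e"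
    and fk: "l < k \<Longrightarrow> multiplicity p (coeff f k) = c + e"
  obtains s t where "degree g = s + t" "s \<le> l" "t \<le> k - l" "l dvd e * s" "(k - l) dvd e * t"
proof -
  have f_nz: "f \<noteq> 0" using fl by auto
  hence nz: "g \<noteq> 0" "h \<noteq> 0" using fgh by auto
  have degsum: "degree g + degree h = k" using nz fgh degf degree_mult_eq by metis
  have lek: "j \<le> k" if "coeff f j \<noteq> 0" for j using that degf le_degree by auto
  have ex: "\<exists>i j. newton_vertex p a b \<sigma> g i \<and> newton_vertex p a b \<sigma> h j \<and> i + j = m"
    if "newton_vertex p a b \<sigma> f m" "a > 0" "\<sigma> \<noteq> 0" for a b \<sigma> m
  proof -
    obtain i j where "newton_vertex p a b \<sigma> g i" "newton_vertex p a b \<sigma> h j"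
      using newton_vertex_exists nz by metis
    thus ?thesis using newton_vertex_mult[OF p that(2,3)] that(1) newton_vertex_unique that(3) fgh
      by metis
  qed
  \<comment> \<open>With \<open>b = 0\<close> the supporting line is horizontal. Its only contact
    point is \<open>l\<close>, so both ends coincide and any \<open>\<sigma>\<close> is
    allowed.\<close>
  have A: "newton_vertex p 1 0 \<sigma> f l" for \<sigma>
    unfolding newton_vertex_def newton_weight_def
  proof (intro conjI allI impI)
    fix j assume n: "coeff f j \<noteq> 0"
    show "1 * int (multiplicity p (coeff f l)) + 0 * int l \<le> 1 * int (multiplicity p (coeff f j)) + 0 * int j"
      using ge[OF lek[OF n] _ n] fl by (cases "j = l") auto
    assume "\<sigma> * int l < \<sigma> * int j"
    hence "j \<noteq> l" by auto
    from ge[OF lek[OF n] this n] show "1 * int (multiplicity p (coeff f l)) + 0 * int l < 1 * int (multiplicity p (coeff f j)) + 0 * int j"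
      using e fl by simp
  qed (use fl in auto)
  obtain s sh where s: "newton_vertex p 1 0 1 g s" "newton_vertex p 1 0 1 h sh" "s + sh = l"
    using ex[OF A[of 1]] by auto
  have v_le: "multiplicity p (coeff q s) \<le> multiplicity p (coeff q j)"
    if "newton_vertex p 1 0 \<sigma> q s" "coeff q j \<noteq> 0" for q s j \<sigma>
    using that unfolding newton_vertex_def newton_weight_def by auto
  have s_nz: "coeff g s \<noteq> 0" "coeff h sh \<noteq> 0" using s unfolding newton_vertex_def by auto
  have s_deg: "s \<le> degree g" "sh \<le> degree h" using s_nz le_degree by auto

  have left: "l dvd e * s"
  proof (cases "l = 0")
    case True thus ?thesis using s by simp
  next
    case False
    hence l: "l > 0" by simp
    have wl: "newton_weight p (int l) (int e) f l = int l * int (c + e)"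
      and w0: "newton_weight p (int l) (int e) f 0 = int l * int (c + e)"
      using fl f0[OF l] unfolding newton_weight_def by (auto simp: algebra_simps)
    have wgt: "int l * int (c + e) < newton_weight p (int l) (int e) f j"
      if "coeff f j \<noteq> 0" "j \<noteq> l" "j \<noteq> 0" for j
    proof -
      have "int l * int (c + e) \<le> int l * int (multiplicity p (coeff f j))"
        using ge[OF lek[OF that(1)] that(2,1)] by (intro mult_left_mono) auto
      moreover have "int e * int j > 0" using e that by simp
      ultimately show ?thesis unfolding newton_weight_def by linarith
    qed
    have "newton_vertex p (int l) (int e) 1 f l" unfolding newton_vertex_def wl
      using wgt w0 wl fl by (smt (verit) mult_1 l of_nat_0 of_nat_less_0_iff)
    from ex[OF this] l obtain i1 j1 where
      1: "newton_vertex p (int l) (int e) 1 g i1" "newton_vertex p (int l) (int e) 1 h j1" "i1 + j1 = l"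
      by auto
    have "newton_vertex p (int l) (int e) (-1) f 0" unfolding newton_vertex_def w0
      using wgt w0 wl f0[OF l] by (smt (verit) mult_minus1 l of_nat_0 of_nat_less_0_iff)
    from ex[OF this] l obtain i0 j0 where
      0: "newton_vertex p (int l) (int e) (-1) g i0" "newton_vertex p (int l) (int e) (-1) h j0" "i0 + j0 = 0"
      by auto
    \<comment> \<open>To the right of the lowest point the valuation cannot drop while the linear
      term grows, so the right end of the descending edge lies at or before it. The ends for
      \<open>g\<close> and \<open>h\<close> add up to \<open>l\<close>, as do the lowest points,
      which forces equality.\<close>
    have le: "i \<le> r" if v: "newton_vertex p (int l) (int e) 1 q i" and r: "newton_vertex p 1 0 1 q r" for q i r
    proof -
      have nz: "coeff q i \<noteq> 0" "coeff q r \<noteq> 0" using v r unfolding newton_vertex_def by auto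
      have "newton_weight p (int l) (int e) q i \<le> newton_weight p (int l) (int e) q r"
        using v nz unfolding newton_vertex_def by auto
      moreover have "int l * int (multiplicity p (coeff q r)) \<le> int l * int (multiplicity p (coeff q i))"
        using v_le[OF r nz(1)] by (intro mult_left_mono) auto
      ultimately have "int e * int i \<le> int e * int r" unfolding newton_weight_def by linarith
      thus ?thesis using e by simp
    qed
    have "i1 \<le> s" "j1 \<le> sh" using le 1 s by auto
    hence i1: "i1 = s" using 1 s by simp
    have i0: "i0 = 0" using 0 by simp
    have "newton_weight p (int l) (int e) g s = newton_weight p (int l) (int e) g 0"
      using 0(1) 1(1) unfolding i1 i0 newton_vertex_def by (meson order_antisym)
    hence "int e * int s = int l * (int (multiplicity p (coeff g 0)) - int (multiplicity p (coeff g s)))"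
      unfolding newton_weight_def by (simp add: algebra_simps)
    hence "int l dvd int (e * s)" by simp
    thus ?thesis by (simp only: int_dvd_int_iff)
  qed

  have right: "(k - l) dvd e * (degree g - s)"
  proof (cases "l = k")
    case True thus ?thesis using s s_deg degsum by simp
  next
    case False
    hence l: "l < k" using lk by simp
    define m where "m = k - l"
    have m: "m > 0" "int k = int l + int m" unfolding m_def using l by auto
    have kn: "coeff f k \<noteq> 0" using f_nz degf by auto
    \<comment> \<open>Mirror image of the left edge: the rising edge has slope \<open>e / m\<close>,
      hence the weight with \<open>b = - e\<close>. It takes the same value at \<open>l\<close> and
      \<open>k\<close>.\<close>
    have wl: "newton_weight p (int m) (- int e) f l = int m * int c - int e * int l"
      and wk: "newton_weight p (int m) (- int e) f k = int m * int c - int e * int l"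
      using fl fk[OF l] m unfolding newton_weight_def by (auto simp: algebra_simps)
    have wgt: "int m * int c - int e * int l < newton_weight p (int m) (- int e) f j"
      if "coeff f j \<noteq> 0" "j \<noteq> l" "j \<noteq> k" for j
    proof -
      have "int m * int (c + e) \<le> int m * int (multiplicity p (coeff f j))"
        using ge[OF lek[OF that(1)] that(2,1)] by (intro mult_left_mono) auto
      moreover have "int e * int j < int e * int k" using e that lek[OF that(1)] by simp
      ultimately show ?thesis unfolding newton_weight_def m(2) by (simp add: algebra_simps)
    qed
    have "newton_vertex p (int m) (- int e) (-1) f l" unfolding newton_vertex_def wl
      using wgt wk wl fl l by (smt (verit) mult_minus1 of_nat_less_iff)
    from ex[OF this] m obtain i1 j1 where
      1: "newton_vertex p (int m) (- int e) (-1) g i1" "newton_vertex p (int m) (- int e) (-1) h j1" "i1 + j1 = l"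
      by auto
    have "newton_vertex p (int m) (- int e) 1 f k" unfolding newton_vertex_def wk
      using wgt wk wl kn l by (smt (verit) mult_1 of_nat_less_iff)
    from ex[OF this] m obtain i0 j0 where
      0: "newton_vertex p (int m) (- int e) 1 g i0" "newton_vertex p (int m) (- int e) 1 h j0" "i0 + j0 = k"
      by auto
    have le: "r \<le> i" if v: "newton_vertex p (int m) (- int e) (-1) q i" and r: "newton_vertex p 1 0 1 q r" for q i r
    proof -
      have nz: "coeff q i \<noteq> 0" "coeff q r \<noteq> 0" using v r unfolding newton_vertex_def by auto
      have "newton_weight p (int m) (- int e) q i \<le> newton_weight p (int m) (- int e) q r"
        using v nz unfolding newton_vertex_def by auto
      moreover have "int m * int (multiplicity p (coeff q r)) \<le> int m * int (multiplicity p (coeff q i))"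
        using v_le[OF r nz(1)] by (intro mult_left_mono) auto
      ultimately have "int e * int r \<le> int e * int i" unfolding newton_weight_def by linarith
      thus ?thesis using e by simp
    qed
    have "s \<le> i1" "sh \<le> j1" using le 1 s by auto
    hence i1: "i1 = s" using 1 s by simp
    have "i0 \<le> degree g" "j0 \<le> degree h" using 0 le_degree unfolding newton_vertex_def by auto
    hence i0: "i0 = degree g" using 0 degsum by simp
    have "newton_weight p (int m) (- int e) g s = newton_weight p (int m) (- int e) g (degree g)"
      using 0(1) 1(1) unfolding i1 i0 newton_vertex_def by (meson order_antisym)
    hence "int e * int (degree g - s) = int m * (int (multiplicity p (coeff g (degree g))) - int (multiplicity p (coeff g s)))"
      unfolding newton_weight_def using s_deg by (simp add: algebra_simps of_nat_diff)
    hence "int m dvd int (e * (degree g - s))" by simp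
    thus ?thesis unfolding m_def by (simp only: int_dvd_int_iff)
  qed
  show thesis
    by (rule that[of s "degree g - s"]) (use left right s s_deg degsum in auto)
qed

section \<open>From rational to integral factorizations\<close>

lemma rat_poly_clear_denominators:
  fixes g :: "rat poly"
  obtains N :: int and g' :: "int poly" where "N \<noteq> 0" "smult (of_int N) g = map_poly of_int g'"
proof (induction g arbitrary: thesis)
  case 0
  show ?case by (rule 0[of 1 0]) auto
next
  case (pCons c g)
  obtain N g' where Ng: "N \<noteq> 0" "smult (of_int N) g = map_poly of_int g'" using pCons.IH by blast
  obtain a b where ab: "quotient_of c = (a, b)" by fastforce
  have b: "b > 0" and c: "c = of_int a / of_int b"
    using quotient_of_denom_pos[OF ab] quotient_of_div[OF ab] by auto
  have "map_poly of_int (smult b g') = smult (of_int b) (map_poly of_int g' :: rat poly)"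
    by (intro poly_eqI) (simp add: coeff_map_poly)
  moreover have "smult (rat_of_int (b * N)) g = smult (of_int b) (smult (of_int N) g)" by simp
  ultimately have "smult (of_int (b * N)) (pCons c g) = map_poly of_int (pCons (N * a) (smult b g'))"
    unfolding smult_pCons Ng(2) using b by (simp add: map_poly_pCons c)
  thus ?case using pCons.prems[of "b * N"] b Ng(1) by simp
qed

lemma map_poly_of_int_mult:
  "map_poly of_int (f * g :: int poly) = (map_poly of_int f * map_poly of_int g :: 'a :: {comm_ring_1, ring_char_0} poly)"
  by (intro poly_eqI) (simp add: coeff_map_poly coeff_mult)

text \<open>Keeping the common factor \<open>N\<close> takes the place of Gauss's lemma: multiplying
  by a constant raises all valuations equally and leaves the edges of the Newton polygon
  unchanged.\<close>

lemma rat_factor_imp_int_factor: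
  fixes f :: "int poly" and g h :: "rat poly"
  assumes "map_poly of_int f = g * h"
  obtains N g' h' where "N \<noteq> 0" "smult N f = g' * h'" "degree g' = degree g"
proof -
  obtain M g' where g: "M \<noteq> 0" "smult (of_int M) g = map_poly of_int g'"
    using rat_poly_clear_denominators by blast
  obtain N h' where h: "N \<noteq> 0" "smult (of_int N) h = map_poly of_int h'"
    using rat_poly_clear_denominators by blast
  have "map_poly of_int (g' * h') = smult (rat_of_int M * of_int N) (map_poly of_int f)"
    unfolding map_poly_of_int_mult g(2)[symmetric] h(2)[symmetric] assms by (simp add: mult.commute)
  also have "\<dots> = map_poly of_int (smult (M * N) f)"
    by (intro poly_eqI) (simp add: coeff_map_poly)
  finally have "smult (M * N) f = g' * h'"
    unfolding poly_eq_iff by (simp add: coeff_map_poly) (metis of_int_eq_iff of_int_mult)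
  moreover have "degree (map_poly rat_of_int g') = degree g'" by (rule degree_map_poly) auto
  hence "degree g' = degree g" using g by (metis degree_smult_eq of_int_eq_0_iff)
  ultimately show thesis using that[of "M * N" g' h'] g h by simp
qed

section \<open>The coefficients of the shifted polynomial\<close>

definition int_trunc_binom_poly :: "nat \<Rightarrow> nat \<Rightarrow> int poly" where
  "int_trunc_binom_poly n k = (\<Sum>j=0..k. monom (of_nat (n choose j)) j)"

lemma trunc_binom_poly_conv: "trunc_binom_poly n k = map_poly of_int (int_trunc_binom_poly n k)"
  unfolding trunc_binom_poly_def int_trunc_binom_poly_def
  by (intro poly_eqI) (simp add: coeff_map_poly coeff_sum if_distrib cong: if_cong)

lemma coeff_int_trunc_binom_poly: "coeff (int_trunc_binom_poly n k) j = (if j \<le> k then int (n choose j) else 0)"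
  unfolding int_trunc_binom_poly_def by (simp add: coeff_sum)

lemma degree_int_trunc_binom_poly: "k \<le> n \<Longrightarrow> degree (int_trunc_binom_poly n k) = k"
  by (intro antisym degree_le le_degree) (auto simp: coeff_int_trunc_binom_poly)

lemma degree_trunc_binom_poly: "k \<le> n \<Longrightarrow> degree (trunc_binom_poly n k) = k"
  unfolding trunc_binom_poly_conv by (subst degree_map_poly) (auto simp: degree_int_trunc_binom_poly)

text \<open>Expanding the powers of \<open>x - 1\<close> and using \<open>(n choose m) * (m choose
  j) = (n choose j) * ((n - j) choose (m - j))\<close> leaves an alternating partial sum of a row of
  Pascal's triangle. Such a sum telescopes to a single binomial coefficient of the previous row; the
  induction on \<open>k\<close> carries out the telescoping.\<close>

lemma coeff_shifted_trunc_binom_poly: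
  assumes "k < n" "j \<le> k"
  shows "coeff (pcompose (int_trunc_binom_poly n k) [:-1, 1:]) j =
    (-1) ^ (k - j) * int ((n choose j) * ((n - j - 1) choose (k - j)))"
  using assms
proof (induction k)
  case 0
  thus ?case by (simp add: int_trunc_binom_poly_def)
next
  case (Suc k)
  have pm: "pcompose (monom c m) q = smult c (q ^ m)" for c :: int and m q
    by (induction m) (simp_all add: monom_0 monom_Suc pcompose_pCons)
  have rec: "pcompose (int_trunc_binom_poly n (Suc k)) [:-1, 1:] =
      pcompose (int_trunc_binom_poly n k) [:-1, 1:] + smult (int (n choose Suc k)) ([:-1, 1:] ^ Suc k)"
    unfolding int_trunc_binom_poly_def by (simp add: pcompose_add pm)
  show ?case
  proof (cases "j = Suc k")
    case True
    have "degree (pcompose (int_trunc_binom_poly n k) [:-1, 1:]) = k"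
      using Suc by (simp add: degree_pcompose degree_int_trunc_binom_poly)
    thus ?thesis unfolding rec using True
      by (simp add: coeff_eq_0 coeff_linear_poly_power del: power_Suc)
  next
    case False
    hence j: "j \<le> k" using Suc by simp
    have "(n choose Suc k) * (Suc k choose j) = (n choose j) * ((n - j) choose (Suc k - j))"
      using Suc j by (intro choose_mult) auto
    also have "n - j = Suc (n - j - 1)" using Suc by simp
    also have "Suc k - j = Suc (k - j)" using j by simp
    also have "(Suc (n - j - 1)) choose (Suc (k - j)) =
        ((n - j - 1) choose (k - j)) + ((n - j - 1) choose (Suc (k - j)))" by simp
    finally have eq: "int (n choose Suc k) * int (Suc k choose j) =
        int (n choose j) * (int ((n - j - 1) choose (k - j)) + int ((n - j - 1) choose (Suc (k - j))))"
      by (metis of_nat_mult of_nat_add)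
    have "coeff (pcompose (int_trunc_binom_poly n (Suc k)) [:-1, 1:]) j =
       (-1) ^ (k - j) * int ((n choose j) * ((n - j - 1) choose (k - j))) +
       int (n choose Suc k) * (int (Suc k choose j) * (-1) ^ (Suc k - j))"
      unfolding rec using Suc j by (simp add: coeff_linear_poly_power del: power_Suc binomial_Suc_Suc)
    also have "Suc k - j = Suc (k - j)" using j by simp
    finally have "coeff (pcompose (int_trunc_binom_poly n (Suc k)) [:-1, 1:]) j =
       (-1) ^ (k - j) * (int (n choose j) * int ((n - j - 1) choose (k - j)) -
       int (n choose Suc k) * int (Suc k choose j))"
      by (simp add: algebra_simps del: binomial_Suc_Suc)
    thus ?thesis unfolding eq using j by (simp add: algebra_simps Suc_diff_le)
  qed
qed

lemma shifted_coeff_times: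
  assumes "k < n" "j \<le> k"
  shows "(n - j) * ((n choose j) * ((n - j - 1) choose (k - j))) = (k choose j) * ((n choose k) * (n - k))"
proof -
  have "(n - j) * ((n - j - 1) choose (k - j)) = (n - j - (k - j)) * ((n - j) choose (k - j))"
    by (rule binomial_absorb_comp[symmetric])
  moreover have "(n choose k) * (k choose j) = (n choose j) * ((n - j) choose (k - j))"
    using assms by (intro choose_mult) auto
  moreover have "n - j - (k - j) = n - k" using assms by simp
  ultimately show ?thesis by (metis mult.assoc mult.commute)
qed

lemma multiplicity_int_of_nat: "prime p \<Longrightarrow> multiplicity (int p) (int a) = multiplicity p a"
  unfolding multiplicity_def by (simp flip: of_nat_power)

lemma prime_not_dvd_binomial:
  fixes p :: nat
  assumes "prime p" "k < p" "j \<le> k"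
  shows "\<not> p dvd k choose j"
proof
  assume "p dvd k choose j"
  hence "p dvd fact k" using binomial_fact_lemma[OF assms(3)] by (metis dvd_mult)
  thus False using assms by (simp add: prime_dvd_fact_iff)
qed

text \<open>The polynomial shifted by \<open>-1\<close> has the coefficients
  \<open>\<plusminus> (k choose j) * K / (n - j)\<close> with \<open>K\<close> independent of \<open>j\<close>.\<close>

theorem trunc_binom_poly_factor_degree:
  fixes p :: nat
  assumes kn: "k < n" and lk: "l \<le> k" and p: "prime p" "k < p" and dvd: "p dvd n - l"
    and fac: "trunc_binom_poly n k = g * h"
  obtains s t where "degree g = s + t" "s \<le> l" "t \<le> k - l"
    "l dvd multiplicity p (n - l) * s" "(k - l) dvd multiplicity p (n - l) * t"
proof -
  obtain N g' h' where N: "N \<noteq> 0" "smult N (int_trunc_binom_poly n k) = g' * h'" "degree g' = degree g"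
    using rat_factor_imp_int_factor[of "int_trunc_binom_poly n k" g h] fac trunc_binom_poly_conv by metis
  let ?q = "[:-1, 1:] :: int poly"
  let ?f = "pcompose (int_trunc_binom_poly n k) ?q"
  let ?F = "smult N ?f"
  let ?v = "\<lambda>x. multiplicity (int p) x"
  have F: "?F = pcompose g' ?q * pcompose h' ?q"
    using N(2) by (metis pcompose_smult pcompose_mult)
  have degF: "degree ?F = k" using N(1) kn by (simp add: degree_pcompose degree_int_trunc_binom_poly)
  define K where "K = (n choose k) * (n - k)"
  have K: "K \<noteq> 0" unfolding K_def using kn by simp
  have cf: "coeff ?F j \<noteq> 0 \<and> ?v (coeff ?F j) + multiplicity p (n - j) = ?v N + multiplicity p K"
    if j: "j \<le> k" for j
  proof -
    let ?c = "(n choose j) * ((n - j - 1) choose (k - j))"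
    have eq: "(n - j) * ?c = (k choose j) * K" unfolding K_def using shifted_coeff_times[OF kn j] .
    have nz: "?c \<noteq> 0" using eq K j by (metis binomial_eq_0_iff mult_eq_0_iff not_le)
    have c: "coeff ?F j = N * ((-1) ^ (k - j) * int ?c)"
      using coeff_shifted_trunc_binom_poly[OF kn j] by simp
    have c0: "coeff ?F j \<noteq> 0" unfolding c using nz N(1) by simp
    have "?v ((-1) ^ (k - j) * int ?c) = multiplicity p ?c"
      by (cases "even (k - j)") (simp_all add: multiplicity_int_of_nat p del: of_nat_mult)
    moreover have "?v (coeff ?F j) = ?v N + ?v ((-1) ^ (k - j) * int ?c)"
      unfolding c using N(1) nz p by (intro prime_elem_multiplicity_mult_distrib) auto
    moreover have "multiplicity p ?c + multiplicity p (n - j) = multiplicity p ((n - j) * ?c)"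
      using nz p kn j by (subst prime_elem_multiplicity_mult_distrib) auto
    moreover have "\<dots> = multiplicity p (k choose j) + multiplicity p K"
      unfolding eq using K j p by (subst prime_elem_multiplicity_mult_distrib) auto
    moreover have "multiplicity p (k choose j) = 0"
      using prime_not_dvd_binomial[OF p j] by (simp add: not_dvd_imp_multiplicity_0)
    ultimately show ?thesis using c0 by simp
  qed
  define e where "e = multiplicity p (n - l)"
  have e: "e > 0" unfolding e_def using dvd p kn lk
    by (metis multiplicity_gt_zero_iff not_prime_unit zero_less_diff order.strict_trans1 less_numeral_extra(3))
  \<comment> \<open>Two multiples of \<open>p\<close> among these numbers would differ by a positive
    number at most \<open>k\<close>, which is less than \<open>p\<close>.\<close>
  have other: "multiplicity p (n - j) = 0" if "j \<le> k" "j \<noteq> l" for j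
  proof (rule not_dvd_imp_multiplicity_0, rule notI)
    assume a: "p dvd n - j"
    have "p dvd (if j < l then l - j else j - l)"
      using dvd_diff_nat[OF a dvd] dvd_diff_nat[OF dvd a] kn that lk by (auto split: if_splits)
    moreover have "0 < (if j < l then l - j else j - l)" "(if j < l then l - j else j - l) < p"
      using that lk p(2) by auto
    ultimately show False by (meson nat_dvd_not_less)
  qed
  define c where "c = ?v (coeff ?F l)"
  \<comment> \<open>All coefficients except that at \<open>l\<close> have the same valuation, so the
    polygon has the shape of a V with its tip at \<open>l\<close>.\<close>
  have ce: "?v (coeff ?F j) = c + e" if "j \<le> k" "j \<noteq> l" for j
    using cf[OF lk] cf[OF that(1)] other[OF that] unfolding c_def e_def by simp
  obtain s t where "degree (pcompose g' ?q) = s + t" "s \<le> l" "t \<le> k - l" "l dvd e * s" "(k - l) dvd e * t"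
    by (rule dumas_two_edges[of "int p" ?F _ _ k l e c]) (use F degF lk e cf[OF lk] ce cf p c_def in auto)
  thus thesis using that N(3) unfolding e_def by (simp add: degree_pcompose)
qed

section \<open>Irreducibility criteria and the exceptional pairs\<close>

lemma rat_poly_irreducibleI:
  fixes f :: "'a :: field poly"
  assumes "degree f > 0"
    and "\<And>g h. f = g * h \<Longrightarrow> 0 < degree g \<Longrightarrow> 2 * degree g \<le> degree f \<Longrightarrow> False"
  shows "irreducible f"
proof (rule irreducibleI)
  show "f \<noteq> 0" using assms(1) by auto
  thus "\<not> f dvd 1" using assms(1) by (simp add: is_unit_iff_degree)
  fix g h assume f: "f = g * h"
  hence nz: "g \<noteq> 0" "h \<noteq> 0" using assms(1) by auto
  hence deg: "degree f = degree g + degree h" using f degree_mult_eq by auto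
  show "g dvd 1 \<or> h dvd 1"
  proof (rule ccontr)
    assume "\<not> ?thesis"
    hence "degree g > 0" "degree h > 0" using nz by (auto simp: is_unit_iff_degree)
    thus False using assms(2)[OF f] assms(2)[of h g] f deg by (cases "degree g \<le> degree h") (auto simp: mult.commute)
  qed
qed

lemma irreducible_pcompose_linearD:
  fixes f :: "'a :: field poly"
  assumes "irreducible (pcompose f [:a, 1:])" "degree f > 0"
  shows "irreducible f"
proof (rule irreducibleI)
  show "f \<noteq> 0" using assms(2) by auto
  thus "\<not> f dvd 1" using assms(2) by (simp add: is_unit_iff_degree)
  fix g h assume f: "f = g * h"
  hence nz: "g \<noteq> 0" "h \<noteq> 0" using \<open>f \<noteq> 0\<close> by auto
  have "pcompose g [:a, 1:] dvd 1 \<or> pcompose h [:a, 1:] dvd 1"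
    using assms(1) f by (intro irreducibleD) (simp_all add: pcompose_mult)
  moreover have "pcompose g [:a, 1:] \<noteq> 0" "pcompose h [:a, 1:] \<noteq> 0"
    using nz by (simp_all add: pcompose_eq_0_iff)
  ultimately show "g dvd 1 \<or> h dvd 1" using nz by (simp add: is_unit_iff_degree degree_pcompose)
qed

text \<open>The Newton polygon of \<open>f\<close> is a single edge: \<open>l\<close> is \<open>0\<close> or the degree.\<close>

lemma irreducible_dumas:
  fixes f :: "int poly" and p :: int
  assumes p: "prime p" and e: "e > 0" "coprime e (degree f)" and deg: "degree f > 0"
    and l: "l \<in> {0, degree f}" "m \<in> {0, degree f}" "m \<noteq> l"
    and fl: "\<not> p dvd coeff f l" and fm: "multiplicity p (coeff f m) = e" "coeff f m \<noteq> 0"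
    and ge: "\<And>j. j \<noteq> l \<Longrightarrow> j \<le> degree f \<Longrightarrow> p ^ e dvd coeff f j"
  shows "irreducible (map_poly rat_of_int f)"
proof (rule rat_poly_irreducibleI)
  have degr: "degree (map_poly rat_of_int f) = degree f" by (rule degree_map_poly) auto
  show "degree (map_poly rat_of_int f) > 0" using deg degr by simp
  fix g h assume fac: "map_poly rat_of_int f = g * h" "0 < degree g"
    "2 * degree g \<le> degree (map_poly rat_of_int f)"
  obtain N g' h' where N: "N \<noteq> 0" "smult N f = g' * h'" "degree g' = degree g"
    using rat_factor_imp_int_factor[OF fac(1)] by metis
  define F where "F = smult N f"
  have F: "F = g' * h'" using N(2) by (simp add: F_def)
  have F': "degree F = degree f" "\<And>j. coeff F j = 0 \<longleftrightarrow> coeff f j = 0"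
    unfolding F_def using N(1) by auto
  have v: "multiplicity p (coeff F j) = multiplicity p N + multiplicity p (coeff f j)"
    if "coeff f j \<noteq> 0" for j
    unfolding F_def coeff_smult using that N(1) p by (intro prime_elem_multiplicity_mult_distrib) auto
  have l0: "coeff f l \<noteq> 0" using fl by auto
  have vl: "multiplicity p (coeff f l) = 0" using fl by (simp add: not_dvd_imp_multiplicity_0)
  have vge: "e \<le> multiplicity p (coeff f j)" if "coeff f j \<noteq> 0" "j \<noteq> l" for j
    using ge[OF that(2)] that p le_degree[OF that(1)]
    by (subst (asm) power_dvd_iff_le_multiplicity) auto
  obtain s t where st: "degree g' = s + t" "s \<le> l" "t \<le> degree f - l" "l dvd e * s" "(degree f - l) dvd e * t"
  proof (rule dumas_two_edges[of p F g' h' "degree f" l e "multiplicity p N"])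
    show "0 < l \<Longrightarrow> coeff F 0 \<noteq> 0 \<and> multiplicity p (coeff F 0) = multiplicity p N + e"
      using l fm v[of 0] F'(2) by auto
    show "l < degree f \<Longrightarrow> multiplicity p (coeff F (degree f)) = multiplicity p N + e"
      using l fm v[of "degree f"] by auto
  qed (use p F F' l0 vl v l e vge in \<open>auto simp del: leading_coeff_0_iff\<close>)
  \<comment> \<open>Since \<open>l\<close> is an end of the range of indices, one of the two edges
    has length zero and contributes nothing to the degree.\<close>
  have "degree f dvd e * (s + t)" using st l by auto
  moreover have "coprime (degree f) e" using e(2) by (simp only: coprime_commute)
  ultimately have "degree f dvd degree g" using st(1) N(3) by (simp only: coprime_dvd_mult_right_iff)
  hence "degree f \<le> degree g" using fac(2) by (rule dvd_imp_le)
  thus False using fac(3) deg unfolding degr by linarith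
qed

text \<open>For \<open>e = 1\<close> this is Eisenstein's criterion for the reversed polynomial. The
  hypotheses refer to the coefficient list so that a concrete polynomial can be tested by
  evaluation.\<close>

lemma irreducible_dumas_left:
  fixes f :: "int poly" and p :: int
  assumes "prime p" "e > 0" "coprime e (degree f)" "degree f > 0"
    and "\<not> p dvd hd (coeffs f)" "\<forall>c\<in>set (tl (coeffs f)). p ^ e dvd c"
    and "\<not> p ^ Suc e dvd last (coeffs f)"
  shows "irreducible (map_poly rat_of_int f)"
proof -
  have f: "f \<noteq> 0" using assms(4) by auto
  have len: "length (coeffs f) = Suc (degree f)" using f by (simp add: length_coeffs_degree)
  have nth: "coeff f j = tl (coeffs f) ! (j - 1)" if "0 < j" "j \<le> degree f" for j
    using that len f by (simp add: nth_tl coeffs_nth)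
  have mem: "p ^ e dvd coeff f j" if "0 < j" "j \<le> degree f" for j
    unfolding nth[OF that] using that len assms(6) by (simp add: nth_mem)
  have hd: "hd (coeffs f) = coeff f 0" using len f by (simp add: hd_conv_nth coeffs_nth flip: length_greater_0_conv)
  have la: "last (coeffs f) = coeff f (degree f)" using f by (simp add: last_coeffs_eq_coeff_degree)
  show ?thesis
    by (rule irreducible_dumas[of p e f 0 "degree f"])
       (use assms mem hd la f in \<open>auto intro!: multiplicity_eqI\<close>)
qed

text \<open>Eisenstein's criterion is the case \<open>e = 1\<close>.\<close>

lemma irreducible_dumas_right:
  fixes f :: "int poly" and p :: int
  assumes "prime p" "e > 0" "coprime e (degree f)" "degree f > 0"
    and "\<not> p dvd last (coeffs f)" "\<forall>c\<in>set (butlast (coeffs f)). p ^ e dvd c"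
    and "\<not> p ^ Suc e dvd hd (coeffs f)"
  shows "irreducible (map_poly rat_of_int f)"
proof -
  have f: "f \<noteq> 0" using assms(4) by auto
  have len: "length (coeffs f) = Suc (degree f)" using f by (simp add: length_coeffs_degree)
  have nth: "coeff f j = butlast (coeffs f) ! j" if "j < degree f" for j
    using that len f by (simp add: nth_butlast coeffs_nth)
  have mem: "p ^ e dvd coeff f j" if "j < degree f" for j
    unfolding nth[OF that] using that len assms(6) by (simp add: nth_mem)
  have hd: "hd (coeffs f) = coeff f 0" using len f by (simp add: hd_conv_nth coeffs_nth flip: length_greater_0_conv)
  have la: "last (coeffs f) = coeff f (degree f)" using f by (simp add: last_coeffs_eq_coeff_degree)
  have c0: "coeff f 0 \<noteq> 0" using assms(7) hd by auto
  show ?thesis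
    by (rule irreducible_dumas[of p e f "degree f" 0])
       (use assms mem hd la f c0 in \<open>auto intro!: multiplicity_eqI\<close>)
qed

lemma trunc_binom_poly_no_linear_factor:
  assumes "\<And>x. poly (trunc_binom_poly n k) x \<noteq> 0" and "trunc_binom_poly n k = g * h"
  shows "degree g \<noteq> 1"
proof
  assume "degree g = 1"
  then obtain a b where ab: "g = [:a, b:]" "b \<noteq> 0"
    by (metis degree1_coeffs)
  hence "poly g (- a / b) = 0" by simp
  thus False using assms by simp
qed

lemma int_trunc_binom_poly_Poly:
  "int_trunc_binom_poly n k = Poly (map (\<lambda>j. int (n choose j)) [0..<Suc k])"
proof (rule poly_eqI)
  fix i
  show "coeff (int_trunc_binom_poly n k) i = coeff (Poly (map (\<lambda>j. int (n choose j)) [0..<Suc k])) i"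
    unfolding coeff_int_trunc_binom_poly coeff_Poly_eq nth_default_def
    by (cases "i \<le> k") (simp_all add: nth_map less_Suc_eq_le del: upt_Suc)
qed

lemma upt_small:
  "[0..<Suc 2] = [0,1,2]" "[0..<Suc 3] = [0,1,2,3]" "[0..<Suc 4] = [0,1,2,3,4]" "[0..<Suc 5] = [0,1,2,3,4,5]"
  "[0..<Suc 6] = [0,1,2,3,4,5,6]" "[0..<Suc 8] = [0,1,2,3,4,5,6,7,8]"
  by (simp_all add: upt_rec)

lemma int_trunc_binom_poly_6_3: "int_trunc_binom_poly 6 3 = [:1, 6, 15, 20:]"
  unfolding int_trunc_binom_poly_Poly upt_small by (simp add: fact_numeral binomial_fact' del: binomial_Suc_Suc)

lemma int_trunc_binom_poly_9_3: "int_trunc_binom_poly 9 3 = [:1, 9, 36, 84:]"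
  unfolding int_trunc_binom_poly_Poly upt_small by (simp add: fact_numeral binomial_fact' del: binomial_Suc_Suc)

lemma int_trunc_binom_poly_12_3: "int_trunc_binom_poly 12 3 = [:1, 12, 66, 220:]"
  unfolding int_trunc_binom_poly_Poly upt_small by (simp add: fact_numeral binomial_fact' del: binomial_Suc_Suc)

lemma int_trunc_binom_poly_27_3: "int_trunc_binom_poly 27 3 = [:1, 27, 351, 2925:]"
  unfolding int_trunc_binom_poly_Poly upt_small by (simp add: fact_numeral binomial_fact' del: binomial_Suc_Suc)

lemma int_trunc_binom_poly_8_4: "int_trunc_binom_poly 8 4 = [:1, 8, 28, 56, 70:]"
  unfolding int_trunc_binom_poly_Poly upt_small by (simp add: fact_numeral binomial_fact' del: binomial_Suc_Suc)

lemma int_trunc_binom_poly_10_5: "int_trunc_binom_poly 10 5 = [:1, 10, 45, 120, 210, 252:]"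
  unfolding int_trunc_binom_poly_Poly upt_small by (simp add: fact_numeral binomial_fact' del: binomial_Suc_Suc)

lemma int_trunc_binom_poly_12_6: "int_trunc_binom_poly 12 6 = [:1, 12, 66, 220, 495, 792, 924:]"
  unfolding int_trunc_binom_poly_Poly upt_small by (simp add: fact_numeral binomial_fact' del: binomial_Suc_Suc)

lemma int_trunc_binom_poly_16_8: "int_trunc_binom_poly 16 8 = [:1, 16, 120, 560, 1820, 4368, 8008, 11440, 12870:]"
  unfolding int_trunc_binom_poly_Poly upt_small by (simp add: fact_numeral binomial_fact' del: binomial_Suc_Suc)

lemma pos_trunc_binom_poly_12_6: "poly (trunc_binom_poly 12 6) x > 0"
proof -
  have "poly (trunc_binom_poly 12 6) x = 1 + 12 * x + 66 * x^2 + 220 * x^3 + 495 * x^4 + 792 * x^5 + 924 * x^6"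
    unfolding trunc_binom_poly_conv int_trunc_binom_poly_12_6
    by (simp add: map_poly_pCons power_numeral_reduce algebra_simps)
  \<comment> \<open>The square is that of the cubic truncation of \<open>(1 + x)^6\<close>, the
    square root of \<open>(1 + x)^12\<close>, so it agrees through the term in \<open>x^3\<close>.
    The rest is \<open>x^4 * (524 * x^2 + 192 * x + 30)\<close>, where the quadratic is completed to
    a square.\<close>
  also have "\<dots> = (1 + 6 * x + 15 * x^2 + 20 * x^3)^2 + x^4 * (524 * (x + 24/131)^2 + 1626/131)"
    by (simp add: power_numeral_reduce algebra_simps)
  also have "\<dots> > 0"
  proof (cases "x = 0")
    case False
    hence "x^4 * (524 * (x + 24/131)^2 + 1626/131) > 0" by (intro mult_pos_pos add_nonneg_pos) auto
    thus ?thesis by (intro add_nonneg_pos) auto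
  qed auto
  finally show ?thesis .
qed

lemma irreducible_trunc_binom_poly_8_4: "irreducible (trunc_binom_poly 8 4)"
  unfolding trunc_binom_poly_conv int_trunc_binom_poly_8_4
  by (rule irreducible_dumas_left[of 2 1]) simp_all

lemma irreducible_trunc_binom_poly_16_8: "irreducible (trunc_binom_poly 16 8)"
  unfolding trunc_binom_poly_conv int_trunc_binom_poly_16_8
  by (rule irreducible_dumas_left[of 2 1]) simp_all

lemma irreducible_trunc_binom_poly_9_3: "irreducible (trunc_binom_poly 9 3)"
  unfolding trunc_binom_poly_conv int_trunc_binom_poly_9_3
  by (rule irreducible_dumas_left[of 3 1]) simp_all

text \<open>The leading coefficient is \<open>2925 = 9 * 325\<close>, so the edge has height 2; it
  has no interior lattice point because 2 is coprime to the degree 3.\<close>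

lemma irreducible_trunc_binom_poly_27_3: "irreducible (trunc_binom_poly 27 3)"
  unfolding trunc_binom_poly_conv int_trunc_binom_poly_27_3
  by (rule irreducible_dumas_left[of 3 2]) simp_all

lemma map_poly_of_int_pcompose_linear:
  "pcompose (map_poly of_int f) [:of_int a, 1:] = (map_poly of_int (pcompose f [:a, 1:]) :: 'a :: {comm_ring_1, ring_char_0} poly)"
proof (induction f)
  case (pCons c f)
  have "map_poly of_int (pcompose (pCons c f) [:a, 1:]) =
      (map_poly of_int [:c:] + map_poly of_int ([:a, 1:] * pcompose f [:a, 1:]) :: 'a poly)"
    unfolding pcompose_pCons by (intro poly_eqI) (simp add: coeff_map_poly)
  also have "\<dots> = pcompose (map_poly of_int (pCons c f)) [:of_int a, 1:]"
    unfolding map_poly_of_int_mult pCons.IH[symmetric] by (simp add: map_poly_pCons pcompose_pCons)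
  finally show ?case by simp
qed simp

lemma irreducible_trunc_binom_poly_shiftD:
  assumes "irreducible (map_poly rat_of_int (pcompose (int_trunc_binom_poly n k) [:a, 1:]))" "0 < k" "k \<le> n"
  shows "irreducible (trunc_binom_poly n k)"
proof (rule irreducible_pcompose_linearD)
  show "irreducible (pcompose (trunc_binom_poly n k) [:of_int a, 1:])"
    unfolding trunc_binom_poly_conv map_poly_of_int_pcompose_linear by (rule assms(1))
qed (use assms in \<open>simp add: degree_trunc_binom_poly\<close>)

text \<open>The shift moves the only root modulo \<open>p\<close> to 0. Up to units, the polynomial
  for \<open>(6, 3)\<close> is \<open>(x - 1)^3\<close> modulo 3; likewise that for
  \<open>(12, 3)\<close> is \<open>(x + 1)^3\<close> modulo 3 and that for \<open>(10, 5)\<close> is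
  \<open>(x - 2)^5\<close> modulo 5.\<close>

lemma irreducible_trunc_binom_poly_6_3: "irreducible (trunc_binom_poly 6 3)"
  by (rule irreducible_trunc_binom_poly_shiftD[where a = "1"], unfold int_trunc_binom_poly_6_3,
      rule irreducible_dumas_right[of 3 1]) (simp_all add: pcompose_pCons)

lemma irreducible_trunc_binom_poly_12_3: "irreducible (trunc_binom_poly 12 3)"
  by (rule irreducible_trunc_binom_poly_shiftD[where a = "-1"], unfold int_trunc_binom_poly_12_3,
      rule irreducible_dumas_right[of 3 1]) (simp_all add: pcompose_pCons)

lemma irreducible_trunc_binom_poly_10_5: "irreducible (trunc_binom_poly 10 5)"
  by (rule irreducible_trunc_binom_poly_shiftD[where a = "2"], unfold int_trunc_binom_poly_10_5,
      rule irreducible_dumas_right[of 5 1]) (simp_all add: pcompose_pCons)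

section \<open>Degrees excluded by primes exceeding k\<close>

text \<open>The two-edge theorem read contrapositively. The excluded \<open>l\<close> are those for
  which whole edges, or half edges if \<open>p^2\<close> divides \<open>n - l\<close>, could add up
  to \<open>d\<close> with \<open>2 * d \<le> k\<close>. Higher powers of \<open>p\<close> do not
  appear because \<open>n < (k + 1)^3\<close>.\<close>

definition degree_obstruction :: "nat \<Rightarrow> nat \<Rightarrow> nat \<Rightarrow> bool" where
  "degree_obstruction n k d \<longleftrightarrow> (\<exists>l p. l \<le> k \<and> prime p \<and> k < p \<and> p dvd n - l \<and> l \<noteq> d \<and> l \<noteq> k - d \<and>
     (\<not> p ^ 2 dvd n - l \<or> l \<noteq> 2 * d \<and> l \<noteq> k - 2 * d \<and> (2 * d = k \<longrightarrow> odd l)))"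

lemma dvd_le_cases:
  fixes l s :: nat
  assumes "l dvd s" "s \<le> l"
  shows "s = 0 \<or> s = l"
  using assms by (cases "s = 0") (auto dest: dvd_imp_le)

lemma dvd_double_le_cases:
  fixes l s :: nat
  assumes "l dvd 2 * s" "s \<le> l"
  shows "s = 0 \<or> s = l \<or> 2 * s = l"
proof -
  obtain c where c: "2 * s = l * c" using assms(1) by auto
  have "l * c \<le> l * 2" using c assms(2) by linarith
  hence "l = 0 \<or> c \<le> 2" by (simp only: mult_le_cancel1) auto
  moreover have "c = 0 \<or> c = 1 \<or> c = 2" if "c \<le> 2" using that by auto
  ultimately show ?thesis using c by auto
qed

text \<open>Every choice other than half of both edges gives one of the excluded equalities or
  exceeds half of the total length.\<close>

lemma two_edges_even:
  fixes s t l x :: nat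
  assumes "s = 0 \<or> s = l \<or> 2 * s = l" "t = 0 \<or> t = x \<or> 2 * t = x"
    and "0 < s + t" "2 * (s + t) \<le> l + x" "l \<noteq> s + t" "x \<noteq> s + t" "l \<noteq> 2 * (s + t)" "x \<noteq> 2 * (s + t)"
  shows "2 * (s + t) = l + x \<and> even l"
  using assms by (elim disjE) auto

lemma degree_obstruction_no_factor:
  assumes kn: "k < n" "n < (k + 1) ^ 3" and fac: "trunc_binom_poly n k = g * h"
    and d: "0 < degree g" "2 * degree g \<le> k"
  shows "\<not> degree_obstruction n k (degree g)"
proof
  define d where "d = degree g"
  assume "degree_obstruction n k (degree g)"
  then obtain l p where l: "l \<le> k" and p: "prime p" "k < p" "p dvd n - l" and ld: "l \<noteq> d" "l \<noteq> k - d"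
    and sq: "p ^ 2 dvd n - l \<Longrightarrow> l \<noteq> 2 * d \<and> l \<noteq> k - 2 * d \<and> (2 * d = k \<longrightarrow> odd l)"
    unfolding degree_obstruction_def d_def by blast
  define e where "e = multiplicity p (n - l)"
  have nz: "n - l \<noteq> 0" "\<not> is_unit p" using kn l p by auto
  have pe: "p ^ e dvd n - l" unfolding e_def by (rule multiplicity_dvd)
  have "e < 3"
  proof (rule ccontr)
    assume "\<not> e < 3"
    hence "p ^ 3 dvd n - l" using pe by (meson le_imp_power_dvd dvd_trans not_less)
    hence "p ^ 3 \<le> n - l" using nz by (intro dvd_imp_le) auto
    moreover have "(k + 1) ^ 3 \<le> p ^ 3" using p by (intro power_mono) auto
    ultimately show False using kn by linarith
  qed
  moreover have "e \<noteq> 0" using p nz unfolding e_def by (simp add: multiplicity_eq_zero_iff)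
  ultimately have e: "e = 1 \<or> e = 2" by auto
  obtain s t where st: "d = s + t" "s \<le> l" "t \<le> k - l" "l dvd e * s" "(k - l) dvd e * t"
    using trunc_binom_poly_factor_degree[OF kn(1) l p fac] unfolding e_def d_def by metis
  from e show False
  proof
    assume "e = 1"
    hence "s = 0 \<or> s = l" "t = 0 \<or> t = k - l"
      using st dvd_le_cases[of l s] dvd_le_cases[of "k - l" t] by simp_all
    moreover have "0 < d" "2 * d \<le> k" using d unfolding d_def by auto
    ultimately show False using st(1) ld l by (elim disjE; linarith)
  next
    assume e2: "e = 2"
    hence st2: "s = 0 \<or> s = l \<or> 2 * s = l" "t = 0 \<or> t = k - l \<or> 2 * t = k - l"
      using st dvd_double_le_cases[of l s] dvd_double_le_cases[of "k - l" t] by simp_all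
    have neq: "l \<noteq> 2 * d" "l \<noteq> k - 2 * d" "2 * d = k \<longrightarrow> odd l" using sq pe e2 by blast+
    from st2 have "2 * (s + t) = l + (k - l) \<and> even l"
      by (rule two_edges_even) (use st(1) ld l d d_def neq in simp_all)
    thus False using neq(3) st(1) l by simp
  qed
qed

lemma trunc_binom_poly_irreducibleI:
  assumes "0 < k" "k < n" "n < (k + 1) ^ 3"
    and "\<And>d. 0 < d \<Longrightarrow> 2 * d \<le> k \<Longrightarrow> degree_obstruction n k d"
  shows "irreducible (trunc_binom_poly n k)"
proof (rule rat_poly_irreducibleI)
  have deg: "degree (trunc_binom_poly n k) = k" using assms(2) by (simp add: degree_trunc_binom_poly)
  thus "degree (trunc_binom_poly n k) > 0" using assms(1) by simp
  fix g h assume "trunc_binom_poly n k = g * h" "0 < degree g" "2 * degree g \<le> degree (trunc_binom_poly n k)"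
  thus False using assms(4) degree_obstruction_no_factor[OF assms(2,3)] unfolding deg by blast
qed

section \<open>Prime factorizations of binomial coefficients\<close>

lemma prime_multiplicity_prod_nat:
  fixes f :: "'a \<Rightarrow> nat"
  assumes "prime p" "finite A" "\<And>x. x \<in> A \<Longrightarrow> 0 < f x"
  shows "multiplicity p (\<Prod>x\<in>A. f x) = (\<Sum>x\<in>A. multiplicity p (f x))"
proof (rule prime_elem_multiplicity_prod_distrib)
  show "0 \<notin> f ` A" using assms(3) by force
qed (use assms in auto)

text \<open>Erdos' argument: set aside the factor \<open>f i\<close> with the largest power of
  \<open>p\<close>. The power of \<open>p\<close> in any other \<open>f j\<close> divides
  \<open>f i\<close> too and hence the difference of the indices. The product of all these
  differences is \<open>i! * (m - 1 - i)!\<close>, a divisor of \<open>(m - 1)!\<close>.\<close>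

lemma multiplicity_prod_window:
  fixes f :: "nat \<Rightarrow> nat"
  assumes p: "prime p" and S: "S \<subseteq> {..<m}" "S \<noteq> {}"
    and pos: "\<And>i. i \<in> S \<Longrightarrow> 0 < f i"
    and sep: "\<And>i j a. i \<in> S \<Longrightarrow> j \<in> S \<Longrightarrow> i < j \<Longrightarrow> p ^ a dvd f i \<Longrightarrow> p ^ a dvd f j \<Longrightarrow> p ^ a dvd j - i"
  shows "\<exists>i\<in>S. multiplicity p (\<Prod>j\<in>S. f j) \<le> multiplicity p (f i) + multiplicity p (fact (m - 1))"
proof -
  have finS: "finite S" using S finite_subset by blast
  let ?v = "\<lambda>x. multiplicity p (x :: nat)"
  obtain i where i: "i \<in> S" "\<And>j. j \<in> S \<Longrightarrow> ?v (f j) \<le> ?v (f i)"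
  proof -
    have "Max ((\<lambda>j. ?v (f j)) ` S) \<in> (\<lambda>j. ?v (f j)) ` S" using finS S by (intro Max_in) auto
    then obtain i where "i \<in> S" "?v (f i) = Max ((\<lambda>j. ?v (f j)) ` S)" by auto
    thus thesis using that finS by (metis Max_ge finite_imageI imageI)
  qed
  have im: "i < m" using i S by auto
  define D where "D = (\<lambda>j. if j < i then i - j else j - i)"
  have D_pos: "D j > 0" if "j \<noteq> i" for j using that unfolding D_def by auto
  have le: "?v (f j) \<le> ?v (D j)" if j: "j \<in> S" "j \<noteq> i" for j
  proof -
    have d1: "p ^ ?v (f j) dvd f j" by (rule multiplicity_dvd)
    have "p ^ ?v (f j) dvd p ^ ?v (f i)" using i(2)[OF j(1)] by (rule le_imp_power_dvd)
    hence d2: "p ^ ?v (f j) dvd f i" using multiplicity_dvd dvd_trans by blast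
    have "p ^ ?v (f j) dvd D j"
      using sep[of j i "?v (f j)"] sep[of i j "?v (f j)"] i(1) j d1 d2 unfolding D_def by auto
    thus ?thesis using D_pos[OF j(2)] p by (subst (asm) power_dvd_iff_le_multiplicity) auto
  qed
  have prodD: "(\<Prod>j\<in>{..<m}-{i}. D j) = fact i * fact (m - 1 - i)"
  proof -
    have "{..<m} - {i} = {..<i} \<union> {Suc i..<m}" using im by auto
    hence "(\<Prod>j\<in>{..<m}-{i}. D j) = (\<Prod>j\<in>{..<i}. D j) * (\<Prod>j\<in>{Suc i..<m}. D j)"
      by (simp add: prod.union_disjoint disjoint_iff)
    also have "(\<Prod>j\<in>{..<i}. D j) = (\<Prod>j\<in>{..<i}. i - j)" unfolding D_def by (intro prod.cong) auto
    also have "\<dots> = (\<Prod>j\<in>{1..i}. j)"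
      by (rule prod.reindex_bij_witness[of _ "\<lambda>j. i - j" "\<lambda>j. i - j"]) auto
    also have "\<dots> = fact i" by (simp add: fact_prod)
    also have "(\<Prod>j\<in>{Suc i..<m}. D j) = (\<Prod>j\<in>{Suc i..<m}. j - i)" unfolding D_def by (intro prod.cong) auto
    also have "\<dots> = (\<Prod>j\<in>{1..m-1-i}. j)"
      by (rule prod.reindex_bij_witness[of _ "\<lambda>j. j + i" "\<lambda>j. j - i"]) auto
    also have "\<dots> = fact (m - 1 - i)" by (simp add: fact_prod)
    finally show ?thesis .
  qed
  have "?v (\<Prod>j\<in>S. f j) = (\<Sum>j\<in>S. ?v (f j))"
    using p finS pos by (rule prime_multiplicity_prod_nat)
  also have "\<dots> = ?v (f i) + (\<Sum>j\<in>S-{i}. ?v (f j))" using i finS by (simp add: sum.remove)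
  also have "(\<Sum>j\<in>S-{i}. ?v (f j)) \<le> (\<Sum>j\<in>S-{i}. ?v (D j))" using le by (intro sum_mono) auto
  also have "(\<Sum>j\<in>S-{i}. ?v (D j)) \<le> (\<Sum>j\<in>{..<m}-{i}. ?v (D j))" using S by (intro sum_mono2) auto
  also have "\<dots> = ?v (\<Prod>j\<in>{..<m}-{i}. D j)"
    by (rule prime_multiplicity_prod_nat[symmetric]) (use p D_pos in auto)
  also have "\<dots> \<le> ?v (fact (m - 1))"
    unfolding prodD using im fact_fact_dvd_fact[of i "m - 1 - i"]
    by (intro dvd_imp_multiplicity_le) auto
  finally show ?thesis using i(1) by auto
qed

lemma binomial_fact_prod: "(n choose k) * fact k = (\<Prod>i<k. n - i)"
proof (induction k)
  case (Suc k)
  have "Suc k * (n choose Suc k) = (n - k) * (n choose k)"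
    by (simp only: binomial_absorption binomial_absorb_comp)
  hence "(n choose Suc k) * fact (Suc k) = (n - k) * ((n choose k) * fact k)"
    by (metis fact_Suc mult.assoc mult.commute of_nat_id)
  thus ?case using Suc by (simp add: mult.commute)
qed simp

text \<open>The excess \<open>(k - 1)!\<close> in the window bound is absorbed by the denominator
  \<open>k!\<close> of the binomial coefficient.\<close>

lemma prime_power_binomial_window:
  assumes "prime p" "0 < k" "k \<le> n"
  shows "\<exists>i<k. multiplicity p (n choose k) \<le> multiplicity p (n - i)"
proof -
  have "\<exists>i\<in>{..<k}. multiplicity p (\<Prod>j\<in>{..<k}. n - j) \<le> multiplicity p (n - i) + multiplicity p (fact (k - 1) :: nat)"
  proof (rule multiplicity_prod_window)
    fix i j a assume "i \<in> {..<k}" "j \<in> {..<k}" "i < j" "p ^ a dvd n - i" "p ^ a dvd n - j"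
    hence "p ^ a dvd (n - i) - (n - j)" by (simp only: dvd_diff_nat)
    moreover have "(n - i) - (n - j) = j - i" using \<open>i < j\<close> \<open>j \<in> {..<k}\<close> assms(3) by auto
    ultimately show "p ^ a dvd j - i" by (simp only:)
  qed (use assms in auto)
  then obtain i where i: "i < k" "multiplicity p ((n choose k) * fact k) \<le> multiplicity p (n - i) + multiplicity p (fact (k - 1) :: nat)"
    unfolding binomial_fact_prod by auto
  have "multiplicity p ((n choose k) * fact k) = multiplicity p (n choose k) + multiplicity p (fact k :: nat)"
    using assms by (intro prime_elem_multiplicity_mult_distrib) auto
  moreover have "multiplicity p (fact (k - 1) :: nat) \<le> multiplicity p (fact k :: nat)"
    by (intro dvd_imp_multiplicity_le fact_dvd) auto
  ultimately show ?thesis using i by auto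
qed

lemma prime_power_binomial_le:
  assumes "prime p" "k \<le> n" "0 < n"
  shows "p ^ multiplicity p (n choose k) \<le> n"
proof (cases "k = 0")
  case False
  then obtain i where i: "i < k" "multiplicity p (n choose k) \<le> multiplicity p (n - i)"
    using prime_power_binomial_window[OF assms(1) _ assms(2)] by auto
  have "p ^ multiplicity p (n choose k) dvd n - i"
    using le_imp_power_dvd[OF i(2)] multiplicity_dvd dvd_trans by blast
  hence "p ^ multiplicity p (n choose k) \<le> n - i" using i assms by (intro dvd_imp_le) auto
  thus ?thesis by simp
qed (use assms in auto)

definition primes_upto :: "nat \<Rightarrow> nat set" where
  "primes_upto k = {p. prime p \<and> p \<le> k}"

lemma finite_primes_upto [simp, intro]: "finite (primes_upto k)"
  unfolding primes_upto_def by (rule finite_subset[of _ "{..k}"]) auto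

lemma primes_upto_mono: "j \<le> k \<Longrightarrow> primes_upto j \<subseteq> primes_upto k"
  unfolding primes_upto_def by auto

text \<open>The position \<open>l = k\<close> is left out because the numerator of
  \<open>n choose k\<close> stops at \<open>n - (k - 1)\<close>.\<close>

definition rough_positions :: "nat \<Rightarrow> nat \<Rightarrow> nat set" where
  "rough_positions n k = {l. l < k \<and> (\<exists>p. prime p \<and> k < p \<and> p dvd n - l)}"

lemma finite_rough_positions [simp, intro]: "finite (rough_positions n k)"
  unfolding rough_positions_def by (rule finite_subset[of _ "{..<k}"]) auto

text \<open>A prime above \<open>k\<close> can divide the numerator
  \<open>n * (n - 1) * ... * (n - k + 1)\<close> only at rough positions, so the product over these
  positions already contains its full power.\<close>

lemma binomial_dvd_rough_times_smooth:
  assumes "k \<le> n"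
  shows "n choose k dvd (\<Prod>l\<in>rough_positions n k. n - l) * (\<Prod>p\<in>primes_upto k. p ^ multiplicity p (n choose k))"
    (is "_ dvd ?R * ?Q")
proof (rule multiplicity_le_imp_dvd)
  let ?E = "rough_positions n k"
  have E: "?E \<subseteq> {..<k}" unfolding rough_positions_def by auto
  have Epos: "0 < n - l" if "l \<in> ?E" for l using that assms unfolding rough_positions_def by auto
  have Ppos: "0 < p" if "p \<in> primes_upto k" for p using that unfolding primes_upto_def by (auto intro: prime_gt_0_nat)
  have R0: "?R \<noteq> 0" using prod_pos[of ?E "\<lambda>l. n - l"] Epos by fastforce
  have Q0: "?Q \<noteq> 0" using prod_pos[of "primes_upto k" "\<lambda>p. p ^ multiplicity p (n choose k)"] Ppos by fastforce
  show "n choose k \<noteq> 0" using assms by simp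
  fix p :: nat assume p: "prime p"
  hence pe: "prime_elem p" by auto
  have mRQ: "multiplicity p (?R * ?Q) = multiplicity p ?R + multiplicity p ?Q"
    using R0 Q0 pe by (intro prime_elem_multiplicity_mult_distrib) auto
  show "multiplicity p (n choose k) \<le> multiplicity p (?R * ?Q)"
  proof (cases "p \<le> k")
    case True
    hence "p ^ multiplicity p (n choose k) dvd ?Q"
      using p by (intro dvd_prodI) (auto simp: primes_upto_def)
    hence "multiplicity p (n choose k) \<le> multiplicity p ?Q"
      using Q0 p by (subst (asm) power_dvd_iff_le_multiplicity) auto
    thus ?thesis using mRQ by simp
  next
    case False
    have "multiplicity p (n choose k) \<le> multiplicity p ((n choose k) * fact k)"
      using assms by (intro dvd_imp_multiplicity_le) auto
    also have "\<dots> = (\<Sum>i<k. multiplicity p (n - i))"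
      unfolding binomial_fact_prod by (rule prime_multiplicity_prod_nat) (use p assms in auto)
    also have "\<dots> = (\<Sum>i\<in>?E. multiplicity p (n - i))"
      using E False p by (intro sum.mono_neutral_right)
        (auto simp: rough_positions_def not_dvd_imp_multiplicity_0)
    also have "\<dots> = multiplicity p ?R"
      by (rule prime_multiplicity_prod_nat[symmetric]) (use p Epos in auto)
    finally show ?thesis using mRQ by simp
  qed
qed

lemma binomial_le_rough_times_smooth:
  assumes "k \<le> n" "0 < n" "card (rough_positions n k) \<le> c"
  shows "n choose k \<le> n ^ c * (\<Prod>p\<in>primes_upto k. p ^ multiplicity p (n choose k))"
proof -
  let ?E = "rough_positions n k"
  have "(\<Prod>l\<in>?E. n - l) \<le> (\<Prod>l\<in>?E. n)" by (intro prod_mono) auto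
  also have "\<dots> \<le> n ^ c" using assms by (simp add: power_increasing)
  finally have R: "(\<Prod>l\<in>?E. n - l) \<le> n ^ c" .
  have "0 < (\<Prod>l\<in>?E. n - l) * (\<Prod>p\<in>primes_upto k. p ^ multiplicity p (n choose k))"
    using assms by (auto simp: primes_upto_def rough_positions_def intro!: prod_pos prime_gt_0_nat)
  hence "n choose k \<le> (\<Prod>l\<in>?E. n - l) * (\<Prod>p\<in>primes_upto k. p ^ multiplicity p (n choose k))"
    using binomial_dvd_rough_times_smooth[OF assms(1)] by (intro dvd_imp_le) auto
  also have "\<dots> \<le> n ^ c * (\<Prod>p\<in>primes_upto k. p ^ multiplicity p (n choose k))"
    using R by (intro mult_right_mono) auto
  finally show ?thesis .
qed

lemma binomial_le_power_prime_count:
  assumes "k \<le> n" "0 < n" "card (rough_positions n k) \<le> c"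
  shows "n choose k \<le> n ^ (c + card (primes_upto k))"
proof -
  have "(\<Prod>p\<in>primes_upto k. p ^ multiplicity p (n choose k)) \<le> (\<Prod>p\<in>primes_upto k. n)"
    using assms by (intro prod_mono) (auto simp: primes_upto_def prime_power_binomial_le)
  hence "n ^ c * (\<Prod>p\<in>primes_upto k. p ^ multiplicity p (n choose k)) \<le> n ^ c * n ^ card (primes_upto k)"
    by (intro mult_left_mono) auto
  with binomial_le_rough_times_smooth[OF assms] show ?thesis unfolding power_add by (rule le_trans)
qed

section \<open>Chebyshev's bound for the product of primes\<close>

lemma prod_primes_le_power4: "(\<Prod>p\<in>primes_upto n. p) \<le> 4 ^ n"
proof (induction n rule: less_induct)
  case (less n)
  have "n < 2 \<or> n = 2 \<or> n > 2 \<and> even n \<or> n > 2 \<and> odd n" by auto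
  thus ?case
  proof (elim disjE)
    assume "n < 2"
    hence "primes_upto n = {}" unfolding primes_upto_def by (auto dest: prime_ge_2_nat)
    thus ?thesis by simp
  next
    assume 2: "n = 2"
    have "primes_upto 2 = {2}" unfolding primes_upto_def
      by (auto intro: antisym prime_ge_2_nat)
    thus ?thesis using 2 by simp
  next
    assume 3: "n > 2 \<and> even n"
    have "\<not> prime n" using 3 prime_odd_nat by auto
    have "p \<le> n \<longleftrightarrow> p \<le> n - 1" if "prime p" for p
      using \<open>\<not> prime n\<close> that 3 by (cases "p = n") auto
    hence "primes_upto n = primes_upto (n - 1)" unfolding primes_upto_def by blast
    moreover have "(\<Prod>p\<in>primes_upto (n - 1). p) \<le> 4 ^ (n - 1)" using less 3 by simp
    moreover have "4 ^ (n - 1) \<le> (4 ^ n :: nat)" by (intro power_increasing) auto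
    ultimately show ?thesis using le_trans by metis
  next
    assume odd: "n > 2 \<and> odd n"
    then obtain m where "n = 2 * m + 1" by (auto elim: oddE)
    hence 4: "n = 2 * m + 1" "m \<ge> 1" using odd by auto
    define B where "B = primes_upto n - primes_upto (m + 1)"
    \<comment> \<open>The primes in \<open>B\<close> lie above \<open>m + 1\<close> and at most at
      \<open>2 * m + 1\<close>: they divide \<open>(2 * m + 1)!\<close> but neither
      \<open>m!\<close> nor \<open>(m + 1)!\<close>. The binomial coefficient is at most half of its
      row sum, that is \<open>4^m\<close>.\<close>
    have "(\<Prod>p\<in>B. p) dvd (2 * m + 1 choose m)"
    proof (rule multiplicity_le_imp_dvd)
      fix p :: nat assume p: "prime p"
      have B0: "(\<Prod>p\<in>B. p) \<noteq> 0" using not_prime_0 unfolding B_def primes_upto_def by auto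
      have "multiplicity p (\<Prod>p\<in>B. p) = (\<Sum>q\<in>B. multiplicity p q)"
        by (rule prime_multiplicity_prod_nat) (use p in \<open>auto simp: B_def primes_upto_def prime_gt_0_nat\<close>)
      also have "\<dots> = (\<Sum>q\<in>B. if p = q then 1 else 0)"
        using p by (intro sum.cong) (auto simp: B_def primes_upto_def prime_multiplicity_other)
      also have "\<dots> = (if p \<in> B then 1 else 0)" by (simp add: B_def)
      also have "\<dots> \<le> multiplicity p (2 * m + 1 choose m)"
      proof (cases "p \<in> B")
        case True
        hence pm: "m + 1 < p" "p \<le> 2 * m + 1" unfolding B_def primes_upto_def 4 by auto
        have "p dvd fact (2 * m + 1)" using pm by (simp only: prime_dvd_fact_iff[OF p])
        also have "fact (2 * m + 1) = (fact m * fact (m + 1) * (2 * m + 1 choose m) :: nat)"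
          using binomial_fact_lemma[of m "2 * m + 1"] by simp
        finally have "p \<le> m \<or> p \<le> m + 1 \<or> p dvd (2 * m + 1 choose m)"
          by (simp only: prime_dvd_mult_iff[OF p] prime_dvd_fact_iff[OF p] disj_assoc)
        hence "p dvd (2 * m + 1 choose m)" using pm by linarith
        hence "1 \<le> multiplicity p (2 * m + 1 choose m)"
          using p by (intro multiplicity_geI) auto
        thus ?thesis using True by simp
      qed simp
      finally show "multiplicity p (\<Prod>p\<in>B. p) \<le> multiplicity p (2 * m + 1 choose m)" .
    next
      show "(\<Prod>p\<in>B. p) \<noteq> 0" using not_prime_0 unfolding B_def primes_upto_def by auto
    qed
    hence "(\<Prod>p\<in>B. p) \<le> (2 * m + 1 choose m)" by (intro dvd_imp_le) auto
    also have "\<dots> \<le> 4 ^ m"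
    proof -
      have "(2 * m + 1 choose m) \<le> (\<Sum>k\<le>m. 2 * m + 1 choose k)" by (intro member_le_sum) auto
      also have "\<dots> = 2 ^ (2 * m)" by (rule binomial_r_part_sum)
      also have "\<dots> = 4 ^ m" by (simp add: power_mult)
      finally show ?thesis .
    qed
    finally have Ble: "(\<Prod>p\<in>B. p) \<le> 4 ^ m" .
    have un: "primes_upto n = primes_upto (m + 1) \<union> B" and dis: "primes_upto (m + 1) \<inter> B = {}"
      using primes_upto_mono[of "m + 1" n] 4 unfolding B_def by auto
    have "(\<Prod>p\<in>primes_upto n. p) = (\<Prod>p\<in>primes_upto (m + 1). p) * (\<Prod>p\<in>B. p)"
      unfolding un using dis by (intro prod.union_disjoint) (auto simp: B_def)
    also have "\<dots> \<le> 4 ^ (m + 1) * 4 ^ m" using less[of "m + 1"] 4 Ble by (intro mult_mono) auto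
    also have "\<dots> = 4 ^ n" using 4 by (simp flip: power_add)
    finally show ?thesis .
  qed
qed

section \<open>A linear bound for the number of primes\<close>

definition wheel210 :: "int \<Rightarrow> bool" where
  "wheel210 x \<longleftrightarrow> x mod 2 \<noteq> 0 \<and> x mod 3 \<noteq> 0 \<and> x mod 5 \<noteq> 0 \<and> x mod 7 \<noteq> 0"

definition wheel_count :: "int \<Rightarrow> nat" where
  "wheel_count k = card {x \<in> {1..k}. wheel210 x}"

fun wheel_check :: "int \<Rightarrow> int list \<Rightarrow> bool" where
  "wheel_check c [] = True"
| "wheel_check c (x # xs) = (let c' = (if wheel210 x then c + 1 else c) in 4 * c' \<le> x + 1 \<and> wheel_check c' xs)"

lemma wheel_count_Suc:
  assumes "0 \<le> k"
  shows "wheel_count (k + 1) = wheel_count k + (if wheel210 (k + 1) then 1 else 0)"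
proof -
  have iv: "{1..k + 1} = insert (k + 1) {1..k}" using assms by auto
  have fin: "finite {x \<in> {1..k}. wheel210 x}" by (rule finite_subset[of _ "{1..k}"]) auto
  show ?thesis
  proof (cases "wheel210 (k + 1)")
    case True
    hence A: "{x \<in> {1..k + 1}. wheel210 x} = insert (k + 1) {x \<in> {1..k}. wheel210 x}" unfolding iv by auto
    show ?thesis unfolding wheel_count_def A using card_insert_disjoint[OF fin, of "k + 1"] True by simp
  next
    case False
    hence "{x \<in> {1..k + 1}. wheel210 x} = {x \<in> {1..k}. wheel210 x}" unfolding iv by auto
    thus ?thesis unfolding wheel_count_def using False by simp
  qed
qed

lemma wheel_check_sound:
  assumes "wheel_check (int (wheel_count (i - 1))) [i..j]" "1 \<le> i" "i \<le> x" "x \<le> j"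
  shows "4 * int (wheel_count x) \<le> x + 1"
  using assms
proof (induction "nat (j - i)" arbitrary: i)
  case 0
  hence "i = x" "j = x" by auto
  thus ?case using 0 wheel_count_Suc[of "x - 1"] by (auto simp: Let_def upto.simps split: if_splits)
next
  case (Suc m)
  have ij: "[i..j] = i # [i + 1..j]" using Suc by (simp add: upto.simps)
  have c: "int (wheel_count i) = (if wheel210 i then int (wheel_count (i - 1)) + 1 else int (wheel_count (i - 1)))"
    using wheel_count_Suc[of "i - 1"] Suc by simp
  have chk: "4 * int (wheel_count i) \<le> i + 1" "wheel_check (int (wheel_count i)) [i + 1..j]"
    using Suc.prems(1) unfolding ij wheel_check.simps Let_def c[symmetric] by auto
  show ?case
  proof (cases "x = i")
    case False
    show ?thesis by (rule Suc.hyps(1)[of "i + 1"]) (use Suc False chk in auto)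
  qed (use chk in simp)
qed

lemma wheel_count_initial:
  assumes "3 \<le> x" "x \<le> 212"
  shows "4 * int (wheel_count x) \<le> x + 1"
proof (rule wheel_check_sound[of 3 212])
  have "wheel_count 0 = 0" unfolding wheel_count_def by simp
  moreover have "wheel_count 1 = 1" using wheel_count_Suc[of 0] calculation by (simp add: wheel210_def)
  ultimately have "int (wheel_count (3 - 1)) = 1" using wheel_count_Suc[of 1] by (simp add: wheel210_def)
  moreover have "wheel_check 1 [3..212]" by code_simp
  ultimately show "wheel_check (int (wheel_count (3 - 1))) [3..212]" by (simp only:)
qed (use assms in auto)

lemma wheel210_periodic: "wheel210 (x + 210) \<longleftrightarrow> wheel210 x"
  unfolding wheel210_def by presburger

lemma wheel_count_shift:
  assumes "0 \<le> k"
  shows "wheel_count (k + 210) + wheel_count 0 = wheel_count k + wheel_count 210"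
  using assms
proof (induction k rule: int_ge_induct)
  case (step k)
  thus ?case using wheel_count_Suc[of k] wheel_count_Suc[of "k + 210"] wheel210_periodic[of "k + 1"]
    by (simp add: algebra_simps)
qed simp

text \<open>There are 48 residues coprime to \<open>210 = 2 * 3 * 5 * 7\<close>, a density below
  1/4, so a period adds at most 210 to the left side; the bound 52 used here suffices since
  \<open>4 * 52 = 208\<close>. The inequality fails at 1 and 2, so the computed range is 3 to 212,
  one full period of starting values.\<close>

lemma wheel_count_le:
  assumes "3 \<le> k"
  shows "4 * int (wheel_count k) \<le> k + 1"
  using assms
proof (induction "nat k" arbitrary: k rule: less_induct)
  case less
  show ?case
  proof (cases "k \<le> 212")
    case False
    have "4 * int (wheel_count (k - 210)) \<le> k - 210 + 1" 
      using less.hyps[of "k - 210"] less.prems False by simp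
    moreover have "4 * int (wheel_count 210) \<le> 210 + 1" by (rule wheel_count_initial) auto
    hence "wheel_count 210 \<le> 52" by simp
    moreover have "wheel_count k + wheel_count 0 = wheel_count (k - 210) + wheel_count 210"
      using wheel_count_shift[of "k - 210"] False by simp
    ultimately show ?thesis by linarith
  qed (use less wheel_count_initial in simp)
qed

text \<open>The wheel misses the four primes 2, 3, 5, 7 and counts the number 1, a net correction of
  3; hence \<open>13 = 1 + 4 * 3\<close>.\<close>

lemma prime_count_le: "4 * card (primes_upto k) \<le> k + 13"
proof (cases "k \<ge> 3")
  case False
  have "primes_upto k \<subseteq> {2}" using False unfolding primes_upto_def by (auto dest: prime_ge_2_nat)
  hence "card (primes_upto k) \<le> 1" using card_mono[of "{2::nat}"] by fastforce
  thus ?thesis by simp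
next
  case True
  let ?W = "{x \<in> {1..int k}. wheel210 x}"
  have sub: "int ` primes_upto k \<subseteq> {2, 3, 5, 7} \<union> (?W - {1})"
  proof
    fix x assume "x \<in> int ` primes_upto k"
    then obtain p where p: "x = int p" "prime p" "p \<le> k" unfolding primes_upto_def by auto
    have eq: "p = q" if "q dvd p" "prime q" for q using that p(2) primes_dvd_imp_eq by blast
    have dvd: "int p mod 2 = 0 \<Longrightarrow> 2 dvd p" "int p mod 3 = 0 \<Longrightarrow> 3 dvd p" "int p mod 5 = 0 \<Longrightarrow> 5 dvd p"
      "int p mod 7 = 0 \<Longrightarrow> 7 dvd p" by presburger+
    have eqs: "2 dvd p \<Longrightarrow> p = 2" "3 dvd p \<Longrightarrow> p = 3" "5 dvd p \<Longrightarrow> p = 5" "7 dvd p \<Longrightarrow> p = 7"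
      using eq[of 2] eq[of 3] eq[of 5] eq[of 7] by simp_all
    have "int p mod 2 = 0 \<longrightarrow> p = 2" by (intro impI eqs(1) dvd(1))
    moreover have "int p mod 3 = 0 \<longrightarrow> p = 3" by (intro impI eqs(2) dvd(2))
    moreover have "int p mod 5 = 0 \<longrightarrow> p = 5" by (intro impI eqs(3) dvd(3))
    moreover have "int p mod 7 = 0 \<longrightarrow> p = 7" by (intro impI eqs(4) dvd(4))
    ultimately have "wheel210 x \<or> p = 2 \<or> p = 3 \<or> p = 5 \<or> p = 7" unfolding wheel210_def p(1) by metis
    thus "x \<in> {2, 3, 5, 7} \<union> (?W - {1})" using p prime_gt_1_nat[OF p(2)] by auto
  qed
  have finW: "finite ?W" by (rule finite_subset[of _ "{1..int k}"]) auto
  have "card (primes_upto k) = card (int ` primes_upto k)" by (simp add: card_image)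
  also have "\<dots> \<le> card ({2, 3, 5, 7} \<union> (?W - {1}))" 
    using sub finW by (intro card_mono finite_UnI finite_Diff) auto
  also have "\<dots> \<le> card {2, 3, 5, 7 :: int} + card (?W - {1})" by (rule card_Un_le)
  also have "card (?W - {1}) = wheel_count (int k) - 1"
    unfolding wheel_count_def using True by (subst card_Diff_singleton) (auto simp: wheel210_def)
  finally have "card (primes_upto k) \<le> 4 + (wheel_count (int k) - 1)" by simp
  moreover {
  have "{1} \<subseteq> ?W" using True by (simp add: wheel210_def)
  then have "card {1 :: int} \<le> wheel_count (int k)" unfolding wheel_count_def by (rule card_mono[OF finW])
  hence "1 \<le> wheel_count (int k)" by simp }
  moreover have "4 * int (wheel_count (int k)) \<le> int k + 1" using True by (intro wheel_count_le) auto
  ultimately show ?thesis by linarith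
qed

section \<open>Lower bounds for binomial coefficients\<close>

lemma binomial_power_mono:
  assumes "k \<le> N" "N \<le> n" "0 < N"
  shows "(N choose k) * n ^ k \<le> (n choose k) * N ^ k"
proof -
  have "fact k * ((N choose k) * n ^ k) = (\<Prod>i<k. (N - i) * n)"
    unfolding prod.distrib using binomial_fact_prod[of N k] by (simp add: mult_ac)
  also have "\<dots> \<le> (\<Prod>i<k. (n - i) * N)"
  proof (intro prod_mono conjI)
    fix i assume i: "i \<in> {..<k}"
    have "i * N \<le> i * n" using assms by simp
    thus "(N - i) * n \<le> (n - i) * N"
      unfolding diff_mult_distrib mult.commute[of n N] by (rule diff_le_mono2)
  qed auto
  also have "\<dots> = fact k * ((n choose k) * N ^ k)"
    unfolding prod.distrib using binomial_fact_prod[of n k] by (simp add: mult_ac)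
  finally show ?thesis by simp
qed

text \<open>Each quotient \<open>(n - i) / n\<close> grows with \<open>n\<close>, so
  \<open>(n choose k) / n^k\<close> is nondecreasing, and so is \<open>(n choose k) / n^j\<close>
  for \<open>j \<le> k\<close>. One numerical check at the least \<open>n\<close> therefore settles
  a whole half-line.\<close>

lemma binomial_gt_power_mono:
  assumes "k \<le> N" "N \<le> n" "0 < N" "j \<le> k" "N ^ j < N choose k"
  shows "n ^ j < n choose k"
proof -
  have "N ^ j * n ^ k < (N choose k) * n ^ k" using assms by simp
  also have "\<dots> \<le> (n choose k) * N ^ k" using assms by (intro binomial_power_mono)
  finally have "N ^ j * n ^ (j + (k - j)) < (n choose k) * N ^ (j + (k - j))" using assms(4) by simp
  hence "N ^ j * (n ^ j * n ^ (k - j)) < N ^ j * ((n choose k) * N ^ (k - j))"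
    by (simp only: power_add mult_ac)
  hence "n ^ j * n ^ (k - j) < (n choose k) * N ^ (k - j)" by simp
  also have "\<dots> \<le> (n choose k) * n ^ (k - j)" using assms by (intro mult_left_mono power_mono) auto
  finally show ?thesis by simp
qed

lemma binomial_triple_step:
  "(3 * Suc k choose Suc k) * (2 * (2 * k + 1)) * (k + 1) = 3 * (3 * k + 1) * (3 * k + 2) * (3 * k choose k)"
proof -
  have f: "fact k * fact (2 * k) * (3 * k choose k) = (fact (3 * k) :: nat)"
    using binomial_fact_lemma[of k "3 * k"] by simp
  have "fact (Suc k) * fact (3 * Suc k - Suc k) * (3 * Suc k choose Suc k) = (fact (3 * Suc k) :: nat)"
    by (rule binomial_fact_lemma) simp
  moreover have "3 * Suc k - Suc k = Suc (Suc (2 * k))" by simp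
  moreover have "(fact (3 * Suc k) :: nat) = fact (Suc (Suc (Suc (3 * k))))" by (rule arg_cong[of _ _ fact]) simp
  ultimately have eq: "fact (Suc k) * fact (Suc (Suc (2 * k))) * (3 * Suc k choose Suc k) = (fact (Suc (Suc (Suc (3 * k)))) :: nat)"
    by (simp only:)
  have 1: "fact (Suc k) * fact (Suc (Suc (2 * k))) =
      (fact k * fact (2 * k)) * ((k + 1) * (2 * k + 1) * (2 * k + 2) :: nat)"
    by (simp add: algebra_simps)
  have 2: "fact (Suc (Suc (Suc (3 * k)))) = (fact (3 * k) :: nat) * ((3 * k + 1) * (3 * k + 2) * (3 * k + 3))"
    by (simp add: algebra_simps)
  have "(fact k * fact (2 * k)) * ((3 * Suc k choose Suc k) * ((k + 1) * (2 * k + 1) * (2 * k + 2))) =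
      (fact k * fact (2 * k) :: nat) * ((3 * k choose k) * ((3 * k + 1) * (3 * k + 2) * (3 * k + 3)))"
    using eq unfolding 1 2 f[symmetric] by (simp only: mult_ac)
  hence eq2: "(3 * Suc k choose Suc k) * ((k + 1) * (2 * k + 1) * (2 * k + 2)) =
      (3 * k choose k) * ((3 * k + 1) * (3 * k + 2) * (3 * k + 3))" by simp
  have 3: "2 * k + 2 = 2 * (k + 1)" "3 * k + 3 = 3 * (k + 1)" by simp_all
  have "(k + 1) * ((3 * Suc k choose Suc k) * (2 * (2 * k + 1)) * (k + 1)) = (k + 1) * (3 * (3 * k + 1) * (3 * k + 2) * (3 * k choose k))"
    using eq2 unfolding 3 by (simp only: mult_ac)
  thus ?thesis by (simp only: mult_cancel1) simp
qed

text \<open>Consecutive values of \<open>3 * k choose k\<close> have a ratio tending to 27/4 from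
  below, and the factor \<open>k\<close> compensates for the deficit. The induction starts at 5
  because the inequality fails for \<open>k = 4\<close>.\<close>

lemma binomial_triple_lower:
  assumes "5 \<le> k"
  shows "27 ^ k \<le> k * (3 * k choose k) * 4 ^ k"
  using assms
proof (induction k rule: dec_induct)
  case base
  have "(3 * 5 choose 5 :: nat) = 3003" by (simp add: binomial_fact' fact_numeral del: binomial_Suc_Suc)
  thus ?case by simp
next
  case (step k)
  let ?B = "3 * k choose k" let ?B' = "3 * Suc k choose Suc k"
  have "27 ^ Suc k * (2 * (2 * k + 1)) \<le> 27 * (k * ?B * 4 ^ k) * (2 * (2 * k + 1))"
    unfolding power_Suc using step by (intro mult_right_mono mult_left_mono) auto
  also have "\<dots> = (27 * k * (2 * (2 * k + 1))) * (?B * 4 ^ k)" by (simp only: mult_ac)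
  also have "\<dots> \<le> (4 * (3 * (3 * k + 1) * (3 * k + 2))) * (?B * 4 ^ k)"
    by (intro mult_right_mono) (simp_all add: algebra_simps)
  also have "\<dots> = (3 * (3 * k + 1) * (3 * k + 2) * ?B) * 4 ^ Suc k" by simp
  also have "\<dots> = (Suc k * ?B' * 4 ^ Suc k) * (2 * (2 * k + 1))"
    unfolding binomial_triple_step[symmetric] by (simp only: mult_ac Suc_eq_plus1)
  finally show ?case by (simp only: mult_le_cancel2) simp
qed

text \<open>Transport of the bound at \<open>3 * k\<close> to larger \<open>n\<close>: the base 27/4
  is multiplied by \<open>n / (3 * k)\<close>, which gives \<open>9 * n / (4 * k)\<close>.\<close>

lemma binomial_lower_large:
  assumes "5 \<le> k" "3 * k \<le> n"
  shows "(9 * n) ^ k \<le> k * (n choose k) * (4 * k) ^ k"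
proof -
  have "(27 * n) ^ k = 27 ^ k * n ^ k" by (simp add: power_mult_distrib)
  also have "\<dots> \<le> (k * (3 * k choose k) * 4 ^ k) * n ^ k"
    using binomial_triple_lower[OF assms(1)] by (intro mult_right_mono) auto
  also have "\<dots> = k * 4 ^ k * ((3 * k choose k) * n ^ k)" by simp
  also have "\<dots> \<le> k * 4 ^ k * ((n choose k) * (3 * k) ^ k)"
    using assms binomial_power_mono[of k "3 * k" n] by (intro mult_left_mono) auto
  also have "\<dots> = (k * (n choose k) * (4 * k) ^ k) * 3 ^ k" by (simp add: power_mult_distrib)
  finally have "3 ^ k * (9 * n) ^ k \<le> 3 ^ k * (k * (n choose k) * (4 * k) ^ k)"
    by (simp add: power_mult_distrib mult_ac flip: power_mult_distrib[of 3 9])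
  thus ?thesis by simp
qed

text \<open>As long as the new upper index is at most \<open>3 * k\<close>, raising it by one
  multiplies the coefficient by at least 3/2.\<close>

lemma binomial_lower_middle:
  assumes "2 * k \<le> n" "n \<le> 3 * k"
  shows "(2 * k choose k) * 3 ^ (n - 2 * k) \<le> (n choose k) * 2 ^ (n - 2 * k)"
  using assms
proof (induction n rule: dec_induct)
  case (step n)
  have "Suc n * (n choose k) = (Suc n - k) * (Suc n choose k)"
    using binomial_absorb_comp[of "Suc n" k] by simp
  moreover have "3 * (Suc n - k) \<le> 2 * Suc n" using step by simp
  hence "3 * (Suc n - k) * (n choose k) \<le> 2 * Suc n * (n choose k)" by (rule mult_right_mono) simp
  ultimately have "3 * (Suc n - k) * (n choose k) \<le> 2 * ((Suc n - k) * (Suc n choose k))"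
    by (simp only: mult.assoc)
  hence "(Suc n - k) * (3 * (n choose k)) \<le> (Suc n - k) * (2 * (Suc n choose k))" by (simp only: mult_ac)
  hence le: "3 * (n choose k) \<le> 2 * (Suc n choose k)" using step by simp
  have "(2 * k choose k) * 3 ^ (Suc n - 2 * k) = 3 * ((2 * k choose k) * 3 ^ (n - 2 * k))"
    using step by (simp add: Suc_diff_le)
  also have "\<dots> \<le> (3 * (n choose k)) * 2 ^ (n - 2 * k)" using step by simp
  also have "\<dots> \<le> (2 * (Suc n choose k)) * 2 ^ (n - 2 * k)" using le by (intro mult_right_mono) auto
  also have "\<dots> = (Suc n choose k) * 2 ^ (Suc n - 2 * k)" using step by (simp add: Suc_diff_le)
  finally show ?case .
qed simp

text \<open>The split is at the square root of \<open>n\<close>. The cut-off \<open>y\<close> is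
  kept free: \<open>y = k\<close> makes the last hypothesis vacuous, whereas near
  \<open>n = 2 * k\<close> a smaller \<open>y\<close> is essential.\<close>

lemma smooth_part_le:
  assumes "k \<le> n" "0 < n" "n < (r + 1)\<^sup>2"
    and y: "\<And>p. prime p \<Longrightarrow> r < p \<Longrightarrow> y < p \<Longrightarrow> p \<le> k \<Longrightarrow> \<not> p dvd n choose k"
  shows "(\<Prod>p\<in>primes_upto k. p ^ multiplicity p (n choose k)) \<le> n ^ card (primes_upto r) * 4 ^ y"
proof -
  let ?f = "\<lambda>p. p ^ multiplicity p (n choose k)"
  let ?A = "primes_upto k \<inter> primes_upto r" let ?B = "primes_upto k - primes_upto r"
  have "(\<Prod>p\<in>primes_upto k. ?f p) = (\<Prod>p\<in>?A. ?f p) * (\<Prod>p\<in>?B. ?f p)"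
    by (rule prod.Int_Diff) simp
  also have "\<dots> \<le> n ^ card (primes_upto r) * 4 ^ y"
  proof (intro mult_mono)
    have "(\<Prod>p\<in>?A. ?f p) \<le> (\<Prod>p\<in>?A. n)"
      using assms by (intro prod_mono) (auto simp: primes_upto_def prime_power_binomial_le)
    also have "\<dots> \<le> n ^ card (primes_upto r)"
      using assms by (simp add: power_increasing card_mono)
    finally show "(\<Prod>p\<in>?A. ?f p) \<le> n ^ card (primes_upto r)" .
    have "(\<Prod>p\<in>?B. ?f p) \<le> (\<Prod>p\<in>?B \<inter> primes_upto y. p)"
    proof -
      have one: "?f p = 1" if "p \<in> ?B" "p \<notin> primes_upto y" for p
        using that y[of p] by (auto simp: primes_upto_def not_dvd_imp_multiplicity_0)
      have "(\<Prod>p\<in>?B. ?f p) = (\<Prod>p\<in>?B \<inter> primes_upto y. ?f p)"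
        by (rule prod.mono_neutral_right) (simp, blast, use one in blast)
      also have "\<dots> \<le> (\<Prod>p\<in>?B \<inter> primes_upto y. p)"
      proof (intro prod_mono conjI)
        fix p assume "p \<in> ?B \<inter> primes_upto y"
        hence p: "prime p" "r + 1 \<le> p" unfolding primes_upto_def by auto
        have "p ^ multiplicity p (n choose k) \<le> n" using assms p by (intro prime_power_binomial_le) auto
        also have "n < (r + 1)\<^sup>2" by fact
        also have "\<dots> \<le> p\<^sup>2" using p by (intro power_mono) auto
        finally have "multiplicity p (n choose k) < 2" using prime_gt_1_nat[OF p(1)] by (rule power_less_imp_less_exp[rotated])
        hence "p ^ multiplicity p (n choose k) \<le> p ^ 1" using prime_gt_0_nat[OF p(1)] by (intro power_increasing) auto
        thus "?f p \<le> p" by simp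
      qed auto
      finally show ?thesis .
    qed
    also have "\<dots> \<le> (\<Prod>p\<in>primes_upto y. p)"
      by (intro dvd_imp_le prod_dvd_prod_subset prod_pos) (auto simp: primes_upto_def prime_gt_0_nat)
    also have "\<dots> \<le> 4 ^ y" by (rule prod_primes_le_power4)
    finally show "(\<Prod>p\<in>?B. ?f p) \<le> 4 ^ y" .
  qed auto
  finally show ?thesis .
qed

text \<open>The numerator runs over the numbers from \<open>n - k + 1\<close> to \<open>n\<close>.
  Here \<open>p \<le> k \<le> n - k\<close> lies below this window and \<open>3 * p\<close> above
  it, so \<open>2 * p\<close> is the only possible multiple of \<open>p\<close>. Its single factor
  \<open>p\<close> cancels against the one in \<open>k!\<close>.\<close>

lemma large_prime_not_dvd_binomial:
  assumes "prime p" "3 \<le> p" "p \<le> k" "2 * k \<le> n" "n < 3 * p"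
  shows "\<not> p dvd n choose k"
proof
  assume dvd: "p dvd n choose k"
  have pos: "0 < n - i" if "i < k" for i using that assms by auto
  have only: "n - i = 2 * p" if i: "i < k" "p dvd n - i" for i
  proof -
    obtain c where c: "n - i = p * c" using i by auto
    have "p * c < p * 3" "p * 1 < p * c" unfolding c[symmetric] using i assms by auto
    hence "c < 3" "1 < c" by (simp_all only: mult_less_cancel1)
    hence "c = 2" by simp
    thus ?thesis using c by simp
  qed
  have "multiplicity p (n choose k) + multiplicity p (fact k :: nat) = multiplicity p ((n choose k) * fact k)"
    using assms by (intro prime_elem_multiplicity_mult_distrib[symmetric]) auto
  also have "\<dots> = (\<Sum>i<k. multiplicity p (n - i))"
    unfolding binomial_fact_prod by (rule prime_multiplicity_prod_nat) (use assms pos in auto)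
  also have "\<dots> \<le> (\<Sum>i<k. if i = n - 2 * p then 1 else 0)"
  proof (intro sum_mono)
    fix i assume "i \<in> {..<k}"
    hence i: "i < k" by simp
    show "multiplicity p (n - i) \<le> (if i = n - 2 * p then 1 else 0)"
    proof (cases "p dvd n - i")
      case True
      have "multiplicity p (n - i) = multiplicity p (2 * p)" using only[OF i True] by simp
      also have "\<dots> = multiplicity p 2 + multiplicity p p"
        using assms by (intro prime_elem_multiplicity_mult_distrib) auto
      also have "\<dots> = 1" using assms by (simp add: not_dvd_imp_multiplicity_0 nat_dvd_not_less)
      finally show ?thesis using only[OF i True] i pos[OF i] by auto
    qed (simp add: not_dvd_imp_multiplicity_0)
  qed
  also have "\<dots> \<le> 1" by (cases "n - 2 * p < k") auto
  finally have "multiplicity p (n choose k) + multiplicity p (fact k :: nat) \<le> 1" .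
  moreover have "1 \<le> multiplicity p (n choose k)" using dvd assms by (intro multiplicity_geI) auto
  moreover have "1 \<le> multiplicity p (fact k :: nat)"
    using assms by (intro multiplicity_geI) (auto simp: prime_dvd_fact_iff)
  ultimately show False by simp
qed

section \<open>Large values of k\<close>

lemma not_obstruction_cases:
  assumes "\<not> degree_obstruction n k d" "l \<le> k" "prime p" "k < p" "p dvd n - l"
  shows "l = d \<or> l = k - d \<or> p\<^sup>2 dvd n - l \<and> (l = 2 * d \<or> l = k - 2 * d \<or> 2 * d = k \<and> even l)"
  using assms unfolding degree_obstruction_def by blast

text \<open>A prime above \<open>k\<close> has square at least \<open>(k + 1)^2\<close>, so half
  edges cannot occur. The bound thus covers \<open>2 * d = k\<close> as well.\<close>

lemma card_rough_positions_le2: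
  assumes "\<not> degree_obstruction n k d" "k \<le> n" "n < (k + 1)\<^sup>2"
  shows "card (rough_positions n k) \<le> 2"
proof -
  have "rough_positions n k \<subseteq> {d, k - d}"
  proof
    fix l assume "l \<in> rough_positions n k"
    then obtain p where l: "l < k" "prime p" "k < p" "p dvd n - l" unfolding rough_positions_def by auto
    have "\<not> p\<^sup>2 dvd n - l"
    proof
      assume "p\<^sup>2 dvd n - l"
      hence "p\<^sup>2 \<le> n - l" using l assms(2) by (intro dvd_imp_le) auto
      moreover have "(k + 1)\<^sup>2 \<le> p\<^sup>2" using l by (intro power_mono) auto
      ultimately show False using assms(3) by linarith
    qed
    thus "l \<in> {d, k - d}" using not_obstruction_cases[OF assms(1) _ l(2-4)] l(1) by auto
  qed
  hence "card (rough_positions n k) \<le> card {d, k - d}" by (intro card_mono) auto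
  also have "\<dots> \<le> 2" by (simp add: card_insert_if)
  finally show ?thesis .
qed

lemma card_rough_positions_le4:
  assumes "\<not> degree_obstruction n k d" "2 * d \<noteq> k"
  shows "card (rough_positions n k) \<le> 4"
proof -
  have "rough_positions n k \<subseteq> {d, k - d, 2 * d, k - 2 * d}"
  proof
    fix l assume "l \<in> rough_positions n k"
    then obtain p where l: "l < k" "prime p" "k < p" "p dvd n - l" unfolding rough_positions_def by auto
    show "l \<in> {d, k - d, 2 * d, k - 2 * d}"
      using not_obstruction_cases[OF assms(1) _ l(2-4)] l(1) assms(2) by auto
  qed
  hence "card (rough_positions n k) \<le> card {d, k - d, 2 * d, k - 2 * d}" by (intro card_mono) auto
  also have "\<dots> \<le> 4" by (simp add: card_insert_if)
  finally show ?thesis .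
qed

lemma obstruction_if_binomial_gt:
  assumes "k \<le> n" "0 < n"
    and "n < (k + 1)\<^sup>2 \<and> c = 2 \<or> 2 * d \<noteq> k \<and> c = 4"
    and "n ^ (c + card (primes_upto k)) < n choose k"
  shows "degree_obstruction n k d"
proof (rule ccontr)
  assume no: "\<not> degree_obstruction n k d"
  have "card (rough_positions n k) \<le> c"
    using assms(3) card_rough_positions_le2[OF no assms(1)] card_rough_positions_le4[OF no] by auto
  thus False using binomial_le_power_prime_count[OF assms(1,2)] assms(4) by fastforce
qed

text \<open>Take \<open>l = n - p\<close>. Then \<open>n - l\<close> is the prime \<open>p\<close>
  itself, which \<open>p^2\<close> does not divide, so without an obstruction \<open>l\<close> must
  be \<open>d\<close> or \<open>k - d\<close>. Three different primes give three values of
  \<open>l\<close>. The bound \<open>2 * n < 3 * a\<close> ensures both \<open>k < p\<close> and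
  \<open>n - p \<le> k\<close>.\<close>

lemma obstruction_of_three_primes:
  assumes "prime a" "prime b" "prime c" "a < b" "b < c" "c \<le> n" "2 * n < 3 * a" "2 * k \<le> n" "n < 3 * k"
  shows "degree_obstruction n k d"
proof (rule ccontr)
  assume no: "\<not> degree_obstruction n k d"
  have "n - p = d \<or> n - p = k - d" if p: "prime p" "a \<le> p" "p \<le> c" for p
  proof -
    have kp: "k < p" "n - p \<le> k" "n - (n - p) = p" using assms p by auto
    have "\<not> p\<^sup>2 dvd p"
    proof
      assume "p\<^sup>2 dvd p"
      hence "p * p \<le> p" using p(1) prime_gt_0_nat by (auto dest!: dvd_imp_le simp: power2_eq_square)
      thus False using prime_gt_1_nat[OF p(1)] by simp
    qed
    thus ?thesis using not_obstruction_cases[OF no kp(2) p(1) kp(1)] unfolding kp(3) by auto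
  qed
  from this[of a] this[of b] this[of c] show False using assms by auto
qed

text \<open>Since \<open>n > k\<^sup>2\<close>, the quotient \<open>(n / k) ^ k\<close> exceeds \<open>n ^ (k / 2)\<close>.\<close>

lemma obstruction_of_large_n:
  assumes "29 \<le> k" "(k + 1)\<^sup>2 \<le> n" "2 * d \<noteq> k"
  shows "degree_obstruction n k d"
proof (rule obstruction_if_binomial_gt[where c = 4])
  let ?j = "4 + card (primes_upto k)"
  \<comment> \<open>The prime count bounds \<open>2 * ?j\<close> by \<open>k / 2 + 29 / 2\<close>,
    which is at most \<open>k\<close> from 29 on.\<close>
  have j: "2 * ?j \<le> k" using prime_count_le[of k] assms(1) by presburger
  have k2: "k\<^sup>2 < n" using assms(2) by (simp add: power2_eq_square)
  have kn: "k \<le> n" using k2 assms(1) by (meson le_trans less_imp_le_nat self_le_power zero_less_numeral le_eq_less_or_eq le_numeral_extra(1) one_le_numeral power2_nat_le_imp_le)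
  thus "k \<le> n" .
  show "0 < n" using k2 by simp
  have "real n ^ k = (real n / real k) ^ k * real k ^ k" using assms(1) by (simp add: power_divide)
  also have "\<dots> \<le> real (n choose k) * real k ^ k"
    using binomial_ge_n_over_k_pow_k[OF kn, where 'a = real] by (intro mult_right_mono) auto
  finally have "n ^ k \<le> (n choose k) * k ^ k" by (metis of_nat_le_iff of_nat_mult of_nat_power)
  hence "(n ^ k) ^ 2 \<le> ((n choose k) * k ^ k) ^ 2" by (rule power_mono) simp
  also have "\<dots> = (n choose k) ^ 2 * (k\<^sup>2) ^ k" by (simp add: power_mult_distrib power2_eq_square)
  also have "\<dots> < (n choose k) ^ 2 * n ^ k"
    using k2 kn assms(1) by (intro mult_strict_left_mono power_strict_mono) auto
  finally have "n ^ k * n ^ k < (n choose k) ^ 2 * n ^ k" by (simp add: power2_eq_square)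
  hence "n ^ k < (n choose k) ^ 2" by simp
  moreover have "(n ^ ?j)\<^sup>2 \<le> n ^ k"
    unfolding power_mult[symmetric] using j k2 by (intro power_increasing) auto
  ultimately have "(n ^ ?j)\<^sup>2 < (n choose k)\<^sup>2" by linarith
  thus "n ^ ?j < n choose k" by (rule power_less_imp_less_base) simp
qed (use assms in auto)

text \<open>The case \<open>n \<ge> 3 * k\<close> on a block of values of \<open>k\<close>. With \<open>R = 531441 / (768 * b) = 27\<^sup>4 / (4\<^sup>4 * 3 * b)\<close>
  the numerical hypothesis says \<open>R ^ u > (3 * b) ^ v\<close>.\<close>

lemma binomial_gt_block:
  assumes "5 \<le> k" "29 \<le> k" "k \<le> b" "3 * k \<le> n" "25 * u \<le> v * k" "0 < v"
    and num: "(3 * b) ^ v * (768 * b) ^ u < 531441 ^ u"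
  shows "n ^ (2 + card (primes_upto k)) < n choose k"
proof (rule binomial_gt_power_mono[of k "3 * k"])
  define j where "j = 2 + card (primes_upto k)"
  have j: "4 * j \<le> k + 21" using prime_count_le[of k] unfolding j_def by simp
  show "2 + card (primes_upto k) \<le> k" using j assms(2) unfolding j_def by presburger
  define L where "L = ln (3 * real b)"
  define R where "R = ln 531441 - ln (768 * real b)"
  have b: "0 < real b" "1 \<le> 3 * real b" using assms by auto
  have L0: "0 \<le> L" unfolding L_def using b by simp
  have "real ((3 * b) ^ v * (768 * b) ^ u) < real (531441 ^ u)" using num by (simp only: of_nat_less_iff)
  hence "ln (real ((3 * b) ^ v * (768 * b) ^ u)) < ln (real (531441 ^ u))"
    using b by (subst ln_less_cancel_iff) auto
  hence vu: "real v * L < real u * R"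
    unfolding L_def R_def using b by (simp add: ln_mult ln_realpow algebra_simps)
  have R0: "0 < R" using vu L0 assms(6) by (metis mult_nonneg_nonneg of_nat_0_le_iff linorder_not_le mult_nonneg_nonpos order_le_less_trans less_le)
  have "real v * (25 * L) < 25 * real u * R" using vu by simp
  also have "\<dots> \<le> (real v * real k) * R"
    using assms(5) R0 by (intro mult_right_mono) (simp_all flip: of_nat_mult)
  finally have "real v * (25 * L) < real v * (real k * R)" by simp
  hence main: "25 * L < real k * R" using assms(6) by simp
  have ln256: "ln (256 :: real) = 4 * ln 4" using ln_realpow[of 4 4] by simp
  have ln531441: "ln (531441 :: real) = 4 * ln 27" using ln_realpow[of 27 4] by simp
  have R: "R = 4 * ln 27 - 4 * ln 4 - L"
  proof -
    have "ln (768 * real b) = ln 256 + ln (3 * real b)" using b ln_mult[of 256 "3 * real b"] by simp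
    thus ?thesis unfolding R_def L_def ln531441 ln256 by simp
  qed
  have kL: "ln (3 * real k) \<le> L" unfolding L_def using assms by simp
  have lnk: "ln (real k) \<le> ln (3 * real k)" "0 \<le> ln (3 * real k)" using assms by auto
  show "(3 * k) ^ (2 + card (primes_upto k)) < 3 * k choose k"
  proof (rule ccontr)
    assume "\<not> ?thesis"
    hence "3 * k choose k \<le> (3 * k) ^ j" by (simp only: not_less j_def)
    hence "k * (3 * k choose k) * 4 ^ k \<le> k * (3 * k) ^ j * 4 ^ k" by (intro mult_le_mono) simp_all
    with binomial_triple_lower[OF assms(1)] have "27 ^ k \<le> k * (3 * k) ^ j * 4 ^ k" by (rule le_trans)
    hence "real (27 ^ k) \<le> real (k * (3 * k) ^ j * 4 ^ k)" by (simp only: of_nat_le_iff)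
    hence "ln (real (27 ^ k)) \<le> ln (real (k * (3 * k) ^ j * 4 ^ k))"
      using assms(1) by (subst ln_le_cancel_iff) auto
    hence "real k * ln 27 \<le> ln (real k) + real j * ln (3 * real k) + real k * ln 4"
      using assms(1) by (simp add: ln_mult ln_realpow algebra_simps)
    \<comment> \<open>Here \<open>4 * j \<le> k + 21\<close>, and \<open>4 * ln k\<close> is at most
      \<open>4 * ln (3 * k)\<close>; together they give the coefficient \<open>k + 25\<close>, the
      source of the 25 in the hypothesis on \<open>u\<close> and \<open>v\<close>.\<close>
    hence "4 * (real k * ln 27) \<le> 4 * ln (real k) + (4 * real j) * ln (3 * real k) + 4 * (real k * ln 4)"
      by linarith
    also have "(4 * real j) * ln (3 * real k) \<le> (real k + 21) * ln (3 * real k)"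
      using j lnk by (intro mult_right_mono) linarith+
    finally have "4 * (real k * ln 27) \<le> (real k + 25) * ln (3 * real k) + 4 * (real k * ln 4)"
      using lnk by (simp add: algebra_simps)
    also have "(real k + 25) * ln (3 * real k) \<le> (real k + 25) * L" using kL by (intro mult_left_mono) auto
    finally have "real k * R \<le> 25 * L" unfolding R by (simp add: algebra_simps)
    thus False using main by simp
  qed
qed (use assms in auto)

lemma binomial_gt_medium:
  assumes "50 \<le> k" "k \<le> 400" "3 * k \<le> n"
  shows "n ^ (2 + card (primes_upto k)) < n choose k"
proof -
  \<comment> \<open>Each block ends at the value passed for \<open>b\<close> and starts no lower
    than \<open>25 * u / v\<close>; the ratio \<open>u / v\<close> may grow with \<open>k\<close>,
    which allows longer blocks.\<close>
  have "k \<in> {50..54} \<or> k \<in> {55..62} \<or> k \<in> {63..74} \<or> k \<in> {75..100} \<or> k \<in> {100..150} \<or> k \<in> {150..230} \<or>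
     k \<in> {200..290} \<or> k \<in> {250..340} \<or> k \<in> {325..400}" using assms by auto
  thus ?thesis
  proof (elim disjE)
    assume "k \<in> {50..54}" thus ?thesis using assms by (intro binomial_gt_block[of k 54 n 2 1]) auto
  next
    assume "k \<in> {55..62}" thus ?thesis using assms by (intro binomial_gt_block[of k 62 n 11 5]) auto
  next
    assume "k \<in> {63..74}" thus ?thesis using assms by (intro binomial_gt_block[of k 74 n 5 2]) auto
  next
    assume "k \<in> {75..100}" thus ?thesis using assms by (intro binomial_gt_block[of k 100 n 3 1]) auto
  next
    assume "k \<in> {100..150}" thus ?thesis using assms by (intro binomial_gt_block[of k 150 n 4 1]) auto
  next
    assume "k \<in> {150..230}" thus ?thesis using assms by (intro binomial_gt_block[of k 230 n 6 1]) auto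
  next
    assume "k \<in> {200..290}" thus ?thesis using assms by (intro binomial_gt_block[of k 290 n 8 1]) auto
  next
    assume "k \<in> {250..340}" thus ?thesis using assms by (intro binomial_gt_block[of k 340 n 10 1]) auto
  next
    assume "k \<in> {325..400}" thus ?thesis using assms by (intro binomial_gt_block[of k 400 n 13 1]) auto
  qed
qed

section \<open>Logarithmic inequalities for large k\<close>

lemma ln2_bounds: "2 / 3 \<le> ln (2 :: real)" "ln (2 :: real) \<le> 37 / 50"
proof -
  \<comment> \<open>The crude bound \<open>1 + x + x^2\<close> for the exponential is sharp enough
    only for small arguments, so 2/3 is split into eight steps of 1/12.\<close>
  have "exp (1 / 12 :: real) \<le> 1 + 1 / 12 + (1 / 12)\<^sup>2" by (rule exp_bound) auto
  hence "exp (1 / 12 :: real) ^ 8 \<le> (1 + 1 / 12 + (1 / 12)\<^sup>2) ^ 8" by (intro power_mono) auto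
  also have "\<dots> \<le> 2" by (simp add: power_numeral_reduce)
  finally have "exp (8 * (1 / 12 :: real)) \<le> 2" by (subst exp_of_nat_mult[of 8, simplified])
  thus "2 / 3 \<le> ln (2 :: real)" by (subst ln_ge_iff) auto
  have "1 + 37 / 50 + (37 / 50)\<^sup>2 / 2 \<le> exp (37 / 50 :: real)" by (rule exp_lower_Taylor_quadratic) auto
  hence "2 \<le> exp (37 / 50 :: real)" by (simp add: power2_eq_square)
  thus "ln (2 :: real) \<le> 37 / 50" by (metis ln_exp ln_le_cancel_iff exp_gt_zero zero_less_numeral)
qed

lemma ln_tangent: "0 < c \<Longrightarrow> 0 < x \<Longrightarrow> ln x \<le> x / c + ln c - (1 :: real)"
  using ln_le_minus_one[of "x / c"] by (simp add: ln_div)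

text \<open>The left side bounds the logarithm of all powers of \<open>n\<close> that arise; the
  argument \<open>9 * x / (16 * k)\<close> is the base \<open>9 * x / (4 * k)\<close> of the lower
  bound divided by 4 from Chebyshev's bound. If \<open>x \<le> 9 * k\<close>, the left side has
  order \<open>sqrt k * ln k\<close>. Otherwise \<open>v = k^(1/4)\<close> satisfies
  \<open>x < v^6\<close>, and even the weak estimate \<open>ln x \<le> 3 * v\<close> keeps the left
  side below a multiple of \<open>v^4 = k\<close>, while the logarithm on the right is at least
  \<open>ln 4\<close>.\<close>

lemma log_inequality_far:
  fixes k x :: real
  assumes k: "400 \<le> k" and x: "3 * k \<le> x" "x\<^sup>2 < k ^ 3"
  shows "(sqrt x + 25) / 4 * ln x < k * ln (9 * x / (16 * k))"
proof (cases "x \<le> 9 * k")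
  case True
  define u where "u = sqrt k"
  have u: "20 \<le> u" "k = u\<^sup>2" unfolding u_def using k by (auto intro: real_le_rsqrt)
  have x0: "1 \<le> x" using x k by simp
  have sx: "sqrt x \<le> 3 * u" "1 \<le> sqrt x"
    using True x0 u by (auto intro!: real_le_lsqrt simp: power_mult_distrib)
  have "ln x = 2 * ln (sqrt x)" using x0 by (simp add: ln_sqrt)
  also have "\<dots> \<le> 2 * ln (3 * u)" using sx u by simp
  also have "\<dots> \<le> 2 * (3 * u / 60 + ln 60 - 1)" using ln_tangent[of 60 "3 * u"] u by simp
  also have "ln (60 :: real) \<le> 111 / 25"
  proof -
    have "ln (60 :: real) \<le> ln (2 ^ 6)" by (subst ln_le_cancel_iff) auto
    also have "\<dots> = 6 * ln 2" by (subst ln_realpow) auto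
    finally show ?thesis using ln2_bounds by simp
  qed
  finally have lx: "ln x \<le> u / 10 + 172 / 25" by simp
  have "(sqrt x + 25) / 4 * ln x \<le> (3 * u + 25) / 4 * (u / 10 + 172 / 25)"
    using sx lx x0 u(1) by (intro mult_mono) auto
  also have "\<dots> < u\<^sup>2 * (1 / 2)"
  proof -
    have "(3 * u + 25) / 4 * (u / 10 + 172 / 25) = 3 / 40 * u\<^sup>2 + 1157 / 200 * u + 43"
      by (simp add: field_simps power2_eq_square)
    moreover have "20 * u \<le> u\<^sup>2" using u by (simp add: power2_eq_square)
    ultimately show ?thesis using u(1) by simp
  qed
  also have "\<dots> \<le> k * ln (9 * x / (16 * k))"
    unfolding u(2)[symmetric]
  proof (intro mult_left_mono)
    have "3 * ln 2 \<le> 4 * ln (27 / 16 :: real)"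
    proof -
      have "ln (2 ^ 3 :: real) \<le> ln ((27 / 16) ^ 4)" by (subst ln_le_cancel_iff) (auto simp: power_numeral_reduce)
      thus ?thesis by (simp only: ln_realpow of_nat_numeral)
    qed
    moreover have "ln (27 / 16) \<le> ln (9 * x / (16 * k))" using k x by (subst ln_le_cancel_iff) (auto simp: field_simps)
    ultimately show "1 / 2 \<le> ln (9 * x / (16 * k))" using ln2_bounds by linarith
  qed (use k in auto)
  finally show ?thesis .
next
  case False
  define v where "v = sqrt (sqrt k)"
  have sk: "20 \<le> sqrt k" using k by (auto intro: real_le_rsqrt)
  have "v\<^sup>2 = sqrt k" unfolding v_def using k by simp
  hence "k = (v\<^sup>2)\<^sup>2" using k by simp
  hence v: "4 \<le> v" "k = v ^ 4" using sk unfolding v_def by (auto intro: real_le_rsqrt)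
  have x0: "1 \<le> x" using x k by simp
  have "x\<^sup>2 < (v ^ 6)\<^sup>2" using x(2) unfolding v(2) by (simp flip: power_mult)
  hence xv: "x < v ^ 6" using v by (intro power_less_imp_less_base[of x 2]) auto
  have "x < (v ^ 3)\<^sup>2" using xv by (simp flip: power_mult)
  hence sx: "sqrt x \<le> v ^ 3" using x0 v by (intro real_le_lsqrt) auto
  have "ln x \<le> ln (v ^ 6)" using xv x0 by (subst ln_le_cancel_iff) auto
  also have "\<dots> = 6 * ln v" using v by (simp add: ln_realpow)
  also have "\<dots> \<le> 6 * (v / 2 + ln 2 - 1)" using ln_tangent[of 2 v] v by simp
  finally have lx: "ln x \<le> 3 * v" using ln2_bounds by simp
  have "(sqrt x + 25) / 4 * ln x \<le> (v ^ 3 + 25) / 4 * (3 * v)"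
    using sx lx x0 v by (intro mult_mono) auto
  also have "\<dots> < v ^ 4 * (4 / 3)"
  proof -
    have "64 \<le> v ^ 3" using power_mono[of 4 v 3] v(1) by simp
    hence "64 * v \<le> v ^ 3 * v" using v(1) by (intro mult_right_mono) auto
    thus ?thesis using v(1) by (simp add: algebra_simps power_numeral_reduce)
  qed
  also have "\<dots> \<le> k * ln (9 * x / (16 * k))"
    unfolding v(2)[symmetric]
  proof (intro mult_left_mono)
    have "2 * ln 2 = ln (2 ^ 2 :: real)" by (subst ln_realpow) auto
    also have "\<dots> \<le> ln (9 * x / (16 * k))" using k False by (subst ln_le_cancel_iff) (auto simp: field_simps)
    finally show "4 / 3 \<le> ln (9 * x / (16 * k))" using ln2_bounds by linarith
  qed (use k in auto)
  finally show ?thesis .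
qed

lemma log_inequality_near:
  fixes k x :: real
  assumes k: "400 \<le> k" and x: "2 * k \<le> x" "x \<le> 3 * k"
  shows "(sqrt x + 25) / 4 * ln x + x / 3 * ln 4 < k * ln 4 + (x - 2 * k) * ln (3 / 2)"
proof -
  define w where "w = sqrt (3 * k)"
  have w: "34 \<le> w" "3 * k = w\<^sup>2" unfolding w_def using k by (auto intro: real_le_rsqrt)
  have x0: "1 \<le> x" using x k by simp
  have sx: "sqrt x \<le> w" "1 \<le> sqrt x" unfolding w_def using x x0 by auto
  have "ln x = 2 * ln (sqrt x)" using x0 by (simp add: ln_sqrt)
  also have "\<dots> \<le> 2 * ln w" using sx w by simp
  also have "\<dots> \<le> 2 * (w / 32 + ln 32 - 1)" using ln_tangent[of 32 w] w by simp
  also have "ln (32 :: real) = 5 * ln 2" using ln_realpow[of 2 5] by simp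
  finally have lx: "ln x \<le> w / 16 + 27 / 5" using ln2_bounds by simp
  have "(sqrt x + 25) / 4 * ln x \<le> (w + 25) / 4 * (w / 16 + 27 / 5)"
    using sx lx x0 w by (intro mult_mono) auto
  also have "\<dots> < w\<^sup>2 / 3 * (7 / 18)"
  proof -
    have "(w + 25) / 4 * (w / 16 + 27 / 5) = w\<^sup>2 / 64 + 557 / 320 * w + 135 / 4"
      by (simp add: field_simps power2_eq_square)
    moreover have "34 * w \<le> w\<^sup>2" using w by (simp add: power2_eq_square)
    ultimately show ?thesis using w(1) by simp
  qed
  also have "\<dots> \<le> k * ln (3 / 2)"
  proof -
    have "7 * ln 2 \<le> 12 * ln (3 / 2 :: real)"
    proof -
      have "ln (2 ^ 7 :: real) \<le> ln ((3 / 2) ^ 12)" by (subst ln_le_cancel_iff) (auto simp: power_numeral_reduce)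
      thus ?thesis by (simp only: ln_realpow of_nat_numeral)
    qed
    hence "7 / 18 \<le> ln (3 / 2 :: real)" using ln2_bounds by linarith
    thus ?thesis using w(2)[symmetric] k by simp
  qed
  \<comment> \<open>The difference of the two sides without the term in \<open>sqrt x\<close> is
    linear and nonincreasing in \<open>x\<close>, because \<open>(3/2)^3 \<le> 4\<close>. So the
    worst case is \<open>x = 3 * k\<close>, where it equals \<open>k * ln (3 / 2)\<close>.\<close>
  also have "\<dots> \<le> k * ln (3 / 2) + (3 * k - x) * (ln 4 / 3 - ln (3 / 2))"
  proof -
    have "ln ((3 / 2) ^ 3) \<le> ln (4 :: real)" by (subst ln_le_cancel_iff) (auto simp: power_numeral_reduce)
    hence "3 * ln (3 / 2) \<le> ln (4 :: real)" by (simp only: ln_realpow of_nat_numeral)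
    hence "0 \<le> (3 * k - x) * (ln 4 / 3 - ln (3 / 2))" using x by (intro mult_nonneg_nonneg) auto
    thus ?thesis by simp
  qed
  also have "\<dots> = k * ln 4 + (x - 2 * k) * ln (3 / 2) - x / 3 * ln 4" by (simp add: field_simps)
  finally show ?thesis by linarith
qed

lemma floor_sqrt_exists:
  obtains r :: nat where "n < (r + 1)\<^sup>2" "real r \<le> sqrt (real n)"
proof
  let ?r = "nat \<lfloor>sqrt (real n)\<rfloor>"
  show "real ?r \<le> sqrt (real n)" by simp
  have "sqrt (real n) < real (?r + 1)" by linarith
  hence "sqrt (real n) ^ 2 < real (?r + 1) ^ 2" by (intro power_strict_mono) auto
  hence "real n < real ((?r + 1)\<^sup>2)" by simp
  thus "n < (?r + 1)\<^sup>2" by (simp only: of_nat_less_iff)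
qed

lemma obstruction_of_large_k:
  assumes k: "400 \<le> k" "2 * k \<le> n" and n: "n < (k + 1)\<^sup>2" "n\<^sup>2 < k ^ 3"
  shows "degree_obstruction n k d"
proof (rule ccontr)
  assume no: "\<not> degree_obstruction n k d"
  have kn: "k \<le> n" "0 < n" using k by auto
  have card2: "card (rough_positions n k) \<le> 2" using card_rough_positions_le2[OF no kn(1) n(1)] .
  obtain r where r: "n < (r + 1)\<^sup>2" "real r \<le> sqrt (real n)" by (rule floor_sqrt_exists)
  \<comment> \<open>The 3 consists of two rough positions and one more power of \<open>n\<close>,
    which absorbs the factor \<open>k\<close> or \<open>2 * k\<close> of the lower bound.\<close>
  define q where "q = 3 + card (primes_upto r)"
  have "4 * q \<le> r + 25" using prime_count_le[of r] unfolding q_def by simp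
  hence "4 * real q \<le> real r + 25" by linarith
  hence q: "real q \<le> (sqrt (real n) + 25) / 4" using r(2) by (simp add: field_simps)
  have ln0: "0 \<le> ln (real n)" using kn by simp
  have qln: "real q * ln (real n) \<le> (sqrt (real n) + 25) / 4 * ln (real n)"
    using q ln0 by (rule mult_right_mono)
  have bound: "n choose k \<le> n ^ 2 * (n ^ card (primes_upto r) * 4 ^ y)"
    if "\<And>p. prime p \<Longrightarrow> r < p \<Longrightarrow> y < p \<Longrightarrow> p \<le> k \<Longrightarrow> \<not> p dvd n choose k" for y
    by (rule order_trans[OF binomial_le_rough_times_smooth[OF kn card2]])
       (intro mult_left_mono smooth_part_le, use kn r(1) that in auto)
  show False
  proof (cases "3 * k \<le> n")
    case True
    have "(9 * n) ^ k \<le> k * (n choose k) * (4 * k) ^ k" using k True by (intro binomial_lower_large) auto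
    also have "\<dots> \<le> n * (n ^ 2 * (n ^ card (primes_upto r) * 4 ^ k)) * (4 * k) ^ k"
      using kn bound[of k] by (intro mult_mono) auto
    also have "\<dots> = n ^ q * (16 * k) ^ k"
      unfolding q_def by (simp add: power_add power_mult_distrib power_numeral_reduce flip: power_mult_distrib[of 4 4])
    finally have "real ((9 * n) ^ k) \<le> real (n ^ q * (16 * k) ^ k)" by (simp only: of_nat_le_iff)
    hence "ln (real ((9 * n) ^ k)) \<le> ln (real (n ^ q * (16 * k) ^ k))"
      using kn k by (subst ln_le_cancel_iff) auto
    hence "real k * ln (9 * real n) \<le> real q * ln (real n) + real k * ln (16 * real k)"
      using kn k by (simp add: ln_mult ln_realpow algebra_simps)
    hence "real k * (ln (9 * real n) - ln (16 * real k)) \<le> real q * ln (real n)"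
      by (simp add: algebra_simps)
    also have "ln (9 * real n) - ln (16 * real k) = ln (9 * real n / (16 * real k))"
      using kn k by (subst ln_div) auto
    finally have "real k * ln (9 * real n / (16 * real k)) \<le> (sqrt (real n) + 25) / 4 * ln (real n)"
      using qln by linarith
    moreover have "(real n)\<^sup>2 < real k ^ 3" using n(2) by (metis of_nat_less_iff of_nat_power)
    ultimately show False using log_inequality_far[of "real k" "real n"] k True by simp
  next
    case False
    define t where "t = n - 2 * k"
    have "4 ^ k / (2 * real k) \<le> real (2 * k choose k)" using k by (intro central_binomial_lower_bound) auto
    hence "4 ^ k \<le> 2 * real k * real (2 * k choose k)" using k by (simp add: field_simps)
    hence c: "4 ^ k \<le> 2 * k * (2 * k choose k)"
      by (metis of_nat_le_iff of_nat_mult of_nat_numeral of_nat_power)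
    have "4 ^ k * 3 ^ t \<le> 2 * k * ((2 * k choose k) * 3 ^ t)" using c by simp
    also have "\<dots> \<le> 2 * k * ((n choose k) * 2 ^ t)"
      unfolding t_def using k False binomial_lower_middle[of k n] by simp
    \<comment> \<open>Here the cut-off is \<open>y = n div 3\<close>: larger primes up to
      \<open>k\<close> do not divide the binomial coefficient. With \<open>y = k\<close> the bound
      \<open>4^k\<close> would swallow the main term of the central binomial coefficient.\<close>
    also have "\<dots> \<le> n * ((n ^ 2 * (n ^ card (primes_upto r) * 4 ^ (n div 3))) * 2 ^ t)"
    proof (intro mult_mono bound)
      fix p assume p: "prime p" "r < p" "n div 3 < p" "p \<le> k"
      have "n < 3 * p" using p(3) by linarith
      moreover have "3 \<le> p" using p(3) k by linarith
      ultimately show "\<not> p dvd n choose k" using p k by (intro large_prime_not_dvd_binomial) auto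
    qed (use k in auto)
    also have "\<dots> = n ^ q * 4 ^ (n div 3) * 2 ^ t"
      unfolding q_def by (simp add: power_add power_numeral_reduce)
    finally have "real (4 ^ k * 3 ^ t) \<le> real (n ^ q * 4 ^ (n div 3) * 2 ^ t)" by (simp only: of_nat_le_iff)
    hence "ln (real (4 ^ k * 3 ^ t)) \<le> ln (real (n ^ q * 4 ^ (n div 3) * 2 ^ t))"
      using kn k by (subst ln_le_cancel_iff) auto
    hence "real k * ln 4 + real t * ln 3 \<le> real q * ln (real n) + real (n div 3) * ln 4 + real t * ln 2"
      using kn k by (simp add: ln_mult ln_realpow)
    also have "real (n div 3) * ln 4 \<le> real n / 3 * ln 4"
    proof (intro mult_right_mono)
      have "real (3 * (n div 3)) \<le> real n" by (simp only: of_nat_le_iff times_div_less_eq_dividend)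
      thus "real (n div 3) \<le> real n / 3" by simp
    qed auto
    finally have "real k * ln 4 + real t * (ln 3 - ln 2) \<le> (sqrt (real n) + 25) / 4 * ln (real n) + real n / 3 * ln 4"
      using qln unfolding right_diff_distrib by linarith
    also have "ln 3 - ln 2 = ln (3 / 2 :: real)" by (subst ln_div) auto
    also have "real t = real n - 2 * real k" unfolding t_def using k by (simp add: of_nat_diff)
    finally show False using log_inequality_near[of "real k" "real n"] k False by simp
  qed
qed

text \<open>From \<open>k^3 \<le> n^2\<close> the quotient \<open>n / k\<close> is at least the cube
  root of \<open>n\<close>, so \<open>n choose k\<close> is at least \<open>n^(k / 3)\<close>. The
  prime count makes \<open>3 * (2 + pi(k))\<close> smaller than \<open>k\<close> from 64 on.\<close>

lemma binomial_gt_far: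
  assumes "64 \<le> k" "k ^ 3 \<le> n\<^sup>2" "k \<le> n"
  shows "n ^ (2 + card (primes_upto k)) < n choose k"
proof -
  let ?j = "2 + card (primes_upto k)"
  have j: "3 * ?j < k" using prime_count_le[of k] assms(1) by presburger
  have n1: "1 < n" using assms by linarith
  have "real n ^ k = (real n / real k) ^ k * real k ^ k" using assms(1) by (simp add: power_divide)
  also have "\<dots> \<le> real (n choose k) * real k ^ k"
    using binomial_ge_n_over_k_pow_k[OF assms(3), where 'a = real] by (intro mult_right_mono) auto
  finally have "n ^ k \<le> (n choose k) * k ^ k" by (metis of_nat_le_iff of_nat_mult of_nat_power)
  hence "(n ^ k) ^ 3 \<le> ((n choose k) * k ^ k) ^ 3" by (rule power_mono) simp
  also have "\<dots> = (n choose k) ^ 3 * (k ^ 3) ^ k"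
    unfolding power_mult_distrib power_mult[symmetric] by (simp add: mult.commute)
  also have "\<dots> \<le> (n choose k) ^ 3 * (n\<^sup>2) ^ k" using assms by (intro mult_left_mono power_mono) auto
  finally have "n ^ k * (n\<^sup>2) ^ k \<le> (n choose k) ^ 3 * (n\<^sup>2) ^ k"
    by (simp add: power2_eq_square power3_eq_cube power_mult_distrib mult.assoc)
  hence "n ^ k \<le> (n choose k) ^ 3" using n1 by simp
  moreover have "n ^ (3 * ?j) < n ^ k" using j n1 by (intro power_strict_increasing) auto
  ultimately have "(n ^ ?j) ^ 3 < (n choose k) ^ 3"
    unfolding power_mult[symmetric] by (simp add: mult.commute)
  thus ?thesis by (rule power_less_imp_less_base) simp
qed

section \<open>Sieving for pairs of smooth numbers\<close>

fun merge_asc :: "int list \<Rightarrow> int list \<Rightarrow> int list" where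
  "merge_asc [] ys = ys"
| "merge_asc (x # xs) [] = x # xs"
| "merge_asc (x # xs) (y # ys) = (if x \<le> y then x # merge_asc xs (y # ys) else y # merge_asc (x # xs) ys)"

fun powers_times :: "nat \<Rightarrow> int \<Rightarrow> int \<Rightarrow> int list \<Rightarrow> int list" where
  "powers_times 0 p N ys = ys"
| "powers_times (Suc a) p N ys = merge_asc ys (powers_times a p N (filter (\<lambda>y. y \<le> N) (map (\<lambda>y. p * y) ys)))"

fun smooth_list :: "int \<Rightarrow> (int \<times> nat) list \<Rightarrow> int list" where
  "smooth_list N [] = [1]"
| "smooth_list N ((p, a) # ps) = powers_times a p N (smooth_list N ps)"

text \<open>Two pointers run through the ascending lists in search of members at distance
  \<open>g\<close>. Each hit carries the members of \<open>ys\<close> between its two ends, so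
  smoothness of the numbers in between is later decided by a short list.\<close>

fun gap_windows :: "int \<Rightarrow> int list \<Rightarrow> int list \<Rightarrow> (int \<times> int list) list" where
  "gap_windows g [] ys = []"
| "gap_windows g (x # xs) [] = []"
| "gap_windows g (x # xs) (y # ys) = (if x < y + g then gap_windows g xs (y # ys)
     else if y + g < x then gap_windows g (x # xs) ys
     else (x, takeWhile (\<lambda>w. w \<le> x) (y # ys)) # gap_windows g xs ys)"

lemma set_merge_asc [simp]: "set (merge_asc xs ys) = set xs \<union> set ys"
  by (induction xs ys rule: merge_asc.induct) auto

lemma sorted_merge_asc: "sorted xs \<Longrightarrow> sorted ys \<Longrightarrow> sorted (merge_asc xs ys)"
  by (induction xs ys rule: merge_asc.induct) auto

lemma sorted_powers_times: "0 < p \<Longrightarrow> sorted ys \<Longrightarrow> sorted (powers_times a p N ys)"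
proof (induction a arbitrary: ys)
  case (Suc a)
  have "sorted (map (\<lambda>y. p * y) ys)"
    using Suc.prems by (intro sorted_map_mono) (auto simp: mono_on_def)
  hence "sorted (filter (\<lambda>y. y \<le> N) (map (\<lambda>y. p * y) ys))" by (rule sorted_filter[where f = id, simplified])
  thus ?case using Suc by (simp add: sorted_merge_asc)
qed simp

lemma powers_times_complete:
  "y \<in> set ys \<Longrightarrow> b \<le> a \<Longrightarrow> 1 \<le> p \<Longrightarrow> 0 < y \<Longrightarrow> p ^ b * y \<le> N \<Longrightarrow> p ^ b * y \<in> set (powers_times a p N ys)"
proof (induction a arbitrary: ys y b)
  case (Suc a)
  show ?case
  proof (cases b)
    case (Suc c)
    have "1 * (p * y) \<le> p ^ c * (p * y)" using Suc.prems Suc by (intro mult_right_mono) auto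
    also have "p ^ c * (p * y) = p ^ b * y" using Suc by simp
    finally have "p * y \<le> p ^ b * y" by (simp only: mult_1_left)
    hence "p * y \<le> N" using Suc.prems(5) by (rule order_trans)
    hence "p * y \<in> set (filter (\<lambda>y. y \<le> N) (map (\<lambda>y. p * y) ys))" using Suc.prems by auto
    from Suc.IH[OF this, of c] have "p ^ c * (p * y) \<in> set (powers_times a p N (filter (\<lambda>y. y \<le> N) (map (\<lambda>y. p * y) ys)))"
      using Suc.prems Suc by (simp add: mult_ac)
    moreover have "p ^ c * (p * y) = p ^ b * y" using Suc by simp
    ultimately show ?thesis unfolding powers_times.simps set_merge_asc by simp
  qed (use Suc.prems in simp)
qed simp

lemma sorted_smooth_list: "\<forall>(p, a)\<in>set ps. prime p \<Longrightarrow> sorted (smooth_list N ps)"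
  by (induction N ps rule: smooth_list.induct) (auto intro!: sorted_powers_times prime_gt_0_int)

lemma smooth_list_complete:
  assumes "\<forall>(p, a)\<in>set ps. prime p \<and> N < p ^ Suc a" "0 < x" "x \<le> N"
    and "\<And>q. prime q \<Longrightarrow> q dvd x \<Longrightarrow> q \<in> fst ` set ps"
  shows "x \<in> set (smooth_list N ps)"
  using assms
proof (induction N ps arbitrary: x rule: smooth_list.induct)
  case (1 N)
  have "is_unit x"
  proof (rule ccontr)
    assume "\<not> is_unit x"
    then obtain q where "prime q" "q dvd x" using prime_divisorE[of x] 1(2) by auto
    thus False using 1(4) by auto
  qed
  thus ?case using 1(2) by simp
next
  case (2 N p a ps)
  have p: "prime p" "N < p ^ Suc a" using 2(2) by auto
  have "\<not> is_unit p" using p(1) by auto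
  then obtain y where y: "x = p ^ multiplicity p x * y" "\<not> p dvd y"
    using multiplicity_decompose'[of x p] 2(3) by blast
  define b where "b = multiplicity p x"
  have p0: "1 < p" using prime_gt_1_int[OF p(1)] .
  have y0: "0 < y" using y(1) 2(3) p0 by (metis zero_less_mult_pos zero_less_power less_trans zero_less_one)
  have pb: "1 \<le> p ^ b" using p0 by simp
  have "1 * y \<le> p ^ b * y" using pb y0 by (intro mult_right_mono) auto
  hence yN: "y \<le> N" using y(1) 2(4) unfolding b_def by simp
  have "p ^ b * 1 \<le> p ^ b * y" using pb y0 by (intro mult_left_mono) auto
  hence "p ^ b < p ^ Suc a" using y(1) 2(4) p(2) unfolding b_def by simp
  hence ba: "b \<le> a" using p0 by (simp del: power_Suc)
  have "y \<in> set (smooth_list N ps)"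
  proof (rule 2(1))
    fix q :: int assume q: "prime q" "q dvd y"
    have "q dvd x" using q(2) y(1) by (metis dvd_mult)
    hence "q \<in> fst ` set ((p, a) # ps)" using 2(5) q(1) by blast
    moreover have "q \<noteq> p" using q(2) y(2) by auto
    ultimately show "q \<in> fst ` set ps" by auto
  qed (use 2(2) y0 yN in auto)
  hence "p ^ b * y \<in> set (powers_times a p N (smooth_list N ps))"
    using ba p0 y0 2(4) y(1) unfolding b_def by (intro powers_times_complete) auto
  thus ?case using y(1) unfolding b_def by simp
qed

lemma takeWhile_sorted_complete:
  fixes x :: int
  assumes "sorted ys" "w \<in> set ys" "w \<le> x"
  shows "w \<in> set (takeWhile (\<lambda>w. w \<le> x) ys)"
  using assms
proof (induction ys)
  case (Cons a ys)
  have "a \<le> x" using Cons.prems by fastforce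
  thus ?case using Cons by auto
qed simp

lemma gap_windows_complete:
  "sorted xs \<Longrightarrow> sorted ys \<Longrightarrow> z \<in> set xs \<Longrightarrow> z - g \<in> set ys \<Longrightarrow>
     \<exists>W. (z, W) \<in> set (gap_windows g xs ys) \<and> (\<forall>w\<in>set ys. z - g \<le> w \<longrightarrow> w \<le> z \<longrightarrow> w \<in> set W)"
proof (induction g xs ys rule: gap_windows.induct)
  case (3 g x xs y ys)
  consider "x < y + g" | "y + g < x" | "x = y + g" by linarith
  thus ?case
  proof cases
    case 1
    have "z \<noteq> x" using 1 3(4-7) by auto
    hence "\<exists>W. (z, W) \<in> set (gap_windows g xs (y # ys)) \<and> (\<forall>w\<in>set (y # ys). z - g \<le> w \<longrightarrow> w \<le> z \<longrightarrow> w \<in> set W)"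
      by (intro 3(1)) (use 1 3(4-7) in auto)
    thus ?thesis using 1 by simp
  next
    case 2
    have zx: "x \<le> z" using 3(4,6) by auto
    hence "z - g \<noteq> y" using 2 by auto
    hence "\<exists>W. (z, W) \<in> set (gap_windows g (x # xs) ys) \<and> (\<forall>w\<in>set ys. z - g \<le> w \<longrightarrow> w \<le> z \<longrightarrow> w \<in> set W)"
      by (intro 3(2)) (use 2 3(4-7) in auto)
    moreover have "\<not> z - g \<le> y" using zx 2 by linarith
    ultimately show ?thesis using 2 by auto
  next
    case eq: 3
    show ?thesis
    proof (cases "z = x")
      case True
      have "(z, takeWhile (\<lambda>w. w \<le> x) (y # ys)) \<in> set (gap_windows g (x # xs) (y # ys))"
        using eq True by simp
      moreover have "w \<in> set (takeWhile (\<lambda>w. w \<le> x) (y # ys))" if "w \<in> set (y # ys)" "w \<le> z" for w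
        using takeWhile_sorted_complete[OF 3(5)] that True by blast
      ultimately show ?thesis by blast
    next
      case False
      have zx: "x < z" using False 3(4,6) by fastforce
      hence "z - g \<noteq> y" using eq by auto
      hence "\<exists>W. (z, W) \<in> set (gap_windows g xs ys) \<and> (\<forall>w\<in>set ys. z - g \<le> w \<longrightarrow> w \<le> z \<longrightarrow> w \<in> set W)"
        by (intro 3(3)) (use False eq 3(4-7) in auto)
      moreover have "\<not> z - g \<le> y" using zx eq by linarith
      ultimately show ?thesis using eq by auto
    qed
  qed
qed auto

text \<open>The primes below 89. Whenever \<open>p^2 \<le> N < 6889 = 83^2\<close>, the prime
  \<open>p\<close> is in the list, and trial division by the list decides primality below
  \<open>7921 = 89^2\<close>.\<close>

definition small_primes :: "int list" where
  "small_primes = [2, 3, 5, 7, 11, 13, 17, 19, 23, 29, 31, 37, 41, 43, 47, 53, 59, 61, 67, 71, 73, 79, 83]"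

lemma small_primes_prime: "p \<in> set small_primes \<Longrightarrow> prime p"
  unfolding small_primes_def by auto

lemma small_primes_complete:
  assumes "prime p" "p < 89"
  shows "p \<in> set small_primes"
proof (rule ccontr)
  assume np: "p \<notin> set small_primes"
  have p1: "1 < p" using prime_gt_1_int[OF assms(1)] .
  have nd: "\<not> q dvd p" if "q \<in> set small_primes" for q
    using primes_dvd_imp_eq[of q p] small_primes_prime[OF that] assms(1) np that by auto
  \<comment> \<open>A composite number below 121 has a prime factor 2, 3, 5 or 7, so these four
    residues decide the matter for all \<open>p < 89\<close>.\<close>
  have "p mod 2 \<noteq> 0" "p mod 3 \<noteq> 0" "p mod 5 \<noteq> 0" "p mod 7 \<noteq> 0"
    using nd[of 2] nd[of 3] nd[of 5] nd[of 7] unfolding small_primes_def dvd_eq_mod_eq_0 by simp_all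
  moreover have "p \<notin> {11, 13, 17, 19, 23, 29, 31, 37, 41, 43, 47, 53, 59, 61, 67, 71, 73, 79, 83}"
    using np unfolding small_primes_def by auto
  ultimately show False using p1 assms(2) by simp presburger
qed

definition sieve_data_ok :: "int \<Rightarrow> int \<Rightarrow> (int \<times> nat) list \<Rightarrow> int list \<Rightarrow> bool" where
  "sieve_data_ok k N ps sqs \<longleftrightarrow> k < 83 \<and> N < 6889 \<and> (\<forall>(p, a)\<in>set ps. p \<in> set small_primes \<and> N < p ^ Suc a) \<and>
     (\<forall>p\<in>set small_primes. if p \<le> k then p \<in> fst ` set ps else p * p \<in> set sqs \<or> N < p * p)"

text \<open>Meant for offsets \<open>l\<close> where \<open>n - l\<close> is already known to have a
  prime factor above \<open>k\<close>. Only the remaining conditions of the obstruction are tested,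
  and the square condition is tested for all candidate primes at once.\<close>

fun some_offset_ok :: "int list \<Rightarrow> int \<Rightarrow> int \<Rightarrow> int \<Rightarrow> int list \<Rightarrow> bool" where
  "some_offset_ok sqs k n d [] = False"
| "some_offset_ok sqs k n d (l # ls) = (if l = d \<or> l = k - d then some_offset_ok sqs k n d ls
     else if l \<noteq> 2 * d \<and> l \<noteq> k - 2 * d \<and> (2 * d = k \<longrightarrow> l mod 2 = 1) then True
     else if list_all (\<lambda>s. (n - l) mod s \<noteq> 0) sqs then True else some_offset_ok sqs k n d ls)"

definition rough_offsets :: "int list \<Rightarrow> int \<Rightarrow> int list \<Rightarrow> int list" where
  "rough_offsets W n ls = filter (\<lambda>l. list_all (\<lambda>y. y \<noteq> n - l) W) ls"

text \<open>Without an obstruction both \<open>n - c\<close> and \<open>n - c - g\<close> must be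
  \<open>k\<close>-smooth. The check therefore visits pairs of smooth numbers at distance
  \<open>g\<close>, of which there are few, and not every \<open>n\<close>.\<close>

definition sieve_check :: "int \<Rightarrow> int \<Rightarrow> int \<Rightarrow> int \<Rightarrow> int \<Rightarrow> int list \<Rightarrow> int list \<Rightarrow> (int \<times> nat) list \<Rightarrow> int list \<Rightarrow> bool" where
  "sieve_check k N lo g c ds exc ps sqs = (let S = smooth_list N ps; ls = [c..c + g] in
     list_all (\<lambda>(y, W). let n = y + c in
        if n < lo \<or> N < n \<or> n \<in> set exc then True
        else let R = rough_offsets W n ls in list_all (\<lambda>d. some_offset_ok sqs k n d R) ds)
       (gap_windows g S S))"

lemma some_offset_okD:
  "some_offset_ok sqs k n d ls \<Longrightarrow> \<exists>l\<in>set ls. l \<noteq> d \<and> l \<noteq> k - d \<and>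
     (l \<noteq> 2 * d \<and> l \<noteq> k - 2 * d \<and> (2 * d = k \<longrightarrow> l mod 2 = 1) \<or> (\<forall>s\<in>set sqs. (n - l) mod s \<noteq> 0))"
  by (induction ls) (auto split: if_splits simp: list_all_iff)

lemma rough_of_not_in_smooth_list:
  fixes x k :: nat
  assumes sv: "sieve_data_ok (int k) N ps sqs" and x: "0 < x" "int x \<le> N" "int x \<notin> set (smooth_list N ps)"
  obtains p where "prime p" "k < p" "p dvd x"
proof -
  have ps: "\<forall>(p, a)\<in>set ps. prime p \<and> N < p ^ Suc a"
    using sv small_primes_prime unfolding sieve_data_ok_def by fast
  have "\<exists>q. prime q \<and> q dvd int x \<and> q \<notin> fst ` set ps"
  proof (rule ccontr)
    assume "\<not> ?thesis"
    hence "int x \<in> set (smooth_list N ps)" using x by (intro smooth_list_complete[OF ps]) auto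
    thus False using x(3) by simp
  qed
  then obtain q where q: "prime q" "q dvd int x" "q \<notin> fst ` set ps" by blast
  have "\<not> q \<le> int k"
  proof
    assume "q \<le> int k"
    hence "q \<in> set small_primes" using sv q(1) by (intro small_primes_complete) (auto simp: sieve_data_ok_def)
    thus False using \<open>q \<le> int k\<close> q(3) sv unfolding sieve_data_ok_def by auto
  qed
  hence "k < nat q" by linarith
  moreover have "prime (nat q)" using q(1) prime_int_nat_transfer[of q] by blast
  moreover have "int (nat q) dvd int x" using q(2) prime_ge_0_int[OF q(1)] by (simp only: nat_0_le)
  hence "nat q dvd x" by (simp only: int_dvd_int_iff)
  ultimately show thesis using that by blast
qed

lemma square_not_dvd_of_sieve:
  fixes p x k :: nat
  assumes sv: "sieve_data_ok (int k) N ps sqs" and x: "0 < x" "int x \<le> N" and p: "prime p" "k < p"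
    and sqs: "\<forall>s\<in>set sqs. int x mod s \<noteq> 0"
  shows "\<not> p\<^sup>2 dvd x"
proof
  assume d: "p\<^sup>2 dvd x"
  hence "p\<^sup>2 \<le> x" using x(1) by (rule dvd_imp_le)
  hence "int (p\<^sup>2) \<le> N" using x(2) by linarith
  hence pN: "int p * int p \<le> N" by (simp add: power2_eq_square)
  have "int p < 89"
  proof (rule ccontr)
    assume "\<not> int p < 89"
    hence "89 * 89 \<le> int p * int p" by (intro mult_mono) auto
    thus False using pN sv unfolding sieve_data_ok_def by linarith
  qed
  hence "int p \<in> set small_primes" using p by (intro small_primes_complete) auto
  hence "int p * int p \<in> set sqs" using sv p(2) pN unfolding sieve_data_ok_def by auto
  hence "int x mod (int p * int p) \<noteq> 0" by (rule bspec[OF sqs])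
  moreover have "int p * int p dvd int x" using d by (metis int_dvd_int_iff of_nat_mult power2_eq_square)
  ultimately show False by simp
qed

lemma sieve_check_sound:
  assumes sv: "sieve_data_ok (int k) N ps sqs"
    and chk: "sieve_check (int k) N lo g c ds exc ps sqs" and c: "0 \<le> c" "c + g \<le> int k"
    and n: "k < n" "lo \<le> int n" "int n \<le> N" "int n \<notin> set exc" and d: "int d \<in> set ds" "2 * d \<le> k"
    and mem: "int n - c \<in> set (smooth_list N ps)" "int n - c - g \<in> set (smooth_list N ps)"
  shows "degree_obstruction n k d"
proof -
  let ?S = "smooth_list N ps"
  have srt: "sorted ?S" using sv small_primes_prime unfolding sieve_data_ok_def by (intro sorted_smooth_list) fast
  obtain W where W: "(int n - c, W) \<in> set (gap_windows g ?S ?S)"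
    "\<And>w. w \<in> set ?S \<Longrightarrow> int n - c - g \<le> w \<Longrightarrow> w \<le> int n - c \<Longrightarrow> w \<in> set W"
    using gap_windows_complete[OF srt srt mem] by blast
  define R where "R = rough_offsets W (int n) [c..c + g]"
  have "let n' = (int n - c) + c in
        if n' < lo \<or> N < n' \<or> n' \<in> set exc then True
        else let R = rough_offsets W n' [c..c + g] in list_all (\<lambda>d. some_offset_ok sqs (int k) n' d R) ds"
    using chk W(1) unfolding sieve_check_def Let_def list_all_iff by fast
  hence "some_offset_ok sqs (int k) (int n) (int d) R"
    using n d(1) unfolding Let_def R_def by (auto simp: list_all_iff)
  then obtain j where j: "j \<in> set R" "j \<noteq> int d" "j \<noteq> int k - int d"
    "j \<noteq> 2 * int d \<and> j \<noteq> int k - 2 * int d \<and> (2 * int d = int k \<longrightarrow> j mod 2 = 1) \<or> (\<forall>s\<in>set sqs. (int n - j) mod s \<noteq> 0)"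
    using some_offset_okD by blast
  define l where "l = nat j"
  have jr: "c \<le> j" "j \<le> c + g" "int n - j \<notin> set W"
    using j(1) unfolding R_def rough_offsets_def by (auto simp: list_all_iff)
  have jS: "int n - j \<notin> set ?S" using W(2)[of "int n - j"] jr by auto
  have l: "j = int l" "l \<le> k" using jr c unfolding l_def by auto
  have x: "0 < n - l" "int (n - l) \<le> N" "int n - j = int (n - l)" using n l by auto
  obtain p where p: "prime p" "k < p" "p dvd n - l"
    using rough_of_not_in_smooth_list[OF sv x(1,2)] jS unfolding x(3) by blast
  have cases: "l \<noteq> 2 * d \<and> l \<noteq> k - 2 * d \<and> (2 * d = k \<longrightarrow> odd l) \<or> \<not> p\<^sup>2 dvd n - l"
    using j(4)
  proof
    assume a: "j \<noteq> 2 * int d \<and> j \<noteq> int k - 2 * int d \<and> (2 * int d = int k \<longrightarrow> j mod 2 = 1)"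
    have "l \<noteq> 2 * d" "l \<noteq> k - 2 * d" using a d(2) unfolding l(1) by (auto simp: of_nat_diff)
    moreover have "2 * d = k \<longrightarrow> odd l" using a unfolding l(1) by presburger
    ultimately show ?thesis by blast
  next
    assume "\<forall>s\<in>set sqs. (int n - j) mod s \<noteq> 0"
    thus ?thesis using square_not_dvd_of_sieve[OF sv x(1,2) p(1,2)] unfolding x(3) by blast
  qed
  have "l \<noteq> d" "l \<noteq> k - d" using j(2,3) d(2) unfolding l(1) by (auto simp: of_nat_diff)
  thus ?thesis unfolding degree_obstruction_def using l(2) p cases by blast
qed

text \<open>For \<open>0 < 2 * d < k\<close> the end positions 0 and \<open>k\<close> are none of
  \<open>d\<close>, \<open>k - d\<close>, \<open>2 * d\<close>, \<open>k - 2 * d\<close>, so a prime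
  above \<open>k\<close> at either of them obstructs at once. Both ends must be smooth, which gives
  \<open>c = 0\<close> and gap \<open>k\<close>.\<close>

lemma obstruction_of_sieve_low_degree:
  assumes sv: "sieve_data_ok (int k) N ps sqs"
    and chk: "sieve_check (int k) N lo (int k) 0 ds exc ps sqs"
    and n: "k < n" "lo \<le> int n" "int n \<le> N" "int n \<notin> set exc" and d: "int d \<in> set ds" "0 < d" "2 * d < k"
  shows "degree_obstruction n k d"
proof (rule ccontr)
  assume no: "\<not> degree_obstruction n k d"
  have "int (n - l) \<in> set (smooth_list N ps)" if l: "l = 0 \<or> l = k" for l
  proof (rule ccontr)
    assume out: "int (n - l) \<notin> set (smooth_list N ps)"
    obtain p where "prime p" "k < p" "p dvd n - l"
      by (rule rough_of_not_in_smooth_list[OF sv _ _ out]) (use n l in auto)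
    thus False using not_obstruction_cases[OF no, of l p] l d by auto
  qed
  from this[of 0] this[of k] show False
    using sieve_check_sound[OF sv chk _ _ n d(1)] no d n(1) by (simp add: of_nat_diff)
qed

text \<open>For \<open>2 * d = k\<close> even positions may be harmless, so the outermost odd
  positions 1 and \<open>k - 1\<close> play the role of the ends; they differ from \<open>d\<close>
  because \<open>d > 1\<close>.\<close>

lemma obstruction_of_sieve_half_degree:
  assumes sv: "sieve_data_ok (int k) N ps sqs"
    and chk: "sieve_check (int k) N lo (int k - 2) 1 [int d] exc ps sqs"
    and n: "k < n" "lo \<le> int n" "int n \<le> N" "int n \<notin> set exc" and d: "1 < d" "2 * d = k"
  shows "degree_obstruction n k d"
proof (rule ccontr)
  assume no: "\<not> degree_obstruction n k d"
  have "int (n - l) \<in> set (smooth_list N ps)" if l: "l = 1 \<or> l = k - 1" for l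
  proof (rule ccontr)
    assume out: "int (n - l) \<notin> set (smooth_list N ps)"
    obtain p where "prime p" "k < p" "p dvd n - l"
      by (rule rough_of_not_in_smooth_list[OF sv _ _ out]) (use n l d in auto)
    thus False using not_obstruction_cases[OF no, of l p] l d by auto
  qed
  from this[of 1] this[of "k - 1"] show False
    using sieve_check_sound[OF sv chk _ _ n, of d] no d n(1) by (simp add: of_nat_diff algebra_simps)
qed

section \<open>The degree k / 2\<close>

text \<open>Apart from the factor \<open>(m - 1)!\<close>, each prime of \<open>P\<close>
  contributes no more than its power in a single \<open>f i\<close>, hence at most
  \<open>B\<close>.\<close>

lemma prod_smooth_le:
  fixes f :: "nat \<Rightarrow> nat"
  assumes S: "S \<subseteq> {..<m}" "S \<noteq> {}"
    and f: "\<And>i. i \<in> S \<Longrightarrow> 0 < f i" "\<And>i. i \<in> S \<Longrightarrow> f i \<le> B"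
    and sep: "\<And>p i j a. prime p \<Longrightarrow> i \<in> S \<Longrightarrow> j \<in> S \<Longrightarrow> i < j \<Longrightarrow> p ^ a dvd f i \<Longrightarrow> p ^ a dvd f j \<Longrightarrow> p ^ a dvd j - i"
    and P: "finite P" "\<And>p i. prime p \<Longrightarrow> i \<in> S \<Longrightarrow> p dvd f i \<Longrightarrow> p \<in> P" "\<And>p. p \<in> P \<Longrightarrow> prime p"
  shows "(\<Prod>i\<in>S. f i) \<le> fact (m - 1) * B ^ card P"
proof -
  have finS: "finite S" using S finite_subset by blast
  have "\<forall>p\<in>P. \<exists>i\<in>S. multiplicity p (\<Prod>j\<in>S. f j) \<le> multiplicity p (f i) + multiplicity p (fact (m - 1) :: nat)"
    using multiplicity_prod_window[OF _ S, of _ f] f(1) sep P(3) by blast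
  then obtain i where i: "\<And>p. p \<in> P \<Longrightarrow> i p \<in> S"
    "\<And>p. p \<in> P \<Longrightarrow> multiplicity p (\<Prod>j\<in>S. f j) \<le> multiplicity p (f (i p)) + multiplicity p (fact (m - 1) :: nat)"
    by metis
  define e where "e = (\<lambda>p. multiplicity p (f (i p)))"
  have pos: "0 < (\<Prod>p\<in>P. p ^ e p)" using P(3) by (intro prod_pos) (auto intro: prime_gt_0_nat)
  have "(\<Prod>i\<in>S. f i) dvd fact (m - 1) * (\<Prod>p\<in>P. p ^ e p)"
  proof (rule multiplicity_le_imp_dvd)
    have "0 < (\<Prod>i\<in>S. f i)" using f(1) by (rule prod_pos)
    thus "(\<Prod>i\<in>S. f i) \<noteq> 0" by simp
    fix p :: nat assume p: "prime p"
    have eq: "multiplicity p (fact (m - 1) * (\<Prod>p\<in>P. p ^ e p)) = multiplicity p (fact (m - 1) :: nat) + multiplicity p (\<Prod>p\<in>P. p ^ e p)"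
      using p pos by (intro prime_elem_multiplicity_mult_distrib) auto
    show "multiplicity p (\<Prod>i\<in>S. f i) \<le> multiplicity p (fact (m - 1) * (\<Prod>p\<in>P. p ^ e p))"
    proof (cases "p \<in> P")
      case True
      have "p ^ e p dvd (\<Prod>p\<in>P. p ^ e p)" using P(1) True by (intro dvd_prodI) auto
      hence "e p \<le> multiplicity p (\<Prod>p\<in>P. p ^ e p)"
        using pos p by (intro multiplicity_geI) auto
      moreover have "multiplicity p (\<Prod>j\<in>S. f j) \<le> e p + multiplicity p (fact (m - 1) :: nat)"
        using i(2)[OF True] unfolding e_def .
      ultimately show ?thesis unfolding eq by linarith
    next
      case False
      have "multiplicity p (\<Prod>i\<in>S. f i) = (\<Sum>i\<in>S. multiplicity p (f i))"
        using p finS f(1) by (rule prime_multiplicity_prod_nat)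
      also have "\<dots> = 0" using False P(2)[OF p] by (intro sum.neutral ballI not_dvd_imp_multiplicity_0) blast
      finally show ?thesis by simp
    qed
  qed
  hence "(\<Prod>i\<in>S. f i) \<le> fact (m - 1) * (\<Prod>p\<in>P. p ^ e p)" using pos by (intro dvd_imp_le) auto
  also have "(\<Prod>p\<in>P. p ^ e p) \<le> (\<Prod>p\<in>P. B)"
  proof (intro prod_mono conjI)
    fix p assume p: "p \<in> P"
    have "p ^ e p \<le> f (i p)" unfolding e_def using f(1)[OF i(1)[OF p]] multiplicity_dvd by (intro dvd_imp_le) auto
    thus "p ^ e p \<le> B" using f(2)[OF i(1)[OF p]] by linarith
  qed auto
  hence "fact (m - 1) * (\<Prod>p\<in>P. p ^ e p) \<le> fact (m - 1) * B ^ card P" by simp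
  finally show ?thesis .
qed

text \<open>The number of odd positions below \<open>2 * d\<close> other than \<open>d\<close>
  itself; only for odd \<open>d\<close> is a position lost.\<close>

definition half_size :: "nat \<Rightarrow> nat" where
  "half_size d = (if even d then d else d - 1)"

lemma card_half_positions: "card {i. i < d \<and> 2 * i + 1 \<noteq> d} = half_size d"
proof (cases "even d")
  case True
  hence "{i. i < d \<and> 2 * i + 1 \<noteq> d} = {..<d}" by auto
  thus ?thesis using True by (simp add: half_size_def)
next
  case False
  then obtain c where c: "d = 2 * c + 1" by (auto elim: oddE)
  hence "{i. i < d \<and> 2 * i + 1 \<noteq> d} = {..<d} - {c}" by auto
  thus ?thesis using c by (simp add: half_size_def)
qed

text \<open>At an odd position other than \<open>d\<close> even a squared prime above
  \<open>2 * d\<close> obstructs, so all these \<open>n - l\<close> are smooth. If \<open>n\<close>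
  is even they are odd: the prime 2 drops out, and the factor 2 in their differences is harmless. If
  \<open>n\<close> is odd they are even, and halving them gives the numbers
  \<open>n div 2 - i\<close>.\<close>

lemma half_degree_bounds:
  assumes no: "\<not> degree_obstruction n (2 * d) d" and d: "2 \<le> d" "2 * d < n"
  shows "even n \<Longrightarrow> (n - 2 * d + 1) ^ half_size d \<le> fact (d - 1) * (n - 1) ^ (card (primes_upto (2 * d)) - 1)"
    and "odd n \<Longrightarrow> (n div 2 - (d - 1)) ^ half_size d \<le> fact (d - 1) * (n div 2) ^ card (primes_upto (2 * d))"
proof -
  define S where "S = {i. i < d \<and> 2 * i + 1 \<noteq> d}"
  have S: "S \<subseteq> {..<d}" unfolding S_def by auto
  have cs: "card S = half_size d" unfolding S_def by (rule card_half_positions)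
  have "0 \<in> S" using d unfolding S_def by auto
  hence Sne: "S \<noteq> {}" by auto
  have smooth: "p \<le> 2 * d" if p: "prime p" "i \<in> S" "p dvd n - (2 * i + 1)" for p i
  proof (rule ccontr)
    assume "\<not> p \<le> 2 * d"
    thus False using not_obstruction_cases[OF no _ p(1) _ p(3)] p(2) unfolding S_def
      by auto
  qed
  show "(n - 2 * d + 1) ^ half_size d \<le> fact (d - 1) * (n - 1) ^ (card (primes_upto (2 * d)) - 1)" if ev: "even n"
  proof -
    let ?f = "\<lambda>i. n - (2 * i + 1)"
    have oddf: "odd (?f i)" if "i \<in> S" for i using that ev d unfolding S_def by auto
    have "(n - 2 * d + 1) ^ half_size d = (\<Prod>i\<in>S. n - 2 * d + 1)"
      unfolding cs[symmetric] by (simp only: prod_constant)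
    also have "\<dots> \<le> (\<Prod>i\<in>S. ?f i)" using d unfolding S_def by (intro prod_mono) auto
    also have "\<dots> \<le> fact (d - 1) * (n - 1) ^ card (primes_upto (2 * d) - {2})"
    proof (rule prod_smooth_le[OF S Sne])
      fix p i j a assume p: "prime p" and ij: "i \<in> S" "j \<in> S" "i < j" "p ^ a dvd ?f i" "p ^ a dvd ?f j"
      have "p ^ a dvd ?f i - ?f j" using ij by (simp only: dvd_diff_nat)
      moreover have "?f i - ?f j = 2 * (j - i)" using ij d unfolding S_def by auto
      ultimately have d2: "p ^ a dvd 2 * (j - i)" by (simp only:)
      show "p ^ a dvd j - i"
      proof (cases "a = 0")
        case False
        have "odd p"
        proof
          assume "even p"
          hence "2 dvd p ^ a" using False by (simp add: dvd_power_iff)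
          hence "2 dvd ?f i" using ij(4) dvd_trans by blast
          thus False using oddf[OF ij(1)] by simp
        qed
        hence "coprime (p ^ a) 2" by simp
        thus ?thesis using d2 by (simp add: coprime_dvd_mult_right_iff)
      qed simp
    next
      fix p i assume p: "prime p" "i \<in> S" "p dvd ?f i"
      have "p \<noteq> 2" using oddf[OF p(2)] p(3) by auto
      thus "p \<in> primes_upto (2 * d) - {2}" using smooth[OF p] p(1) by (auto simp: primes_upto_def)
    next
      fix i assume "i \<in> S" thus "0 < ?f i" "?f i \<le> n - 1" using d unfolding S_def by auto
    qed (auto simp: primes_upto_def intro: finite_subset[OF _ finite_primes_upto[of "2 * d"]])
    also have "card (primes_upto (2 * d) - {2}) = card (primes_upto (2 * d)) - 1"
      using d by (subst card_Diff_singleton) (auto simp: primes_upto_def)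
    finally show ?thesis .
  qed
  show "(n div 2 - (d - 1)) ^ half_size d \<le> fact (d - 1) * (n div 2) ^ card (primes_upto (2 * d))" if od: "odd n"
  proof -
    let ?f = "\<lambda>i. n div 2 - i"
    have f2: "n - (2 * i + 1) = 2 * ?f i" if "i \<in> S" for i using od by presburger
    have big: "d \<le> n div 2" using d by linarith
    have "(n div 2 - (d - 1)) ^ half_size d = (\<Prod>i\<in>S. n div 2 - (d - 1))"
      unfolding cs[symmetric] by (simp only: prod_constant)
    also have "\<dots> \<le> (\<Prod>i\<in>S. ?f i)" unfolding S_def by (intro prod_mono) auto
    also have "\<dots> \<le> fact (d - 1) * (n div 2) ^ card (primes_upto (2 * d))"
    proof (rule prod_smooth_le[OF S Sne])
      fix p i j a assume p: "prime p" and ij: "i \<in> S" "j \<in> S" "i < j" "p ^ a dvd ?f i" "p ^ a dvd ?f j"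
      have "p ^ a dvd ?f i - ?f j" using ij by (simp only: dvd_diff_nat)
      moreover have "?f i - ?f j = j - i" using ij big unfolding S_def by auto
      ultimately show "p ^ a dvd j - i" by (simp only:)
    next
      fix p i assume p: "prime p" "i \<in> S" "p dvd ?f i"
      have "p dvd n - (2 * i + 1)" unfolding f2[OF p(2)] using p(3) by (rule dvd_mult)
      thus "p \<in> primes_upto (2 * d)" using smooth[OF p(1,2)] p(1) by (auto simp: primes_upto_def)
    next
      fix i assume "i \<in> S" thus "0 < ?f i" "?f i \<le> n div 2" using big unfolding S_def by auto
    qed (auto simp: primes_upto_def)
    finally show ?thesis .
  qed
qed

text \<open>Since \<open>(B - c) / B\<close> grows with \<open>B\<close> and
  \<open>P \<le> s\<close>, the inequality passes from \<open>N\<close> to every larger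
  \<open>B\<close>.\<close>

lemma shifted_power_mono:
  fixes N B c :: nat
  assumes "N \<le> B" "c < N" "P \<le> s" "F * N ^ P < (N - c) ^ s"
  shows "F * B ^ P < (B - c) ^ s"
proof -
  have "(N - c) * B \<le> (B - c) * N"
    unfolding diff_mult_distrib mult.commute[of B N] using assms(1) by (intro diff_le_mono2 mult_left_mono) auto
  hence le: "((N - c) * B) ^ P \<le> ((B - c) * N) ^ P" by (rule power_mono) simp
  have "N ^ P * (F * B ^ P) = (F * N ^ P) * B ^ P" by simp
  also have "\<dots> < (N - c) ^ s * B ^ P" using assms by simp
  also have "\<dots> = (N - c) ^ (s - P) * ((N - c) * B) ^ P"
    using assms(3) by (simp add: power_mult_distrib flip: power_add mult.assoc)
  also have "\<dots> \<le> (B - c) ^ (s - P) * ((B - c) * N) ^ P" 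
    by (rule mult_mono[OF power_mono le]) (use assms(1) in auto)
  also have "\<dots> = N ^ P * (B - c) ^ s"
    using assms(3) by (simp add: power_mult_distrib flip: power_add mult.assoc)
  finally show ?thesis by simp
qed

lemma obstruction_half_degree:
  assumes d: "2 \<le> d" "2 * d < n"
    and ev: "even n \<Longrightarrow> Ne \<le> n - 1 \<and> 2 * (d - 1) < Ne \<and> card (primes_upto (2 * d)) - 1 \<le> half_size d \<and>
       fact (d - 1) * Ne ^ (card (primes_upto (2 * d)) - 1) < (Ne - 2 * (d - 1)) ^ half_size d"
    and od: "odd n \<Longrightarrow> No \<le> n div 2 \<and> d - 1 < No \<and> card (primes_upto (2 * d)) \<le> half_size d \<and>
       fact (d - 1) * No ^ card (primes_upto (2 * d)) < (No - (d - 1)) ^ half_size d"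
  shows "degree_obstruction n (2 * d) d"
proof (rule ccontr)
  assume no: "\<not> degree_obstruction n (2 * d) d"
  show False
  proof (cases "even n")
    case True
    have "fact (d - 1) * (n - 1) ^ (card (primes_upto (2 * d)) - 1) < (n - 1 - 2 * (d - 1)) ^ half_size d"
      by (rule shifted_power_mono[of Ne]) (use ev[OF True] in blast)+
    moreover have "n - 1 - 2 * (d - 1) = n - 2 * d + 1" using d by auto
    ultimately show False using half_degree_bounds(1)[OF no d True] by simp
  next
    case False
    have "fact (d - 1) * (n div 2) ^ card (primes_upto (2 * d)) < (n div 2 - (d - 1)) ^ half_size d"
      by (rule shifted_power_mono[of No]) (use od[OF False] in blast)+
    thus False using half_degree_bounds(2)[OF no d False] by simp
  qed
qed

text \<open>In other words \<open>n! \<le> ((n + 1) / 2)^n\<close>; the induction step is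
  Bernoulli's inequality \<open>2 \<le> (1 + 1 / (n + 1))^(n + 1)\<close>.\<close>

lemma fact_times_power2_le: "fact n * 2 ^ n \<le> (n + 1) ^ n"
proof (induction n)
  case (Suc n)
  have "2 * (n + 1) ^ Suc n \<le> (n + 2) ^ Suc n"
  proof -
    have "1 + real (Suc n) * (1 / real (n + 1)) \<le> (1 + 1 / real (n + 1)) ^ Suc n"
      by (rule Bernoulli_inequality, rule order_trans[of _ 0]) auto
    hence "2 * real (n + 1) ^ Suc n \<le> (1 + 1 / real (n + 1)) ^ Suc n * real (n + 1) ^ Suc n"
      by (intro mult_right_mono) auto
    also have "\<dots> = ((1 + 1 / real (n + 1)) * real (n + 1)) ^ Suc n" by (simp only: power_mult_distrib)
    also have "(1 + 1 / real (n + 1)) * real (n + 1) = real (n + 2)" by (simp add: field_simps)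
    finally have "real (2 * (n + 1) ^ Suc n) \<le> real ((n + 2) ^ Suc n)"
      by (simp only: of_nat_mult of_nat_power of_nat_numeral)
    thus ?thesis by (simp only: of_nat_le_iff)
  qed
  moreover have "fact (Suc n) * 2 ^ Suc n = 2 * (n + 1) * (fact n * 2 ^ n)" by (simp add: algebra_simps)
  moreover have "2 * (n + 1) * (fact n * 2 ^ n) \<le> 2 * (n + 1) * (n + 1) ^ n" using Suc by (intro mult_left_mono) auto
  ultimately show ?case by (simp add: mult.assoc)
qed simp

text \<open>Here \<open>2 * d\<^sup>2 + 2 * d = ((2 * d + 1)\<^sup>2 - 1) / 2\<close>, the least value of \<open>n div 2\<close>.\<close>

lemma half_degree_numeric:
  assumes d: "33 \<le> d" and P: "4 * P \<le> 2 * d + 13"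
  shows "fact (d - 1) * (2 * d\<^sup>2 + 2 * d) ^ P < (2 * d\<^sup>2 + 2 * d - 2 * (d - 1)) ^ (d - 1)"
proof (rule ccontr)
  define x where "x = real d"
  have x: "33 \<le> x" unfolding x_def using d by simp
  assume "\<not> ?thesis"
  hence "(2 * d\<^sup>2 + 2 * d - 2 * (d - 1)) ^ (d - 1) \<le> fact (d - 1) * (2 * d\<^sup>2 + 2 * d) ^ P" by simp
  moreover have "(2 * d\<^sup>2) ^ (d - 1) \<le> (2 * d\<^sup>2 + 2 * d - 2 * (d - 1)) ^ (d - 1)" by (intro power_mono) auto
  ultimately have "(2 * d\<^sup>2) ^ (d - 1) \<le> fact (d - 1) * (2 * d\<^sup>2 + 2 * d) ^ P" by (rule order_trans[rotated])
  hence "(2 * d\<^sup>2) ^ (d - 1) * 2 ^ (d - 1) \<le> (fact (d - 1) * (2 * d\<^sup>2 + 2 * d) ^ P) * 2 ^ (d - 1)"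
    by (rule mult_right_mono) simp
  also have "\<dots> = (fact (d - 1) * 2 ^ (d - 1)) * (2 * d\<^sup>2 + 2 * d) ^ P" by (simp only: mult_ac)
  also have "\<dots> \<le> d ^ (d - 1) * (2 * d\<^sup>2 + 2 * d) ^ P"
    using fact_times_power2_le[of "d - 1"] d by (intro mult_right_mono) auto
  finally have "real ((2 * d\<^sup>2) ^ (d - 1) * 2 ^ (d - 1)) \<le> real (d ^ (d - 1) * (2 * d\<^sup>2 + 2 * d) ^ P)"
    by (simp only: of_nat_le_iff)
  hence "ln (real ((2 * d\<^sup>2) ^ (d - 1) * 2 ^ (d - 1))) \<le> ln (real (d ^ (d - 1) * (2 * d\<^sup>2 + 2 * d) ^ P))"
    using d by (subst ln_le_cancel_iff) (auto intro!: mult_pos_pos zero_less_power add_pos_pos)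
  moreover have "ln (real ((2 * d\<^sup>2) ^ (d - 1) * 2 ^ (d - 1))) = (x - 1) * (ln 2 + 2 * ln x) + (x - 1) * ln 2"
    using d unfolding x_def by (simp add: ln_mult ln_realpow of_nat_diff distrib_left)
  moreover have "0 < 2 * (real d)\<^sup>2 + 2 * real d" using d by (intro add_pos_pos) auto
  hence "2 * (real d)\<^sup>2 + 2 * real d \<noteq> 0" by linarith
  hence "ln (real (d ^ (d - 1) * (2 * d\<^sup>2 + 2 * d) ^ P)) = (x - 1) * ln x + real P * ln (2 * x\<^sup>2 + 2 * x)"
    using d unfolding x_def by (simp add: ln_mult ln_realpow of_nat_diff)
  ultimately have main: "(x - 1) * (ln 2 + 2 * ln x) + (x - 1) * ln 2 \<le> (x - 1) * ln x + real P * ln (2 * x\<^sup>2 + 2 * x)"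
    by simp
  have "0 < 1 + 1 / x" using x by (intro add_pos_pos) auto
  hence nz: "1 + 1 / x \<noteq> 0" by linarith
  have "2 * x\<^sup>2 + 2 * x = 2 * x\<^sup>2 * (1 + 1 / x)" using x by (simp add: field_simps power2_eq_square)
  hence "ln (2 * x\<^sup>2 + 2 * x) = ln (2 * x\<^sup>2 * (1 + 1 / x))" by (simp only:)
  also have "\<dots> = ln 2 + 2 * ln x + ln (1 + 1 / x)" 
    using x nz by (simp add: ln_mult ln_realpow)
  also have "ln (1 + 1 / x) \<le> 1 / x" using x by (intro ln_add_one_self_le_self) auto
  finally have lnN: "ln (2 * x\<^sup>2 + 2 * x) \<le> ln 2 + 2 * ln x + 1 / x" by simp
  have ln_N0: "0 \<le> ln (2 * x\<^sup>2 + 2 * x)"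
    by (rule ln_ge_zero) (use x zero_le_power2[of x] in linarith)
  have P4: "real P \<le> x / 2 + 13 / 4" using P unfolding x_def by linarith
  have lx: "0 \<le> ln x" "ln x \<le> x / 32 + 27 / 10"
  proof -
    have "ln x \<le> x / 32 + ln 32 - 1" using x by (intro ln_tangent) auto
    moreover have "ln (32 :: real) = 5 * ln 2" using ln_realpow[of 2 5] by simp
    ultimately show "ln x \<le> x / 32 + 27 / 10" using ln2_bounds by simp
  qed (use x in auto)
  have "real P * ln (2 * x\<^sup>2 + 2 * x) \<le> (x / 2 + 13 / 4) * (ln 2 + 2 * ln x + 1 / x)"
    using P4 lnN ln_N0 x by (intro mult_mono) auto
  also have "\<dots> = (x / 2 + 13 / 4) * (ln 2 + 2 * ln x) + (1 / 2 + 13 / 4 / x)" using x by (simp add: field_simps)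
  also have "13 / 4 / x \<le> 1 / 2" using x by (simp add: field_simps)
  finally have "real P * ln (2 * x\<^sup>2 + 2 * x) \<le> (x / 2 + 13 / 4) * (ln 2 + 2 * ln x) + 1" by simp
  \<comment> \<open>The terms in \<open>x * ln x\<close> cancel, and the linear term with
    \<open>ln 2\<close> decides. Inserting \<open>ln 2 \<ge> 2 / 3\<close> and
    \<open>ln x \<le> x / 32 + 27 / 10\<close> leaves \<open>49 / 64 * x \<le> 99 / 4\<close>, which
    is false from 33 on.\<close>
  hence "(3 / 2 * x - 21 / 4) * ln 2 \<le> 15 / 2 * ln x + 1" using main by (simp add: algebra_simps)
  moreover have "(3 / 2 * x - 21 / 4) * (2 / 3) \<le> (3 / 2 * x - 21 / 4) * ln 2"
    using ln2_bounds x by (intro mult_left_mono) auto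
  ultimately show False using lx x by simp
qed

lemma obstruction_half_degree_large:
  assumes d: "33 \<le> d" and n: "(2 * d + 1)\<^sup>2 \<le> n"
  shows "degree_obstruction n (2 * d) d"
proof -
  let ?N = "2 * d\<^sup>2 + 2 * d" and ?\<pi> = "card (primes_upto (2 * d))"
  have pi: "4 * ?\<pi> \<le> 2 * d + 13" by (rule prime_count_le)
  have sq: "(2 * d + 1)\<^sup>2 = 2 * ?N + 1" by (simp add: power2_eq_square algebra_simps)
  have hs: "d - 1 \<le> half_size d" unfolding half_size_def by auto
  have sub: "?\<pi> \<le> half_size d" using pi d hs by linarith
  have N0: "2 * (d - 1) < ?N" "1 \<le> ?N - 2 * (d - 1)" using d by auto
  have main: "fact (d - 1) * ?N ^ ?\<pi> < (?N - 2 * (d - 1)) ^ half_size d"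
    using half_degree_numeric[OF d pi] power_increasing[OF hs N0(2)] by (rule less_le_trans)
  show ?thesis
  proof (rule obstruction_half_degree[of d n ?N ?N])
    have 1: "?N \<le> n - 1" "?N \<le> n div 2" "?\<pi> - 1 \<le> half_size d" "d - 1 < ?N" using n sq sub N0 by auto
    have "fact (d - 1) * ?N ^ (?\<pi> - 1) \<le> fact (d - 1) * ?N ^ ?\<pi>" using d by (intro mult_left_mono power_increasing) auto
    hence 2: "fact (d - 1) * ?N ^ (?\<pi> - 1) < (?N - 2 * (d - 1)) ^ half_size d" using main by (rule le_less_trans)
    show "?N \<le> n - 1 \<and> 2 * (d - 1) < ?N \<and> ?\<pi> - 1 \<le> half_size d \<and>
       fact (d - 1) * ?N ^ (?\<pi> - 1) < (?N - 2 * (d - 1)) ^ half_size d"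
      using 1 2 N0(1) by blast
    have "(?N - 2 * (d - 1)) ^ half_size d \<le> (?N - (d - 1)) ^ half_size d" by (intro power_mono) auto
    with main have "fact (d - 1) * ?N ^ ?\<pi> < (?N - (d - 1)) ^ half_size d" by (rule less_le_trans)
    thus "?N \<le> n div 2 \<and> d - 1 < ?N \<and> ?\<pi> \<le> half_size d \<and>
       fact (d - 1) * ?N ^ ?\<pi> < (?N - (d - 1)) ^ half_size d"
      using 1 sub by blast
    show "2 \<le> d" using d by simp
    have "2 * d < (2 * d + 1)\<^sup>2" unfolding sq by simp
    thus "2 * d < n" using n by linarith
  qed
qed

section \<open>Small values of k\<close>

text \<open>The exponent 13 is a uniform cap: already \<open>2^14\<close> exceeds every
  \<open>N\<close> below 6889.\<close>

definition smooth_exponents :: "int \<Rightarrow> (int \<times> nat) list" where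
  "smooth_exponents k = map (\<lambda>p. (p, 13)) (filter (\<lambda>p. p \<le> k) small_primes)"

definition rough_squares :: "int \<Rightarrow> int \<Rightarrow> int list" where
  "rough_squares k N = map (\<lambda>p. p * p) (filter (\<lambda>p. k < p \<and> p * p \<le> N) small_primes)"

lemma sieve_data_ok_standard:
  assumes "k < 83" "N < 6889"
  shows "sieve_data_ok k N (smooth_exponents k) (rough_squares k N)"
proof -
  have "N < p ^ Suc 13" if "p \<in> set small_primes" for p
  proof -
    have "2 \<le> p" using small_primes_prime[OF that] by (rule prime_ge_2_int)
    hence "2 ^ 14 \<le> p ^ 14" by (intro power_mono) auto
    thus ?thesis using assms(2) by simp
  qed
  thus ?thesis using assms unfolding sieve_data_ok_def smooth_exponents_def rough_squares_def
    by (force simp del: power_Suc)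
qed

definition low_degree_check :: "int \<Rightarrow> int \<Rightarrow> int list \<Rightarrow> bool" where
  "low_degree_check k N exc =
     sieve_check k N (2 * k) k 0 (filter (\<lambda>d. 2 * d < k) [1..k]) exc (smooth_exponents k) (rough_squares k N)"

definition half_degree_check :: "int \<Rightarrow> int \<Rightarrow> int \<Rightarrow> int list \<Rightarrow> bool" where
  "half_degree_check d lo N exc =
     sieve_check (2 * d) N lo (2 * d - 2) 1 [d] exc (smooth_exponents (2 * d)) (rough_squares (2 * d) N)"

lemma low_degree_checkD:
  assumes "low_degree_check (int k) (int N) (map int exc)" "k < 83" "N < 6889"
    and "2 * k \<le> n" "n \<le> N" "n \<notin> set exc" "0 < d" "2 * d < k"
  shows "degree_obstruction n k d"
  by (rule obstruction_of_sieve_low_degree[OF sieve_data_ok_standard assms(1)[unfolded low_degree_check_def]])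
     (use assms in auto)

lemma half_degree_checkD:
  assumes "half_degree_check (int d) (int lo) (int N) (map int exc)" "2 * d < 83" "N < 6889"
    and "2 * d < n" "lo \<le> n" "n \<le> N" "n \<notin> set exc" "1 < d"
  shows "degree_obstruction n (2 * d) d"
proof -
  have k: "int (2 * d) = 2 * int d" by simp
  show ?thesis
    by (rule obstruction_of_sieve_half_degree[of "2 * d" "int N" "smooth_exponents (2 * int d)" "rough_squares (2 * int d) (int N)" "int lo" d "map int exc"])
       (use assms sieve_data_ok_standard[of "2 * int d" "int N"] in \<open>auto simp: half_degree_check_def k\<close>)
qed

lemma card_primes_upto_small:
  assumes "k < 89"
  shows "card (primes_upto k) = length (filter (\<lambda>p. p \<le> int k) small_primes)"
proof -
  have "int ` primes_upto k = set (filter (\<lambda>p. p \<le> int k) small_primes)"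
  proof (intro equalityI subsetI)
    fix x assume "x \<in> int ` primes_upto k"
    thus "x \<in> set (filter (\<lambda>p. p \<le> int k) small_primes)"
      using assms by (auto simp: primes_upto_def intro!: small_primes_complete)
  next
    fix x assume x: "x \<in> set (filter (\<lambda>p. p \<le> int k) small_primes)"
    hence "prime x" using small_primes_prime by auto
    hence "prime (nat x)" and "0 \<le> x" using prime_int_nat_transfer[of x] by blast+
    thus "x \<in> int ` primes_upto k" using x by (intro image_eqI[of _ _ "nat x"]) (auto simp: primes_upto_def)
  qed
  moreover have "distinct (filter (\<lambda>p. p \<le> int k) small_primes)" unfolding small_primes_def by (intro distinct_filter) simp
  ultimately have "card (int ` primes_upto k) = length (filter (\<lambda>p. p \<le> int k) small_primes)"
    by (simp only: distinct_card)
  thus ?thesis by (simp add: card_image)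
qed

definition int_fact :: "int \<Rightarrow> int" where
  "int_fact k = prod_list [1..k]"

lemma int_fact_conv: "int_fact (int k) = int (fact k)"
proof (induction k)
  case (Suc k)
  have "[1..int (Suc k)] = [1..int k] @ [int (Suc k)]" by (simp add: upto_rec2)
  thus ?case using Suc unfolding int_fact_def by (simp add: algebra_simps)
qed (simp add: int_fact_def)

definition falling_product :: "int \<Rightarrow> int \<Rightarrow> int" where
  "falling_product n k = prod_list (map (\<lambda>i. n - i) [0..k - 1])"

lemma falling_product_conv: "k \<le> n \<Longrightarrow> falling_product (int n) (int k) = int (\<Prod>i<k. n - i)"
proof (induction k)
  case (Suc k)
  have "[0..int (Suc k) - 1] = [0..int k - 1] @ [int k]" using upto_rec2[of 0 "int k"] by simp
  thus ?case using Suc unfolding falling_product_def by (simp add: of_nat_diff)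
qed (simp add: falling_product_def)

definition binomial_check :: "int \<Rightarrow> int \<Rightarrow> nat \<Rightarrow> bool" where
  "binomial_check k n c \<longleftrightarrow> int_fact k * n ^ (c + length (filter (\<lambda>p. p \<le> k) small_primes)) < falling_product n k"

lemma binomial_checkD:
  assumes chk: "binomial_check (int k) (int N) c" and k: "13 \<le> k" "k < 89" "k \<le> N" "N \<le> n" "c \<le> 4"
  shows "n ^ (c + card (primes_upto k)) < n choose k"
proof (rule binomial_gt_power_mono[OF k(3,4)])
  let ?j = "c + card (primes_upto k)"
  have "int (fact k * N ^ ?j) < int ((N choose k) * fact k)"
    using chk unfolding binomial_check_def card_primes_upto_small[OF k(2)] int_fact_conv falling_product_conv[OF k(3)] binomial_fact_prod
    by simp
  hence "fact k * N ^ ?j < fact k * (N choose k)" by (simp only: of_nat_less_iff mult.commute)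
  thus "N ^ ?j < N choose k" by simp
  show "?j \<le> k" using prime_count_le[of k] k by linarith
  show "0 < N" using k by simp
qed

definition half_numeric_check :: "int \<Rightarrow> int \<Rightarrow> int \<Rightarrow> bool" where
  "half_numeric_check d Ne No = (let \<pi> = length (filter (\<lambda>p. p \<le> 2 * d) small_primes);
       h = (if d mod 2 = 0 then nat d else nat (d - 1)) in
     2 * (d - 1) < Ne \<and> d - 1 < No \<and> \<pi> \<le> h \<and>
     int_fact (d - 1) * Ne ^ (\<pi> - 1) < (Ne - 2 * (d - 1)) ^ h \<and> int_fact (d - 1) * No ^ \<pi> < (No - (d - 1)) ^ h)"

lemma half_numeric_checkD:
  assumes chk: "half_numeric_check (int d) (int Ne) (int No)" and d: "2 \<le> d" "2 * d < 89" "2 * d < n"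
    and n: "even n \<Longrightarrow> Ne \<le> n - 1" "odd n \<Longrightarrow> No \<le> n div 2"
  shows "degree_obstruction n (2 * d) d"
proof -
  define \<pi> where "\<pi> = card (primes_upto (2 * d))"
  have pi: "length (filter (\<lambda>p. p \<le> 2 * int d) small_primes) = \<pi>"
    unfolding \<pi>_def using card_primes_upto_small[OF d(2)] by simp
  have d1: "int d - 1 = int (d - 1)" using d by (simp add: of_nat_diff)
  have h: "(if int d mod 2 = 0 then nat (int d) else nat (int (d - 1))) = half_size d"
  proof -
    have "int d mod 2 = 0 \<longleftrightarrow> even d" by presburger
    thus ?thesis unfolding half_size_def by (simp only: nat_int)
  qed
  have c: "2 * int (d - 1) < int Ne" "int (d - 1) < int No" "\<pi> \<le> half_size d"
    "int (fact (d - 1)) * int Ne ^ (\<pi> - 1) < (int Ne - 2 * int (d - 1)) ^ half_size d"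
    "int (fact (d - 1)) * int No ^ \<pi> < (int No - int (d - 1)) ^ half_size d"
    using chk unfolding half_numeric_check_def Let_def pi d1 h int_fact_conv by blast+
  have lt: "2 * (d - 1) < Ne" "d - 1 < No" using c(1,2) by auto
  have e: "int Ne - 2 * int (d - 1) = int (Ne - 2 * (d - 1))" "int No - int (d - 1) = int (No - (d - 1))" using lt by auto
  have "int (fact (d - 1) * Ne ^ (\<pi> - 1)) < int ((Ne - 2 * (d - 1)) ^ half_size d)"
    using c(4) unfolding e by (simp only: of_nat_mult of_nat_power)
  hence ev: "fact (d - 1) * Ne ^ (\<pi> - 1) < (Ne - 2 * (d - 1)) ^ half_size d" by (simp only: of_nat_less_iff)
  have "int (fact (d - 1) * No ^ \<pi>) < int ((No - (d - 1)) ^ half_size d)"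
    using c(5) unfolding e by (simp only: of_nat_mult of_nat_power)
  hence od: "fact (d - 1) * No ^ \<pi> < (No - (d - 1)) ^ half_size d" by (simp only: of_nat_less_iff)
  have "\<pi> - 1 \<le> half_size d" using c(3) by linarith
  thus ?thesis using obstruction_half_degree[OF d(1,3), of Ne No] lt n c(3) ev od unfolding \<pi>_def by blast
qed

lemma list_all_upto: "list_all P [a..b] \<Longrightarrow> a \<le> x \<Longrightarrow> x \<le> b \<Longrightarrow> P x"
  by (simp add: list_all_iff)

definition exceptional :: "nat \<Rightarrow> nat list" where
  "exceptional k = (if k = 3 then [6, 9, 12, 27] else if k = 4 then [8] else if k = 5 then [10]
     else if k = 6 then [12] else if k = 8 then [16] else [])"

section \<open>Numerical verification for small parameters\<close>

lemma low_degree_check_3: "low_degree_check 3 63 [6, 9, 12, 27]" by code_simp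
lemma low_degree_check_4: "low_degree_check 4 124 [8]" by code_simp
lemma low_degree_check_5: "low_degree_check 5 215 [10]" by code_simp
lemma low_degree_check_6: "low_degree_check 6 342 [12]" by code_simp
lemma low_degree_check_7: "low_degree_check 7 511 []" by code_simp
lemma low_degree_check_8: "low_degree_check 8 728 [16]" by code_simp
lemma low_degree_check_9: "low_degree_check 9 999 []" by code_simp
lemma low_degree_check_10: "low_degree_check 10 1330 []" by code_simp
lemma low_degree_check_11: "low_degree_check 11 1727 []" by code_simp
lemma low_degree_check_12: "low_degree_check 12 2196 []" by code_simp
lemma low_degree_check_13: "low_degree_check 13 2743 []" by code_simp
lemma low_degree_check_14: "low_degree_check 14 3374 []" by code_simp
lemma low_degree_check_15: "low_degree_check 15 285 []" by code_simp
lemma low_degree_check_16_32: "list_all (\<lambda>k. low_degree_check k 101 []) [16..32]" by code_simp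

lemma half_degree_check_2: "half_degree_check 2 8 124 [9, 19]" by code_simp
lemma half_degree_check_3: "half_degree_check 3 12 342 []" by code_simp
lemma half_degree_check_4: "half_degree_check 4 16 728 []" by code_simp
lemma half_degree_check_5: "half_degree_check 5 20 1330 []" by code_simp
lemma half_degree_check_6: "half_degree_check 6 24 2196 []" by code_simp
lemma half_degree_check_7: "half_degree_check 7 28 3374 []" by code_simp
lemma half_degree_check_8_16: "list_all (\<lambda>d. half_degree_check d (4 * d) 101 []) [8..16]" by code_simp
lemma half_degree_check_9: "half_degree_check 9 361 6858 []" by code_simp
lemma half_degree_check_10: "half_degree_check 10 441 1294 []" by code_simp
lemma half_degree_check_11: "half_degree_check 11 529 3910 []" by code_simp
lemma half_degree_check_12: "half_degree_check 12 625 768 []" by code_simp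
lemma half_degree_check_13: "half_degree_check 13 729 1660 []" by code_simp
lemma half_degree_check_15: "half_degree_check 15 961 1182 []" by code_simp

text \<open>For \<open>d = 8\<close> and \<open>d = 14\<close> the second entry is
  \<open>2 * d^2 + 2 * d\<close>, the least value of \<open>n div 2\<close>; otherwise it is half of
  the limit reached by the sieve. The value \<open>d = 9\<close> is absent: with eight positions and
  seven primes up to 18 the odd case would require \<open>n div 2\<close> above \<open>8!\<close>,
  so there the sieve runs up to \<open>19^3 - 1\<close>.\<close>

lemma half_numeric_check_8_15:
  "list_all (\<lambda>(d, N). half_numeric_check d ((2 * d + 1)\<^sup>2) N) [(8, 144), (10, 647), (11, 1955), (12, 384), (13, 830), (14, 420), (15, 591)]" by code_simp

lemma half_numeric_check_16_32:
  "list_all (\<lambda>d. half_numeric_check d ((2 * d + 1)\<^sup>2) (2 * d\<^sup>2 + 2 * d)) [16..32]" by code_simp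

lemma binomial_check_15: "binomial_check 15 286 4" by code_simp
lemma binomial_check_16_28: "list_all (\<lambda>k. binomial_check k ((k + 1)\<^sup>2) 4) [16..28]" by code_simp
lemma binomial_check_16_32: "list_all (\<lambda>k. binomial_check k 102 2) [16..32]" by code_simp
lemma binomial_check_33_49: "list_all (\<lambda>k. binomial_check k (3 * k) 2) [33..49]" by code_simp

lemma low_degree_check_small:
  "3 \<le> k \<Longrightarrow> k \<le> 14 \<Longrightarrow> low_degree_check (int k) (int ((k + 1) ^ 3 - 1)) (map int (exceptional k))"
proof -
  assume "3 \<le> k" "k \<le> 14"
  hence "k = 3 \<or> k = 4 \<or> k = 5 \<or> k = 6 \<or> k = 7 \<or> k = 8 \<or> k = 9 \<or> k = 10 \<or> k = 11 \<or> k = 12 \<or> k = 13 \<or> k = 14" by presburger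
  thus ?thesis by (elim disjE) (simp_all add: exceptional_def low_degree_check_3 low_degree_check_4 low_degree_check_5 low_degree_check_6 low_degree_check_7 low_degree_check_8 low_degree_check_9 low_degree_check_10 low_degree_check_11 low_degree_check_12 low_degree_check_13 low_degree_check_14)
qed

lemma half_degree_check_small:
  "2 \<le> d \<Longrightarrow> d \<le> 7 \<Longrightarrow> half_degree_check (int d) (int (4 * d)) (int ((2 * d + 1) ^ 3 - 1)) (map int (if d = 2 then [9, 19] else []))"
proof -
  assume "2 \<le> d" "d \<le> 7"
  hence "d = 2 \<or> d = 3 \<or> d = 4 \<or> d = 5 \<or> d = 6 \<or> d = 7" by presburger
  thus ?thesis by (elim disjE) (simp_all add: half_degree_check_2 half_degree_check_3 half_degree_check_4 half_degree_check_5 half_degree_check_6 half_degree_check_7)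
qed

lemma obstruction_small:
  assumes k: "3 \<le> k" "k \<le> 14" and n: "2 * k \<le> n" "n < (k + 1) ^ 3" and d: "0 < d" "2 * d \<le> k"
    and exc: "2 * d \<noteq> k \<Longrightarrow> n \<notin> set (exceptional k)"
  shows "degree_obstruction n k d"
proof -
  have "(k + 1) ^ 3 \<le> 15 ^ 3" using k by (intro power_mono) auto
  hence N: "(k + 1) ^ 3 - 1 < 6889" by simp
  have N': "n \<le> (k + 1) ^ 3 - 1" using n by linarith
  show ?thesis
  proof (cases "2 * d = k")
    case False
    show ?thesis
      by (rule low_degree_checkD[OF low_degree_check_small[OF k]]) (use k n d exc[OF False] N N' False in linarith | assumption | auto)+
  next
    case True
    have d2: "2 \<le> d" "d \<le> 7" using True k by auto
    show ?thesis
    \<comment> \<open>For \<open>k = 4\<close> the half-degree sieve sees only the offsets 1 to 3.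
      For these two \<open>n\<close> the sole rough value among them sits at
      \<open>l = d = 2\<close>, so the witnesses are taken from the offsets 4 and 0.\<close>
    proof (cases "d = 2 \<and> n \<in> {9, 19}")
      case exc2: True
      hence "n = 9 \<or> n = 19" by auto
      thus ?thesis
      proof
        assume "n = 9"
        thus ?thesis unfolding degree_obstruction_def using True exc2 by (intro exI[of _ 4] exI[of _ 5]) auto
      next
        assume "n = 19"
        thus ?thesis unfolding degree_obstruction_def using True exc2 by (intro exI[of _ 0] exI[of _ 19]) auto
      qed
    next
      case False
      have "degree_obstruction n (2 * d) d"
        by (rule half_degree_checkD[OF half_degree_check_small[OF d2]]) (use True d2 N N' n False in auto)
      thus ?thesis unfolding True .
    qed
  qed
qed

section \<open>Triples of primes just below n\<close>

lemma prime_trial_division: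
  fixes p :: int
  assumes "1 < p" "p < 7921" and trial: "\<And>q. q \<in> set small_primes \<Longrightarrow> q * q \<le> p \<Longrightarrow> \<not> q dvd p"
  shows "prime p"
proof (rule ccontr)
  assume "\<not> prime p"
  then obtain a where a0: "0 \<le> a" "a dvd p" "a \<noteq> 1" "a \<noteq> p"
    using assms(1) unfolding prime_int_iff by blast
  have "a \<noteq> 0" using a0(2) assms(1) by auto
  hence a: "a dvd p" "1 < a" "a \<noteq> p" using a0 by auto
  then obtain b where b: "p = a * b" by auto
  have "0 < a * b" using assms(1) b by linarith
  hence "0 < b" by (rule zero_less_mult_pos) (use a(2) in linarith)
  moreover have "b \<noteq> 1" using b a(3) by auto
  ultimately have b1: "1 < b" by simp
  define c where "c = min a b"
  have c: "1 < c" "c dvd p" "c * c \<le> p"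
    using a b b1 unfolding c_def min_def by (auto intro!: mult_mono)
  obtain q where q: "prime q" "q dvd c" using prime_divisorE[of c] c(1) by auto
  have "q \<le> c" using q(2) c(1) by (intro zdvd_imp_le) auto
  hence qq: "q * q \<le> p" using c(1,3) prime_ge_0_int[OF q(1)] by (meson mult_mono order_trans less_imp_le)
  have "q < 89"
  proof (rule ccontr)
    assume "\<not> q < 89"
    hence "89 * 89 \<le> q * q" by (intro mult_mono) auto
    thus False using qq assms(2) by linarith
  qed
  hence "q \<in> set small_primes" using q(1) by (intro small_primes_complete)
  thus False using trial[OF _ qq] q(2) c(2) dvd_trans by blast
qed

definition prime_check :: "int \<Rightarrow> bool" where
  "prime_check p \<longleftrightarrow> 1 < p \<and> p < 7921 \<and> list_all (\<lambda>q. if p < q * q then True else p mod q \<noteq> 0) small_primes"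

lemma prime_checkD: "prime_check (int p) \<Longrightarrow> prime p"
proof -
  assume "prime_check (int p)"
  hence "prime (int p)" unfolding prime_check_def list_all_iff
    by (intro prime_trial_division) (auto simp: dvd_eq_mod_eq_0 split: if_splits)
  thus "prime p" using prime_int_nat_transfer[of "int p"] by simp
qed

lemma prime_checks: "list_all prime_check [53, 59, 61, 67, 71, 73, 83, 89, 97, 107, 109, 113, 149, 151, 157, 197, 199, 211, 281, 283, 293, 409, 419, 421, 601, 607, 613, 881, 883, 887]" by code_simp

lemma three_primes_below:
  assumes "66 \<le> n" "n \<le> 1200" "2 * k \<le> n" "n < 3 * k"
  shows "degree_obstruction n k d"
proof -
  have pr: "prime p" if "int p \<in> set [53, 59, 61, 67, 71, 73, 83, 89, 97, 107, 109, 113, 149, 151, 157, 197, 199, 211, 281, 283, 293, 409, 419, 421, 601, 607, 613, 881, 883, 887]" for p :: nat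
    using prime_checks that by (intro prime_checkD) (simp only: list_all_iff)
  have *: ?thesis if "int a \<in> set [53, 59, 61, 67, 71, 73, 83, 89, 97, 107, 109, 113, 149, 151, 157, 197, 199, 211, 281, 283, 293, 409, 419, 421, 601, 607, 613, 881, 883, 887]" "int b \<in> set [53, 59, 61, 67, 71, 73, 83, 89, 97, 107, 109, 113, 149, 151, 157, 197, 199, 211, 281, 283, 293, 409, 419, 421, 601, 607, 613, 881, 883, 887]" "int c \<in> set [53, 59, 61, 67, 71, 73, 83, 89, 97, 107, 109, 113, 149, 151, 157, 197, 199, 211, 281, 283, 293, 409, 419, 421, 601, 607, 613, 881, 883, 887]"
    "a < b" "b < c" "c \<le> n" "2 * n < 3 * a" for a b c
    by (rule obstruction_of_three_primes[OF pr[OF that(1)] pr[OF that(2)] pr[OF that(3)]]) (use that assms in auto)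
  \<comment> \<open>A triple with least prime \<open>a\<close> and greatest prime \<open>c\<close>
    serves all \<open>n\<close> from \<open>c\<close> up to, but not including,
    \<open>3 * a / 2\<close>. The range from 66 to 1200 comes from
    \<open>2 * k \<le> n < 3 * k\<close> with \<open>33 \<le> k \<le> 400\<close>.\<close>
  consider "n \<in> {61..79}" | "n \<in> {73..100}" | "n \<in> {97..124}" | "n \<in> {113..160}" | "n \<in> {157..223}"
    | "n \<in> {211..295}" | "n \<in> {293..421}" | "n \<in> {421..613}" | "n \<in> {613..901}" | "n \<in> {887..1200}"
    using assms(1,2) by force
  thus ?thesis
  proof cases
    case 1 thus ?thesis by (intro *[of 53 59 61]) auto
  next
    case 2 thus ?thesis by (intro *[of 67 71 73]) auto
  next
    case 3 thus ?thesis by (intro *[of 83 89 97]) auto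
  next
    case 4 thus ?thesis by (intro *[of 107 109 113]) auto
  next
    case 5 thus ?thesis by (intro *[of 149 151 157]) auto
  next
    case 6 thus ?thesis by (intro *[of 197 199 211]) auto
  next
    case 7 thus ?thesis by (intro *[of 281 283 293]) auto
  next
    case 8 thus ?thesis by (intro *[of 409 419 421]) auto
  next
    case 9 thus ?thesis by (intro *[of 601 607 613]) auto
  next
    case 10 thus ?thesis by (intro *[of 881 883 887]) auto
  qed
qed

section \<open>Combining the ranges of n and k\<close>

lemma obstruction_below_square:
  assumes k: "15 \<le> k" and n: "2 * k \<le> n" "n < (k + 1)\<^sup>2" and d: "0 < d" "2 * d \<le> k"
  shows "degree_obstruction n k d"
proof -
  have kn: "k \<le> n" "0 < n" using k n by auto
  have gt: ?thesis if "n ^ (2 + card (primes_upto k)) < n choose k"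
    using obstruction_if_binomial_gt[OF kn _ that] n(2) by blast
  have primes: ?thesis if "33 \<le> k" "k \<le> 400" "n < 3 * k"
    using three_primes_below[of n k d] n that by linarith
  \<comment> \<open>The value 15 is odd, so \<open>2 * d < k\<close> there. From 33 to 400 prime
    triples and binomial bounds meet at \<open>n = 3 * k\<close>; above 400 the division is at
    \<open>n^2 = k^3\<close>.\<close>
  consider "k = 15" | "16 \<le> k" "k \<le> 32" "n \<le> 101" | "16 \<le> k" "k \<le> 32" "102 \<le> n" | "33 \<le> k" "k \<le> 49"
    | "50 \<le> k" "k \<le> 400" | "401 \<le> k" using k by linarith
  thus ?thesis
  proof cases
    case 1
    have "n \<le> 285" using n(2) 1 by (simp add: power2_eq_square)
    moreover have "2 * d < k" using d 1 by presburger
    ultimately show ?thesis using 1 n(1) d low_degree_checkD[of 15 285 "[]" n d] low_degree_check_15 by simp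
  next
    case 2
    show ?thesis
    proof (cases "2 * d = k")
      case True
      have "half_degree_check (int d) (4 * int d) 101 []"
        using list_all_upto[OF half_degree_check_8_16, of "int d"] True 2 by simp
      thus ?thesis using half_degree_checkD[of d "4 * d" 101 "[]" n] True 2 n(1) by auto
    next
      case False
      have "low_degree_check (int k) 101 []" using list_all_upto[OF low_degree_check_16_32, of "int k"] 2 by simp
      thus ?thesis using low_degree_checkD[of k 101 "[]" n d] 2 False d n(1) by auto
    qed
  next
    case 3
    have "binomial_check (int k) 102 2" using list_all_upto[OF binomial_check_16_32, of "int k"] 3 by simp
    thus ?thesis using binomial_checkD[of k 102 2 n] 3 gt by auto
  next
    case 4
    have "binomial_check (int k) (3 * int k) 2" using list_all_upto[OF binomial_check_33_49, of "int k"] 4 by simp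
    thus ?thesis using binomial_checkD[of k "3 * k" 2 n] 4 gt primes by (cases "n < 3 * k") auto
  next
    case 5
    thus ?thesis using binomial_gt_medium[of k n] gt primes by (cases "n < 3 * k") auto
  next
    case 6
    show ?thesis
    proof (cases "n\<^sup>2 < k ^ 3")
      case True
      thus ?thesis using 6 n by (intro obstruction_of_large_k) auto
    next
      case False
      thus ?thesis using binomial_gt_far[of k n] 6 kn gt by auto
    qed
  qed
qed

lemma obstruction_above_square:
  assumes k: "15 \<le> k" and n: "(k + 1)\<^sup>2 \<le> n" "n < (k + 1) ^ 3" and d: "0 < d" "2 * d < k"
  shows "degree_obstruction n k d"
proof -
  have kn: "k \<le> n" "0 < n" using k n by (auto simp: power2_eq_square)
  have gt: ?thesis if "n ^ (4 + card (primes_upto k)) < n choose k"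
    using obstruction_if_binomial_gt[OF kn _ that] d by auto
  consider "k = 15" "n \<le> 285" | "k = 15" "286 \<le> n" | "16 \<le> k" "k \<le> 28" | "29 \<le> k" using k by linarith
  thus ?thesis
  proof cases
    case 1
    have "2 * k \<le> n" using 1 n(1) by (simp add: power2_eq_square)
    thus ?thesis using 1 d low_degree_checkD[of 15 285 "[]" n d] low_degree_check_15 by simp
  next
    case 2
    thus ?thesis using binomial_checkD[of 15 286 4 n] binomial_check_15 gt by simp
  next
    case 3
    have "binomial_check (int k) ((int k + 1)\<^sup>2) 4" using list_all_upto[OF binomial_check_16_28, of "int k"] 3 by simp
    hence "binomial_check (int k) (int ((k + 1)\<^sup>2)) 4" by (simp add: add.commute)
    moreover have "k \<le> (k + 1)\<^sup>2" by (simp add: power2_eq_square)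
    ultimately show ?thesis using binomial_checkD[of k "(k + 1)\<^sup>2" 4 n] 3 n(1) gt by simp
  next
    case 4
    thus ?thesis using obstruction_of_large_n[of k n d] n(1) d by simp
  qed
qed

lemma obstruction_half_above_square:
  assumes d: "8 \<le> d" and n: "(2 * d + 1)\<^sup>2 \<le> n" "n < (2 * d + 1) ^ 3"
  shows "degree_obstruction n (2 * d) d"
proof -
  have sq: "(2 * d + 1)\<^sup>2 = 2 * (2 * d\<^sup>2 + 2 * d) + 1" by (simp add: power2_eq_square algebra_simps)
  have dn: "2 * d < n" using n(1) unfolding sq by simp
  have isq: "int ((2 * d + 1)\<^sup>2) = (2 * int d + 1)\<^sup>2" by simp
  have num: ?thesis
    if "half_numeric_check (int d) ((2 * int d + 1)\<^sup>2) (int N)" "d \<le> 32" "N \<le> n div 2" for N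
  proof (rule half_numeric_checkD[of d "(2 * d + 1)\<^sup>2" N n])
    show "(2 * d + 1)\<^sup>2 \<le> n - 1" if "even n"
    proof -
      \<comment> \<open>The square is odd, so an even \<open>n\<close> exceeds it by at least one
        and \<open>n - 1\<close> still reaches it.\<close>
      have "n \<noteq> (2 * d + 1)\<^sup>2" using that unfolding sq by auto
      thus ?thesis using n(1) by linarith
    qed
    show "half_numeric_check (int d) (int ((2 * d + 1)\<^sup>2)) (int N)" unfolding isq by (rule that(1))
  qed (use that(2,3) d dn in auto)
  have chk: ?thesis if "half_degree_check (int d) (int ((2 * d + 1)\<^sup>2)) (int N) []" "N < 6889" "n \<le> N" "d \<le> 32" for N
    using half_degree_checkD[of d "(2 * d + 1)\<^sup>2" N "[]" n] that n(1) d dn by simp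
  have N0: "2 * d\<^sup>2 + 2 * d \<le> n div 2" using n(1) unfolding sq by presburger
  consider "d = 8" | "d = 9" | "d = 10" | "d = 11" | "d = 12" | "d = 13" | "d = 14" | "d = 15" | "16 \<le> d" "d \<le> 32" | "33 \<le> d"
    using d by linarith
  thus ?thesis
  proof cases
    case 1
    thus ?thesis using num[of 144] half_numeric_check_8_15 N0 by simp
  next
    case 2
    thus ?thesis using chk[of 6858] half_degree_check_9 n(2) by simp
  next
    case 3
    thus ?thesis using chk[of 1294] half_degree_check_10 num[of 647] half_numeric_check_8_15 by (cases "n \<le> 1294") auto
  next
    case 4
    thus ?thesis using chk[of 3910] half_degree_check_11 num[of 1955] half_numeric_check_8_15 by (cases "n \<le> 3910") auto
  next
    case 5
    thus ?thesis using chk[of 768] half_degree_check_12 num[of 384] half_numeric_check_8_15 by (cases "n \<le> 768") auto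
  next
    case 6
    thus ?thesis using chk[of 1660] half_degree_check_13 num[of 830] half_numeric_check_8_15 by (cases "n \<le> 1660") auto
  next
    case 7
    thus ?thesis using num[of 420] half_numeric_check_8_15 N0 by simp
  next
    case 8
    thus ?thesis using chk[of 1182] half_degree_check_15 num[of 591] half_numeric_check_8_15 by (cases "n \<le> 1182") auto
  next
    case 9
    have "half_numeric_check (int d) ((2 * int d + 1)\<^sup>2) (2 * (int d)\<^sup>2 + 2 * int d)"
      using list_all_upto[OF half_numeric_check_16_32, of "int d"] 9 by simp
    thus ?thesis using num[of "2 * d\<^sup>2 + 2 * d"] N0 9 by simp
  next
    case 10
    thus ?thesis using obstruction_half_degree_large[of d n] n(1) by simp
  qed
qed

lemma obstruction_large:
  assumes k: "15 \<le> k" and n: "2 * k \<le> n" "n < (k + 1) ^ 3" and d: "0 < d" "2 * d \<le> k"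
  shows "degree_obstruction n k d"
proof (cases "n < (k + 1)\<^sup>2")
  case True
  thus ?thesis using obstruction_below_square k n d by blast
next
  case False
  hence sq: "(k + 1)\<^sup>2 \<le> n" by simp
  show ?thesis
  proof (cases "2 * d = k")
    case True
    have "8 \<le> d" using True k by linarith
    thus ?thesis using obstruction_half_above_square[of d n] sq n(2) unfolding True by blast
  next
    case False
    thus ?thesis using obstruction_above_square[OF k sq n(2) d(1)] d(2) by simp
  qed
qed

text \<open>The discriminant \<open>n^2 - 4 * (n choose 2)\<close> equals
  \<open>- n * (n - 2)\<close> and is negative. Primes above 2 would not do: for
  \<open>n = 4\<close> both \<open>n\<close> and \<open>n - 2\<close> are powers of 2, and the
  middle position is \<open>d\<close> itself.\<close>

lemma irreducible_trunc_binom_poly_2: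
  assumes "4 \<le> n"
  shows "irreducible (trunc_binom_poly n 2)"
proof (rule rat_poly_irreducibleI)
  have deg: "degree (trunc_binom_poly n 2) = 2" using assms by (simp add: degree_trunc_binom_poly)
  thus "0 < degree (trunc_binom_poly n 2)" by simp
  fix g h assume fac: "trunc_binom_poly n 2 = g * h" "0 < degree g" "2 * degree g \<le> degree (trunc_binom_poly n 2)"
  have "poly (trunc_binom_poly n 2) x \<noteq> 0" for x
  proof -
    have c2: "2 * rat_of_nat (n choose 2) = rat_of_nat n * (rat_of_nat n - 1)"
    proof -
      have "even (n * (n - 1))" by (cases "even n") auto
      hence "2 * (n choose 2) = n * (n - 1)" unfolding choose_two by (rule dvd_mult_div_cancel)
      hence "rat_of_nat (2 * (n choose 2)) = rat_of_nat (n * (n - 1))" by (simp only:)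
      thus ?thesis using assms by (simp add: of_nat_diff)
    qed
    have "trunc_binom_poly n 2 = [:1, of_nat n, of_nat (n choose 2):]"
      unfolding trunc_binom_poly_def by (simp add: numeral_2_eq_2 monom_Suc monom_0 del: binomial_Suc_Suc)
    hence "4 * poly (trunc_binom_poly n 2) x = 4 + 4 * (of_nat n * x) + 2 * (2 * of_nat (n choose 2)) * x\<^sup>2"
      by (simp add: power2_eq_square algebra_simps)
    also have "\<dots> = (2 + of_nat n * x)\<^sup>2 + of_nat n * (of_nat n - 2) * x\<^sup>2"
      unfolding c2 by (simp add: power2_eq_square algebra_simps)
    also have "\<dots> > 0"
    proof (cases "x = 0")
      case False
      have "4 \<le> rat_of_nat n" using assms by simp
      hence "0 < of_nat n * (of_nat n - 2) * x\<^sup>2" using False by (intro mult_pos_pos) auto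
      thus ?thesis by (intro add_nonneg_pos) auto
    qed simp
    finally show ?thesis by auto
  qed
  hence "degree g \<noteq> 1" using fac(1) by (rule trunc_binom_poly_no_linear_factor)
  thus False using fac(2,3) unfolding deg by linarith
qed

text \<open>Among 12 down to 6 only 11 and 7 have a prime factor above 6. Their positions 1 and 5
  are \<open>d\<close> and \<open>k - d\<close> for \<open>d = 1\<close>, so a linear factor is
  excluded by positivity, while 11 excludes the degrees 2 and 3.\<close>

lemma irreducible_trunc_binom_poly_12_6: "irreducible (trunc_binom_poly 12 6)"
proof (rule rat_poly_irreducibleI)
  have deg: "degree (trunc_binom_poly 12 6) = 6" by (simp add: degree_trunc_binom_poly)
  thus "0 < degree (trunc_binom_poly 12 6)" by simp
  fix g h assume fac: "trunc_binom_poly 12 6 = g * h" "0 < degree g" "2 * degree g \<le> degree (trunc_binom_poly 12 6)"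
  have "degree g \<noteq> 1"
    using pos_trunc_binom_poly_12_6 fac(1) by (intro trunc_binom_poly_no_linear_factor) (auto simp: less_le)
  hence d: "degree g = 2 \<or> degree g = 3" using fac(2,3) unfolding deg by linarith
  have "degree_obstruction 12 6 (degree g)"
    unfolding degree_obstruction_def using d by (intro exI[of _ 1] exI[of _ 11]) auto
  moreover have "\<not> degree_obstruction 12 6 (degree g)"
    by (rule degree_obstruction_no_factor[OF _ _ fac(1,2)]) (use fac(3) deg in auto)
  ultimately show False by contradiction
qed

theorem theorem1p1:
  fixes k n :: nat
  assumes "k > 0" and "n > 0" and "2 * k \<le> n" and "n < (k + 1) ^ 3"
  shows "irreducible (trunc_binom_poly n k)"
proof -
  have main: ?thesis if "\<And>d. 0 < d \<Longrightarrow> 2 * d \<le> k \<Longrightarrow> degree_obstruction n k d"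
    using that assms by (intro trunc_binom_poly_irreducibleI) auto
  consider "k = 1" | "k = 2" | "3 \<le> k" "k \<le> 14" | "15 \<le> k" using assms(1) by linarith
  thus ?thesis
  proof cases
    case 1
    show ?thesis by (rule main) (use 1 in simp)
  next
    case 2
    thus ?thesis using irreducible_trunc_binom_poly_2 assms(3) by simp
  next
    case 3
    show ?thesis
    proof (cases "n \<in> set (exceptional k)")
      case True
      hence "(n, k) \<in> {(6, 3), (9, 3), (12, 3), (27, 3), (8, 4), (10, 5), (12, 6), (16, 8)}"
        unfolding exceptional_def by (auto split: if_splits)
      thus ?thesis
        using irreducible_trunc_binom_poly_6_3 irreducible_trunc_binom_poly_9_3 irreducible_trunc_binom_poly_12_3
          irreducible_trunc_binom_poly_27_3 irreducible_trunc_binom_poly_8_4 irreducible_trunc_binom_poly_10_5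
          irreducible_trunc_binom_poly_12_6 irreducible_trunc_binom_poly_16_8 by auto
    next
      case False
      show ?thesis by (rule main) (rule obstruction_small[OF 3 assms(3,4)], use False in auto)
    qed
  next
    case 4
    show ?thesis by (rule main) (rule obstruction_large[OF 4 assms(3,4)])
  qed
qed

end
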